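(* Let $\Omega\subset\mathbb{R}^d$ ($d=2,3$) be a bounded polyhedral domain, $\psi\in H^1_0(\Omega)\cap H^2(\Omega)$, $y_0,f\in L^2(\Omega)$, $\alpha>0$, $\gamma>0$, and let $\mathcal T_h$ be an admissible triangulation of $\Omega$ with interior vertices $x_1,\dots,x_n$, finite element spaces $X_h$, $X_{h0}$ and Lagrange interpolation operator $I_h$ as described in the context. Suppose that $(u_h,y_h,p_h)\in L^2(\Omega)\times X_{h0}\times X_{h0}$ satisfies $$\int_\Omega \nabla y_h\cdot\nabla\phi_h\,dx+\gamma^3\int_\Omega I_h\{[(y_h-\psi)^-]^3\phi_h\}\,dx=\int_\Omega (f+u_h)\phi_h\,dx\quad\forall\phi_h\in X_{h0},$$ $$\int_\Omega \nabla p_h\cdot\nabla\phi_h\,dx+3\gamma^3\int_\Omega I_h\{[(y_h-\psi)^-]^2p_h\phi_h\}\,dx=\int_\Omega (y_h-y_0)\phi_h\,dx\quad\forall\phi_h\in X_{h0},$$ $$\alpha u_h+p_h=0\quad\text{in }\Omega.$$ Write $y_j=y_h(x_j)$, $p_j=p_h(x_j)$, $\psi_j=\psi(x_j)$ for $j=1,\dots,n$, and suppose moreover that $$p_k\ge 0\quad\text{for all }k\in\{1,\dots,n\}\text{ with }y_k-\psi_k=0.$$ Define $$\eta:=\min\Bigl(\min_{y_j>\psi_j}\frac{p_j}{y_j-\psi_j},\ \min_{y_j<\psi_j}\frac{3p_j}{\psi_j-y_j},\ 0\Bigr),$$ where the inner minima are over $j\in\{1,\dots,n\}$ with the indicated property.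 If $$|\eta|\le \alpha\lambda_1+\sqrt{\alpha^2\lambda_1^2+\alpha},$$ then $u_h$ is a global minimum of problem $(\mathbb P^\gamma_h)$. If this inequality is strict, then $u_h$ is the unique global minimum of $(\mathbb P^\gamma_h)$.
   Context: Notation: $a^-=\min(a,0)$. The function $\psi\in H^2(\Omega)$ is identified with its continuous representative on $\bar\Omega$ (recall $d\le 3$). Triangulation: $\mathcal T_h$ is an admissible (conforming) simplicial triangulation, $\bar\Omega=\bigcup_{T\in\mathcal T_h}\bar T$, with interior vertices $x_1,\dots,x_n$ and boundary vertices $x_{n+1},\dots,x_{n+m}$. $X_h=\{v_h\in C^0(\bar\Omega): v_h\text{ is a linear polynomial on each }T\in\mathcal T_h\}$ (polynomials of degree at most one), $X_{h0}=X_h\cap H^1_0(\Omega)$. The nodal basis functions $\phi_i\in X_h$ satisfy $\phi_i(x_j)=\delta_{ij}$, $i,j=1,\dots,n+m$. The Lagrange interpolation operator is $I_h:C^0(\bar\Omega)\to X_h$, $I_hy=\sum_{j=1}^{n+m}y(x_j)\phi_j$. Problem $(\mathbb P^\gamma_h)$: minimise over $u\in L^2(\Omega)$ the functional $J^\gamma_h(u)=\frac12\|y_h-y_0\|_{L^2(\Omega)}^2+\frac\alpha2\|u\|_{L^2(\Omega)}^2$, where $y_h\in X_{h0}$ is the unique solution of $$\int_\Omega \nabla y_h\cdot\nabla\phi_h\,dx+\gamma^3\int_\Omega I_h\{[(y_h-\psi)^-]^3\phi_h\}\,dx=\int_\Omega (f+u)\phi_h\,dx\quad\forall\phi_h\in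 X_{h0}.$$ A global minimum is a $u_h\in L^2(\Omega)$ with $J^\gamma_h(u_h)\le J^\gamma_h(v)$ for all $v\in L^2(\Omega)$. $\lambda_1=\inf_{\phi\in H^1_0(\Omega)\setminus\{0\}}\frac{\int_\Omega|\nabla\phi|^2dx}{\int_\Omega\phi^2dx}$ is the smallest eigenvalue of $-\Delta$ in $\Omega$ with homogeneous Dirichlet boundary conditions. Convention: a minimum over an empty index set is $+\infty$ (i.e. is omitted). *)

theory Defs
  imports "HOL-Analysis.Analysis"
begin

section \<open>Sobolev spaces\<close>

text \<open>
  Elements of \<open>L\<^sup>2(\<Omega>)\<close>, \<open>H\<^sup>k(\<Omega>)\<close> and \<open>H\<^sup>1\<^sub>0(\<Omega>)\<close> are represented by total functions of which only the
  values on \<open>\<Omega>\<close> matter; equality in these spaces is equality almost everywhere on \<open>\<Omega>\<close>.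
\<close>

definition L2_space :: "'a::euclidean_space set \<Rightarrow> ('a \<Rightarrow> real) set" where
  "L2_space \<Omega> = {u \<in> borel_measurable (lebesgue_on \<Omega>). integrable (lebesgue_on \<Omega>) (\<lambda>x. (u x)\<^sup>2)}"

definition L2_norm :: "'a::euclidean_space set \<Rightarrow> ('a \<Rightarrow> real) \<Rightarrow> real" where
  "L2_norm \<Omega> u = sqrt (\<integral>x. (u x)\<^sup>2 \<partial>lebesgue_on \<Omega>)"

definition pderiv_dir :: "'a::euclidean_space \<Rightarrow> ('a \<Rightarrow> real) \<Rightarrow> 'a \<Rightarrow> real" where
  "pderiv_dir b f x = frechet_derivative f (at x) b"

text \<open>
  All iterated partial derivatives are (Frechet) differentiable everywhere; hence they are also
  continuous, so this is \<open>C\<^sup>\<infinity>\<close>.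
\<close>

definition smooth_fun :: "('a::euclidean_space \<Rightarrow> real) \<Rightarrow> bool" where
  "smooth_fun f \<longleftrightarrow>
     (\<forall>bs. set bs \<subseteq> Basis \<longrightarrow> (\<forall>x. (fold pderiv_dir bs f) differentiable (at x)))"

definition test_funs :: "'a::euclidean_space set \<Rightarrow> ('a \<Rightarrow> real) set" where
  "test_funs \<Omega> =
     {\<phi>. smooth_fun \<phi> \<and> (\<exists>K. compact K \<and> K \<subseteq> \<Omega> \<and> (\<forall>x. x \<notin> K \<longrightarrow> \<phi> x = 0))}"

definition has_weak_pderiv ::
  "'a::euclidean_space set \<Rightarrow> 'a \<Rightarrow> ('a \<Rightarrow> real) \<Rightarrow> ('a \<Rightarrow> real) \<Rightarrow> bool" where
  "has_weak_pderiv \<Omega> b f g \<longleftrightarrow>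
     (\<forall>\<phi>\<in>test_funs \<Omega>.
        (\<integral>x. f x * pderiv_dir b \<phi> x \<partial>lebesgue_on \<Omega>) = - (\<integral>x. g x * \<phi> x \<partial>lebesgue_on \<Omega>))"

text \<open>\<open>sobolev k \<Omega>\<close> is \<open>H\<^sup>k(\<Omega>) = W\<^sup>k\<^sup>,\<^sup>2(\<Omega>)\<close>.\<close>

primrec sobolev :: "nat \<Rightarrow> 'a::euclidean_space set \<Rightarrow> ('a \<Rightarrow> real) set" where
  "sobolev 0 \<Omega> = L2_space \<Omega>"
| "sobolev (Suc k) \<Omega> =
     {f \<in> L2_space \<Omega>. \<forall>b\<in>Basis. \<exists>g\<in>sobolev k \<Omega>. has_weak_pderiv \<Omega> b f g}"

definition is_weak_grad ::
  "'a::euclidean_space set \<Rightarrow> ('a \<Rightarrow> real) \<Rightarrow> ('a \<Rightarrow> 'a) \<Rightarrow> bool" where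
  "is_weak_grad \<Omega> f g \<longleftrightarrow>
     (\<forall>b\<in>Basis. (\<lambda>x. g x \<bullet> b) \<in> L2_space \<Omega> \<and> has_weak_pderiv \<Omega> b f (\<lambda>x. g x \<bullet> b))"

text \<open>
  The weak gradient of \<open>f \<in> H\<^sup>1(\<Omega>)\<close>. It is unique only up to null sets, hence the choice operator;
  it is only used under integrals over \<open>\<Omega>\<close>.
\<close>

definition weak_grad :: "'a::euclidean_space set \<Rightarrow> ('a \<Rightarrow> real) \<Rightarrow> 'a \<Rightarrow> 'a" where
  "weak_grad \<Omega> f = (SOME g. is_weak_grad \<Omega> f g)"

definition dirichlet_form ::
  "'a::euclidean_space set \<Rightarrow> ('a \<Rightarrow> real) \<Rightarrow> ('a \<Rightarrow> real) \<Rightarrow> real" where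
  "dirichlet_form \<Omega> v w = (\<integral>x. weak_grad \<Omega> v x \<bullet> weak_grad \<Omega> w x \<partial>lebesgue_on \<Omega>)"

definition H1_norm :: "'a::euclidean_space set \<Rightarrow> ('a \<Rightarrow> real) \<Rightarrow> real" where
  "H1_norm \<Omega> v = sqrt ((L2_norm \<Omega> v)\<^sup>2 + dirichlet_form \<Omega> v v)"

text \<open>\<open>H\<^sup>1\<^sub>0(\<Omega>)\<close> is the closure of the test functions in \<open>H\<^sup>1(\<Omega>)\<close>.\<close>

definition H10_space :: "'a::euclidean_space set \<Rightarrow> ('a \<Rightarrow> real) set" where
  "H10_space \<Omega> =
     {v \<in> sobolev 1 \<Omega>. \<exists>\<phi>::nat \<Rightarrow> 'a \<Rightarrow> real. (\<forall>k. \<phi> k \<in> test_funs \<Omega>) \<and>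
        (\<lambda>k. H1_norm \<Omega> (\<lambda>x. v x - \<phi> k x)) \<longlonglongrightarrow> 0}"

definition lambda1 :: "'a::euclidean_space set \<Rightarrow> real" where
  "lambda1 \<Omega> =
     (INF \<phi> \<in> {\<phi> \<in> H10_space \<Omega>. \<not> (AE x in lebesgue_on \<Omega>. \<phi> x = 0)}.
        dirichlet_form \<Omega> \<phi> \<phi> / (\<integral>x. (\<phi> x)\<^sup>2 \<partial>lebesgue_on \<Omega>))"

section \<open>Polyhedral domains and triangulations\<close>

text \<open>
  The condition \<open>interior (closure \<Omega>) = \<Omega>\<close> says that \<open>\<Omega>\<close> lies on one side of its boundary; it rules
  out slits and punctures, which could not be seen by a triangulation of \<open>closure \<Omega>\<close>. No Lipschitz
  condition is imposed.
\<close>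

definition polyhedral_domain :: "'a::euclidean_space set \<Rightarrow> bool" where
  "polyhedral_domain \<Omega> \<longleftrightarrow>
     open \<Omega> \<and> connected \<Omega> \<and> \<Omega> \<noteq> {} \<and> interior (closure \<Omega>) = \<Omega> \<and>
     (\<exists>\<P>. finite \<P> \<and> (\<forall>P\<in>\<P>. polyhedron P) \<and> closure \<Omega> = \<Union>\<P>)"

text \<open>
  The elements are closed simplices of full dimension. The library's notion of triangulation
  contains the conformity condition: two elements meet in a common face (possibly empty).
\<close>

definition admissible_triangulation :: "'a::euclidean_space set \<Rightarrow> 'a set set \<Rightarrow> bool" where
  "admissible_triangulation \<Omega> \<T> \<longleftrightarrow>
     triangulation \<T> \<and> (\<forall>T\<in>\<T>. int DIM('a) simplex T) \<and> closure \<Omega> = \<Union>\<T>"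

text \<open>
  Instead of numbering the vertices, they serve as their own indices: sums, minima and quantifiers
  over \<open>j\<close> range over the finite set of vertices \<open>x\<^sub>j\<close>.
\<close>

definition vertices :: "'a::euclidean_space set set \<Rightarrow> 'a set" where
  "vertices \<T> = {z. \<exists>T\<in>\<T>. z extreme_point_of T}"

definition interior_vertices :: "'a::euclidean_space set \<Rightarrow> 'a set set \<Rightarrow> 'a set" where
  "interior_vertices \<Omega> \<T> = vertices \<T> \<inter> \<Omega>"

section \<open>Finite element spaces\<close>

text \<open>
  Functions on \<open>closure \<Omega>\<close> are represented by total functions; finite element functions are
  normalised to vanish outside \<open>closure \<Omega>\<close>, so that they are equal iff they agree on \<open>closure \<Omega>\<close>.
\<close>

definition FE_space :: "'a::euclidean_space set \<Rightarrow> 'a set set \<Rightarrow> ('a \<Rightarrow> real) set" where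
  "FE_space \<Omega> \<T> =
     {v. continuous_on (closure \<Omega>) v \<and>
         (\<forall>T\<in>\<T>. \<exists>a c. \<forall>x\<in>T. v x = a \<bullet> x + c) \<and>
         (\<forall>x. x \<notin> closure \<Omega> \<longrightarrow> v x = 0)}"

definition FE_space0 :: "'a::euclidean_space set \<Rightarrow> 'a set set \<Rightarrow> ('a \<Rightarrow> real) set" where
  "FE_space0 \<Omega> \<T> = FE_space \<Omega> \<T> \<inter> H10_space \<Omega>"

definition nodal_basis :: "'a::euclidean_space set \<Rightarrow> 'a set set \<Rightarrow> 'a \<Rightarrow> 'a \<Rightarrow> real" where
  "nodal_basis \<Omega> \<T> z =
     (THE v. v \<in> FE_space \<Omega> \<T> \<and> (\<forall>z'\<in>vertices \<T>. v z' = (if z' = z then 1 else 0)))"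

definition lagrange_interp ::
  "'a::euclidean_space set \<Rightarrow> 'a set set \<Rightarrow> ('a \<Rightarrow> real) \<Rightarrow> 'a \<Rightarrow> real" where
  "lagrange_interp \<Omega> \<T> y = (\<lambda>x. \<Sum>z\<in>vertices \<T>. y z * nodal_basis \<Omega> \<T> z x)"

section \<open>The discrete control problem\<close>

definition neg_part :: "real \<Rightarrow> real" where
  "neg_part a = min a 0"

definition discrete_state ::
  "'a::euclidean_space set \<Rightarrow> 'a set set \<Rightarrow> real \<Rightarrow> ('a \<Rightarrow> real) \<Rightarrow> ('a \<Rightarrow> real)
     \<Rightarrow> ('a \<Rightarrow> real) \<Rightarrow> ('a \<Rightarrow> real) \<Rightarrow> bool" where
  "discrete_state \<Omega> \<T> \<gamma> \<psi> f u y \<longleftrightarrow>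
     y \<in> FE_space0 \<Omega> \<T> \<and>
     (\<forall>\<phi>\<in>FE_space0 \<Omega> \<T>.
        dirichlet_form \<Omega> y \<phi>
        + \<gamma>^3 * (\<integral>x. lagrange_interp \<Omega> \<T> (\<lambda>\<xi>. (neg_part (y \<xi> - \<psi> \<xi>))^3 * \<phi> \<xi>) x \<partial>lebesgue_on \<Omega>)
        = (\<integral>x. (f x + u x) * \<phi> x \<partial>lebesgue_on \<Omega>))"

definition discrete_adjoint ::
  "'a::euclidean_space set \<Rightarrow> 'a set set \<Rightarrow> real \<Rightarrow> ('a \<Rightarrow> real) \<Rightarrow> ('a \<Rightarrow> real)
     \<Rightarrow> ('a \<Rightarrow> real) \<Rightarrow> ('a \<Rightarrow> real) \<Rightarrow> bool" where
  "discrete_adjoint \<Omega> \<T> \<gamma> \<psi> y\<^sub>0 y p \<longleftrightarrow>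
     p \<in> FE_space0 \<Omega> \<T> \<and>
     (\<forall>\<phi>\<in>FE_space0 \<Omega> \<T>.
        dirichlet_form \<Omega> p \<phi>
        + 3 * \<gamma>^3 * (\<integral>x. lagrange_interp \<Omega> \<T> (\<lambda>\<xi>. (neg_part (y \<xi> - \<psi> \<xi>))\<^sup>2 * p \<xi> * \<phi> \<xi>) x \<partial>lebesgue_on \<Omega>)
        = (\<integral>x. (y x - y\<^sub>0 x) * \<phi> x \<partial>lebesgue_on \<Omega>))"

definition discrete_cost ::
  "'a::euclidean_space set \<Rightarrow> 'a set set \<Rightarrow> real \<Rightarrow> real \<Rightarrow> ('a \<Rightarrow> real) \<Rightarrow> ('a \<Rightarrow> real)
     \<Rightarrow> ('a \<Rightarrow> real) \<Rightarrow> ('a \<Rightarrow> real) \<Rightarrow> real" where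
  "discrete_cost \<Omega> \<T> \<gamma> \<alpha> \<psi> f y\<^sub>0 u =
     (let y = (THE y. discrete_state \<Omega> \<T> \<gamma> \<psi> f u y)
      in 1/2 * (L2_norm \<Omega> (\<lambda>x. y x - y\<^sub>0 x))\<^sup>2 + \<alpha>/2 * (L2_norm \<Omega> u)\<^sup>2)"

definition global_minimum ::
  "'a::euclidean_space set \<Rightarrow> 'a set set \<Rightarrow> real \<Rightarrow> real \<Rightarrow> ('a \<Rightarrow> real) \<Rightarrow> ('a \<Rightarrow> real)
     \<Rightarrow> ('a \<Rightarrow> real) \<Rightarrow> ('a \<Rightarrow> real) \<Rightarrow> bool" where
  "global_minimum \<Omega> \<T> \<gamma> \<alpha> \<psi> f y\<^sub>0 u \<longleftrightarrow>
     u \<in> L2_space \<Omega> \<and>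
     (\<forall>v\<in>L2_space \<Omega>. discrete_cost \<Omega> \<T> \<gamma> \<alpha> \<psi> f y\<^sub>0 u \<le> discrete_cost \<Omega> \<T> \<gamma> \<alpha> \<psi> f y\<^sub>0 v)"

end

theory Submission
  imports Defs
begin

text \<open>
  Let \<open>u\<close>, \<open>y\<close>, \<open>p\<close> satisfy the optimality system, let \<open>v\<close> be another control with state \<open>y'\<close>, and
  put \<open>e = y' - y\<close> and \<open>w = v - u\<close>. Interpolation turns the penalty term into a finite sum: with
  \<open>g t = (neg_part t)\<^sup>3\<close> and the nodal weights \<open>\<omega> z\<close>, the integrals of the nodal basis functions, it is
  the sum of \<open>\<gamma>\<^sup>3 \<cdot> \<omega> z \<cdot> g (y z - \<psi> z) \<cdot> \<phi> z\<close> over the vertices \<open>z\<close>. Expanding the quadratic cost and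
  inserting the adjoint equation tested with \<open>e\<close> and the difference of the state equations tested
  with \<open>p\<close> gives
  \<open>J v - J u = \<parallel>e\<parallel>\<^sup>2 / 2 + \<alpha> / 2 \<cdot> \<parallel>w\<parallel>\<^sup>2 - (\<Sum>z. \<gamma>\<^sup>3 \<cdot> \<omega> z \<cdot> p z \<cdot> R z)\<close>,
  where \<open>R z\<close> is the first-order Taylor remainder of \<open>g\<close> between \<open>a = y z - \<psi> z\<close> and \<open>b = y' z - \<psi> z\<close>.
  The function \<open>g\<close> is nondecreasing and concave, and the remainder is dominated by its monotonicity:
  the sign condition on \<open>p\<close> and the definition of \<open>\<eta>\<close> give
  \<open>p z \<cdot> R z \<le> \<bar>\<eta>\<bar> \<cdot> (g b - g a) \<cdot> (b - a)\<close> (\<open>neg_part_cube_remainder_le\<close>). The weighted sum of the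
  right-hand sides appears in the difference of the state equations tested with \<open>e\<close>; it equals
  \<open>\<integral> w \<cdot> e\<close> minus the Dirichlet energy of \<open>e\<close>, and that energy is at least \<open>\<lambda>\<^sub>1 \<cdot> \<parallel>e\<parallel>\<^sup>2\<close>. What remains is a
  quadratic form in \<open>e\<close> and \<open>w\<close>; completing the square (\<open>cost_gap\<close>) shows that it is nonnegative as soon
  as \<open>\<eta>\<^sup>2 \<le> 2 \<cdot> \<bar>\<eta>\<bar> \<cdot> \<alpha> \<cdot> \<lambda>\<^sub>1 + \<alpha>\<close>, and definite if the inequality is strict. Solving for \<open>\<bar>\<eta>\<bar>\<close> gives the bound
  of the theorem (\<open>quadratic_threshold\<close>).

  Three ingredients of this computation need analysis.

  The Dirichlet form must be bilinear. The weak gradient of a function is selected by a choice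
  operator, so this rests on its uniqueness almost everywhere, hence on a supply of smooth functions
  with compact support: their pointwise limits include the indicators of all open sets
  (\<open>test_funs_tendsto_indicator\<close>).

  The sign condition and \<open>\<eta>\<close> only speak about interior vertices, so \<open>e\<close> has to vanish at the vertices on
  the boundary. For \<open>v\<close> in \<open>H\<^sup>1\<^sub>0(\<Omega>)\<close>,
  extended by zero, the squared \<open>L\<^sup>2\<close> distance to its translate by \<open>s\<close> is at most a multiple of
  \<open>\<bar>s\<bar>\<^sup>2\<close> times the Dirichlet energy (\<open>H10_translation_le\<close>), whereas a jump along a piece of the boundary
  would make that quantity decay only linearly in \<open>\<bar>s\<bar>\<close> (\<open>H10_continuous_zero_on_frontier\<close>). The same
  estimate with a translation that moves \<open>\<Omega>\<close> off itself yields the definiteness of the Dirichlet form.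

  The cost of a control refers to its unique state. Uniqueness is monotonicity of \<open>g\<close>; a state exists
  because it is the minimiser of a coercive energy on a finite-dimensional space
  (\<open>semilinear_equation_solvable\<close>).
\<close>

section \<open>Smooth cut-off functions\<close>

text \<open>
  The classical flat function \<open>exp (- 1 / t)\<close> is the case \<open>k = 0\<close>. The powers of \<open>1 / t\<close> are included
  because differentiation produces them: the linear span of the family is closed under derivatives.
\<close>

definition flat_exp :: "nat \<Rightarrow> real \<Rightarrow> real" where
  "flat_exp k t = (if t > 0 then (1 / t) ^ k * exp (- (1 / t)) else 0)"

lemma flat_exp_tendsto_0: "((\<lambda>t. flat_exp k t) \<longlongrightarrow> 0) (at_right 0)"
proof -
  have "((\<lambda>s::real. s ^ k / exp s) \<longlongrightarrow> 0) at_top"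
    by (rule tendsto_power_div_exp_0)
  then have "((\<lambda>t::real. (inverse t) ^ k / exp (inverse t)) \<longlongrightarrow> 0) (at_right 0)"
    by (rule filterlim_compose[OF _ filterlim_inverse_at_top_right])
  then show ?thesis
    by (rule Lim_transform_eventually)
       (auto simp: flat_exp_def exp_minus divide_simps eventually_at_filter)
qed

text \<open>
  The only delicate point is \<open>t = 0\<close>, where the difference quotient of the \<open>k\<close>-th function from the
  right is the \<open>(k + 1)\<close>-st function, which tends to \<open>0\<close>.
\<close>

lemma flat_exp_deriv:
  "(flat_exp k has_real_derivative (flat_exp (k + 2) t - real k * flat_exp (k + 1) t)) (at t)"
proof -
  consider "t > 0" | "t < 0" | "t = 0" by linarith
  then show ?thesis
  proof cases
    case 1
    have D: "((\<lambda>t. (1 / t) ^ k * exp (- (1 / t))) has_real_derivative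
          (flat_exp (k + 2) t - real k * flat_exp (k + 1) t)) (at t)"
      using 1
    proof (cases k)
      case (Suc m)
      show ?thesis
        unfolding Suc using 1
        by (auto intro!: derivative_eq_intros simp: flat_exp_def power2_eq_square)
           (cases m; simp add: field_simps)
    qed (use 1 in \<open>auto intro!: derivative_eq_intros simp: flat_exp_def power2_eq_square\<close>)
    show ?thesis
      by (rule has_field_derivative_transform_within_open[OF D, of "{0<..}"])
         (use 1 in \<open>auto simp: flat_exp_def\<close>)
  next
    case 2
    have D: "((\<lambda>t. 0) has_real_derivative
          (flat_exp (k + 2) t - real k * flat_exp (k + 1) t)) (at t)"
      using 2 by (auto simp: flat_exp_def)
    show ?thesis
      by (rule has_field_derivative_transform_within_open[OF D, of "{..<0}"])
         (use 2 in \<open>auto simp: flat_exp_def\<close>)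
  next
    case 3
    have "((\<lambda>h. flat_exp k h / h) \<longlongrightarrow> 0) (at_right 0)"
      by (rule Lim_transform_eventually[OF flat_exp_tendsto_0[of "Suc k"]])
         (auto simp: flat_exp_def eventually_at_filter)
    moreover have "((\<lambda>h. flat_exp k h / h) \<longlongrightarrow> 0) (at_left 0)"
      by (rule Lim_transform_eventually[OF tendsto_const])
         (auto simp: flat_exp_def eventually_at_filter)
    ultimately have "((\<lambda>h. flat_exp k h / h) \<longlongrightarrow> 0) (at 0)"
      by (rule filterlim_split_at[rotated])
    then show ?thesis
      using 3 by (simp add: DERIV_def flat_exp_def)
  qed
qed

lemma flat_exp_bounds: "0 \<le> flat_exp 0 t" "flat_exp 0 t \<le> 1"
  by (auto simp: flat_exp_def)

text \<open>
  Steepening the flat function makes it converge to the indicator of the positive reals while it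
  stays between \<open>0\<close> and \<open>1\<close>, as dominated convergence requires.
\<close>

lemma flat_exp_tendsto_1: "t > 0 \<Longrightarrow> (\<lambda>n. flat_exp 0 (real (Suc n) * t)) \<longlonglongrightarrow> 1"
proof -
  assume t: "t > 0"
  have "(\<lambda>n. exp (- (inverse (real (Suc n)) * (1 / t)))) \<longlonglongrightarrow> exp (- (0 * (1 / t)))"
    by (intro tendsto_intros LIMSEQ_inverse_real_of_nat)
  then show ?thesis
    using t by (simp add: flat_exp_def divide_inverse)
qed

text \<open>
  Smoothness in the sense of iterated partial derivatives is awkward to establish for products and
  compositions one at a time. It is easier for a whole algebra at once: all its members are
  differentiable, and all partial derivatives stay inside the algebra.
\<close>

inductive_set smooth_algebra :: "('a::euclidean_space \<Rightarrow> real) set" where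
  const: "(\<lambda>x. c) \<in> smooth_algebra"
| inner: "(\<lambda>x. x \<bullet> v) \<in> smooth_algebra"
| add: "f \<in> smooth_algebra \<Longrightarrow> g \<in> smooth_algebra \<Longrightarrow> (\<lambda>x. f x + g x) \<in> smooth_algebra"
| mult: "f \<in> smooth_algebra \<Longrightarrow> g \<in> smooth_algebra \<Longrightarrow> (\<lambda>x. f x * g x) \<in> smooth_algebra"
| flat: "f \<in> smooth_algebra \<Longrightarrow> (\<lambda>x. flat_exp k (f x)) \<in> smooth_algebra"

lemma pderiv_dir_eqI:
  assumes "\<And>x. (f has_derivative f' x) (at x)"
  shows "pderiv_dir b f = (\<lambda>x. f' x b)"
proof
  fix x
  show "pderiv_dir b f x = f' x b"
    unfolding pderiv_dir_def using frechet_derivative_at[OF assms[of x]] by simp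
qed

lemma smooth_algebra_deriv:
  "f \<in> smooth_algebra \<Longrightarrow>
     \<exists>f'. (\<forall>x. (f has_derivative f' x) (at x)) \<and> (\<forall>b. (\<lambda>x. f' x b) \<in> smooth_algebra)"
proof (induction rule: smooth_algebra.induct)
  case (const c)
  show ?case by (intro exI[of _ "\<lambda>x b. 0"]) (auto intro: smooth_algebra.const)
next
  case (inner v)
  show ?case
    by (intro exI[of _ "\<lambda>x b. b \<bullet> v"]) (auto intro!: smooth_algebra.const derivative_eq_intros)
next
  case (add f g)
  then obtain f' g' where "\<And>x. (f has_derivative f' x) (at x)" "\<And>b. (\<lambda>x. f' x b) \<in> smooth_algebra"
    "\<And>x. (g has_derivative g' x) (at x)" "\<And>b. (\<lambda>x. g' x b) \<in> smooth_algebra"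
    by blast
  then show ?case
    by (intro exI[of _ "\<lambda>x b. f' x b + g' x b"])
       (auto intro!: smooth_algebra.add derivative_eq_intros)
next
  case (mult f g)
  then obtain f' g' where "\<And>x. (f has_derivative f' x) (at x)" "\<And>b. (\<lambda>x. f' x b) \<in> smooth_algebra"
    "\<And>x. (g has_derivative g' x) (at x)" "\<And>b. (\<lambda>x. g' x b) \<in> smooth_algebra"
    by blast
  with mult show ?case
    by (intro exI[of _ "\<lambda>x b. f x * g' x b + f' x b * g x"])
       (auto intro!: smooth_algebra.add smooth_algebra.mult has_derivative_mult)
next
  case (flat f k)
  then obtain f' where f': "\<And>x. (f has_derivative f' x) (at x)" "\<And>b. (\<lambda>x. f' x b) \<in> smooth_algebra"
    by blast
  have "((\<lambda>x. flat_exp k (f x)) has_derivative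
      (\<lambda>b. (flat_exp (k + 2) (f x) + (- real k) * flat_exp (k + 1) (f x)) * f' x b)) (at x)" for x
    using has_derivative_compose[OF f'(1) flat_exp_deriv[unfolded has_field_derivative_def]]
    by auto
  moreover have "(\<lambda>x. (flat_exp (k + 2) (f x) + (- real k) * flat_exp (k + 1) (f x)) * f' x b) \<in> smooth_algebra" for b
    by (intro smooth_algebra.intros flat f')
  ultimately show ?case
    by (intro exI[of _ "\<lambda>x b. (flat_exp (k + 2) (f x) + (- real k) * flat_exp (k + 1) (f x)) * f' x b"]) auto
qed

lemma smooth_algebra_imp_smooth_fun:
  assumes "f \<in> smooth_algebra"
  shows "smooth_fun f"
proof -
  have "fold pderiv_dir bs f \<in> smooth_algebra" for bs
    using assms
  proof (induction bs arbitrary: f)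
    case (Cons b bs)
    then show ?case
      using smooth_algebra_deriv[OF Cons.prems] pderiv_dir_eqI by fastforce
  qed simp
  then show ?thesis
    unfolding smooth_fun_def differentiable_def using smooth_algebra_deriv by blast
qed

lemma smooth_algebra_prod:
  "finite I \<Longrightarrow> (\<And>i. i \<in> I \<Longrightarrow> f i \<in> smooth_algebra) \<Longrightarrow> (\<lambda>x. \<Prod>i\<in>I. f i x) \<in> smooth_algebra"
  by (induction rule: finite_induct) (auto intro: smooth_algebra.intros)

section \<open>Test functions\<close>

lemma smooth_fun_differentiable: "smooth_fun f \<Longrightarrow> f differentiable (at x)"
  unfolding smooth_fun_def by (auto dest: spec[of _ "[]"])

lemma smooth_fun_pderiv: "smooth_fun f \<Longrightarrow> b \<in> Basis \<Longrightarrow> smooth_fun (pderiv_dir b f)"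
  unfolding smooth_fun_def by (intro allI impI) (drule_tac x = "b # bs" in spec, auto)

lemma smooth_fun_continuous: "smooth_fun f \<Longrightarrow> continuous_on S f"
  by (meson differentiable_imp_continuous_within continuous_at_imp_continuous_on smooth_fun_differentiable)

lemma pderiv_dir_lin:
  assumes "\<And>x. f differentiable (at x)" "\<And>x. g differentiable (at x)"
  shows "pderiv_dir b (\<lambda>x. f x + c * g x) = (\<lambda>x. pderiv_dir b f x + c * pderiv_dir b g x)"
  unfolding pderiv_dir_def
  by (rule pderiv_dir_eqI[unfolded pderiv_dir_def])
     (intro has_derivative_add has_derivative_mult_right frechet_derivative_works[THEN iffD1] assms)

lemma smooth_fun_lin:
  assumes "smooth_fun f" "smooth_fun g"
  shows "smooth_fun (\<lambda>x. f x + c * g x)"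
proof -
  have *: "fold pderiv_dir bs (\<lambda>x. f x + c * g x) = (\<lambda>x. fold pderiv_dir bs f x + c * fold pderiv_dir bs g x)"
    if "set bs \<subseteq> Basis" for bs
    using that assms
  proof (induction bs arbitrary: f g)
    case (Cons b bs)
    have "fold pderiv_dir (b # bs) (\<lambda>x. f x + c * g x)
        = fold pderiv_dir bs (\<lambda>x. pderiv_dir b f x + c * pderiv_dir b g x)"
      using Cons by (simp add: pderiv_dir_lin smooth_fun_differentiable)
    also have "\<dots> = (\<lambda>x. fold pderiv_dir bs (pderiv_dir b f) x + c * fold pderiv_dir bs (pderiv_dir b g) x)"
      using Cons.prems by (intro Cons.IH) (auto intro: smooth_fun_pderiv)
    finally show ?case by simp
  qed simp
  show ?thesis
    using assms unfolding smooth_fun_def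
    by (auto simp: * intro!: differentiable_add differentiable_mult)
qed

lemma test_funs_lin:
  assumes "f \<in> test_funs \<Omega>" "g \<in> test_funs \<Omega>"
  shows "(\<lambda>x. f x + c * g x) \<in> test_funs \<Omega>"
proof -
  from assms obtain K L where "compact K" "K \<subseteq> \<Omega>" "\<forall>x. x \<notin> K \<longrightarrow> f x = 0"
      "compact L" "L \<subseteq> \<Omega>" "\<forall>x. x \<notin> L \<longrightarrow> g x = 0"
    unfolding test_funs_def by blast
  then have "compact (K \<union> L) \<and> K \<union> L \<subseteq> \<Omega> \<and> (\<forall>x. x \<notin> K \<union> L \<longrightarrow> f x + c * g x = 0)"
    by auto
  with assms show ?thesis
    unfolding test_funs_def by (auto intro: smooth_fun_lin)
qed

lemma zero_test_funs: "(\<lambda>x. 0) \<in> test_funs \<Omega>"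
  unfolding test_funs_def using smooth_algebra_imp_smooth_fun[OF smooth_algebra.const] by auto

text \<open>
  A ball with centre \<open>c\<close> and radius \<open>r\<close> has the cut-off functions \<open>flat_exp 0 (n \<cdot> (r\<^sup>2 - \<bar>x - c\<bar>\<^sup>2))\<close>,
  which vanish off the ball and tend to \<open>1\<close> on it. The open set is a countable union of balls whose
  closures it contains, and \<open>1 - (\<Prod>i\<le>n. 1 - \<beta> n i x)\<close> combines the cut-offs \<open>\<beta> n i\<close> of the first balls
  smoothly, without leaving the interval from \<open>0\<close> to \<open>1\<close>.
\<close>

lemma test_funs_tendsto_indicator:
  fixes V :: "'a::euclidean_space set"
  assumes "open V"
  obtains \<phi> where "\<And>n. \<phi> n \<in> test_funs V" "\<And>n x. 0 \<le> \<phi> n x" "\<And>n x. \<phi> n x \<le> 1"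
    "\<And>x. (\<lambda>n. \<phi> n x) \<longlonglongrightarrow> indicat_real V x"
proof -
  define \<F> where "\<F> = {ball c r | c r. r > 0 \<and> cball c r \<subseteq> V}"
  have "\<Union>\<F> = V"
  proof
    show "\<Union>\<F> \<subseteq> V" using ball_subset_cball unfolding \<F>_def by blast
    show "V \<subseteq> \<Union>\<F>"
    proof
      fix x assume "x \<in> V"
      then obtain r where "r > 0" "cball x r \<subseteq> V" using assms open_contains_cball by blast
      then have "ball x r \<in> \<F>" "x \<in> ball x r"
        unfolding \<F>_def by (blast, simp)
      then show "x \<in> \<Union>\<F>" by (rule UnionI)
    qed
  qed
  have "open S" if "S \<in> \<F>" for S
    using that open_ball unfolding \<F>_def by blast
  then obtain \<G> where \<G>: "\<G> \<subseteq> \<F>" "countable \<G>" "\<Union>\<G> = \<Union>\<F>"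
    by (rule Lindelof)
  show ?thesis
  proof (cases "V = {}")
    case True
    then show ?thesis using that[of "\<lambda>n x. 0"] by (simp add: zero_test_funs)
  next
    case False
    have "\<G> \<noteq> {}" using False \<G>(3) \<open>\<Union>\<F> = V\<close> by auto
    define B where "B = from_nat_into \<G>"
    have B: "range B = \<G>"
      unfolding B_def using \<open>\<G> \<noteq> {}\<close> \<G>(2) by (rule range_from_nat_into)
    have "\<exists>c r. r > 0 \<and> cball c r \<subseteq> V \<and> B i = ball c r" for i
    proof -
      have "B i \<in> \<F>" using B \<G>(1) by (metis rangeI subsetD)
      then show ?thesis unfolding \<F>_def by (simp add: conj_ac)
    qed
    then obtain c r where cr: "\<And>i. r i > 0" "\<And>i. cball (c i) (r i) \<subseteq> V" "\<And>i. B i = ball (c i) (r i)"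
      by metis
    define q where "q i x = (r i)\<^sup>2 + (- 1) * (\<Sum>b\<in>Basis. (x \<bullet> b + (- (c i \<bullet> b))) * (x \<bullet> b + (- (c i \<bullet> b))))" for i x
    have q: "q i x = (r i)\<^sup>2 - (dist x (c i))\<^sup>2" for i x
    proof -
      have "(dist x (c i))\<^sup>2 = (\<Sum>b\<in>Basis. ((x - c i) \<bullet> b) * ((x - c i) \<bullet> b))"
        unfolding dist_norm power2_norm_eq_inner by (rule euclidean_inner)
      then show ?thesis by (simp add: q_def inner_diff_left)
    qed
    have sum_smooth: "finite I \<Longrightarrow> (\<And>i. i \<in> I \<Longrightarrow> f i \<in> smooth_algebra) \<Longrightarrow> (\<lambda>x. \<Sum>i\<in>I. f i x) \<in> smooth_algebra"
      for I :: "'a set" and f :: "'a \<Rightarrow> 'a \<Rightarrow> real"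
      by (induction rule: finite_induct) (auto intro: smooth_algebra.intros)
    have q_smooth: "q i \<in> smooth_algebra" for i
      unfolding q_def by (intro smooth_algebra.intros sum_smooth) auto
    define \<beta> where "\<beta> n i x = flat_exp 0 (real (Suc n) * q i x)" for n i x
    define \<phi> where "\<phi> n x = 1 + (- 1) * (\<Prod>i\<in>{..n}. 1 + (- 1) * \<beta> n i x)" for n x
    have \<beta>01: "0 \<le> \<beta> n i x" "\<beta> n i x \<le> 1" for n i x
      by (auto simp: \<beta>_def flat_exp_bounds)
    have q_pos: "q i x > 0 \<longleftrightarrow> x \<in> B i" for i x
    proof -
      have "(dist x (c i))\<^sup>2 < (r i)\<^sup>2 \<longleftrightarrow> dist x (c i) < r i"
        using cr(1)[of i] power2_less_imp_less[of "dist x (c i)" "r i"]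
          power_strict_mono[of "dist x (c i)" "r i" 2] by auto
      then show ?thesis by (simp add: q cr(3) dist_commute)
    qed
    have \<beta>_out: "\<beta> n i x = 0" if "x \<notin> B i" for n i x
      using that unfolding \<beta>_def flat_exp_def q_pos[symmetric] by (simp add: zero_less_mult_iff)
    show ?thesis
    proof (rule that)
      show "\<phi> n \<in> test_funs V" for n
      proof -
        have "\<phi> n \<in> smooth_algebra"
          unfolding \<phi>_def \<beta>_def
          by (intro smooth_algebra.intros smooth_algebra_prod q_smooth finite_atMost)
        moreover have "compact (\<Union>i\<in>{..n}. cball (c i) (r i)) \<and> (\<Union>i\<in>{..n}. cball (c i) (r i)) \<subseteq> V \<and>
            (\<forall>x. x \<notin> (\<Union>i\<in>{..n}. cball (c i) (r i)) \<longrightarrow> \<phi> n x = 0)"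
        proof (intro conjI allI impI)
          fix x assume "x \<notin> (\<Union>i\<in>{..n}. cball (c i) (r i))"
          then have "x \<notin> B i" if "i \<le> n" for i using that by (force simp: cr(3))
          then show "\<phi> n x = 0" by (simp add: \<phi>_def \<beta>_out)
        qed (use cr in auto)
        ultimately show ?thesis unfolding test_funs_def using smooth_algebra_imp_smooth_fun by blast
      qed
      have P: "0 \<le> (\<Prod>i\<in>{..n}. 1 - \<beta> n i x)" "(\<Prod>i\<in>{..n}. 1 - \<beta> n i x) \<le> 1" for n x
        using \<beta>01 by (auto intro!: prod_nonneg prod_le_1)
      show "0 \<le> \<phi> n x" "\<phi> n x \<le> 1" for n x
        using P[of n x] by (auto simp: \<phi>_def)
      show "(\<lambda>n. \<phi> n x) \<longlonglongrightarrow> indicat_real V x" for x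
      proof (cases "x \<in> V")
        case True
        then obtain i where i: "x \<in> B i" using \<G>(3) \<open>\<Union>\<F> = V\<close> B by auto
        have lim: "(\<lambda>n. \<beta> n i x) \<longlonglongrightarrow> 1"
          unfolding \<beta>_def using flat_exp_tendsto_1 i q_pos by blast
        have lower: "\<beta> n i x \<le> \<phi> n x" if "n \<ge> i" for n
        proof -
          have "(\<Prod>j\<in>{..n}. 1 - \<beta> n j x) = (1 - \<beta> n i x) * (\<Prod>j\<in>{..n} - {i}. 1 - \<beta> n j x)"
            using that by (intro prod.remove) auto
          also have "\<dots> \<le> (1 - \<beta> n i x) * 1"
            using \<beta>01 by (intro mult_left_mono prod_le_1) auto
          finally show ?thesis by (simp add: \<phi>_def)
        qed
        have "(\<lambda>n. \<phi> n x) \<longlonglongrightarrow> 1"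
          by (rule tendsto_sandwich[OF _ _ lim tendsto_const])
             (use lower P in \<open>auto simp: eventually_sequentially \<phi>_def\<close>)
        then show ?thesis using True by simp
      next
        case False
        then have "x \<notin> B i" for i using cr(2,3)[of i] ball_subset_cball[of "c i" "r i"] by (metis subsetD)
        then show ?thesis using False by (simp add: \<phi>_def \<beta>_out)
      qed
    qed
  qed
qed

lemma test_funs_mono: "S \<subseteq> T \<Longrightarrow> test_funs S \<subseteq> test_funs T"
  unfolding test_funs_def by blast

text \<open>
  The fundamental lemma of the calculus of variations. By dominated convergence the integral of \<open>h\<close>
  over every open subset vanishes; open sets form an intersection-stable generator of the Borel sets,
  so the integral over every Borel set vanishes, and Lebesgue sets are Borel up to null sets.
\<close>

lemma test_funs_orthogonal_imp_AE_zero: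
  fixes h :: "'a::euclidean_space \<Rightarrow> real"
  assumes \<Omega>: "open \<Omega>" and h: "integrable (lebesgue_on \<Omega>) h"
    and orth: "\<And>\<phi>. \<phi> \<in> test_funs \<Omega> \<Longrightarrow> (\<integral>x. h x * \<phi> x \<partial>lebesgue_on \<Omega>) = 0"
  shows "AE x in lebesgue_on \<Omega>. h x = 0"
proof -
  let ?M = "lebesgue_on \<Omega>"
  have [measurable]: "h \<in> borel_measurable ?M" using h by simp
  have [measurable]: "\<Omega> \<in> sets lebesgue" using \<Omega> by simp
  have meas_ind: "indicat_real A \<in> borel_measurable ?M" if "A \<in> sets lebesgue" for A
    by (intro measurable_restrict_space1 borel_measurable_indicator that)
  have int_ind: "integrable ?M (\<lambda>x. h x * indicator A x)" if "A \<in> sets lebesgue" for A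
    using that by (intro Bochner_Integration.integrable_bound[OF h] borel_measurable_times meas_ind)
      (auto simp: indicator_def)
  have open_zero: "(\<integral>x. h x * indicator V x \<partial>?M) = 0" if V: "open V" for V
  proof -
    have "open (V \<inter> \<Omega>)" using V \<Omega> by blast
    then obtain \<phi> where \<phi>: "\<And>n. \<phi> n \<in> test_funs (V \<inter> \<Omega>)" "\<And>n x. 0 \<le> \<phi> n x" "\<And>n x. \<phi> n x \<le> 1"
      "\<And>x. (\<lambda>n. \<phi> n x) \<longlonglongrightarrow> indicat_real (V \<inter> \<Omega>) x"
      using test_funs_tendsto_indicator by blast
    have \<phi>_meas: "\<phi> n \<in> borel_measurable ?M" for n
      using \<phi>(1)[of n] unfolding test_funs_def
      by (intro measurable_restrict_space1 measurable_completion)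
         (auto intro!: borel_measurable_continuous_onI smooth_fun_continuous)
    have "(\<lambda>n. \<integral>x. h x * \<phi> n x \<partial>?M) \<longlonglongrightarrow> (\<integral>x. h x * indicator (V \<inter> \<Omega>) x \<partial>?M)"
    proof (rule integral_dominated_convergence[where w = "\<lambda>x. norm (h x)"])
      show "AE x in ?M. (\<lambda>n. h x * \<phi> n x) \<longlonglongrightarrow> h x * indicator (V \<inter> \<Omega>) x"
        by (intro AE_I2 tendsto_intros \<phi>)
      show "AE x in ?M. norm (h x * \<phi> n x) \<le> norm (h x)" for n
        using \<phi>(2,3) by (intro AE_I2) (simp add: abs_mult mult_left_le)
    qed (use h \<phi>_meas meas_ind[of "V \<inter> \<Omega>"] V \<Omega> in auto)
    moreover have "(\<integral>x. h x * \<phi> n x \<partial>?M) = 0" for n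
      using \<phi>(1) test_funs_mono[of "V \<inter> \<Omega>" \<Omega>] by (intro orth) auto
    ultimately have "(\<integral>x. h x * indicator (V \<inter> \<Omega>) x \<partial>?M) = 0"
      by (simp add: LIMSEQ_const_iff)
    moreover have "(\<integral>x. h x * indicator (V \<inter> \<Omega>) x \<partial>?M) = (\<integral>x. h x * indicator V x \<partial>?M)"
      by (intro Bochner_Integration.integral_cong) (auto simp: indicator_def)
    ultimately show ?thesis by simp
  qed
  have borel_zero: "(\<integral>x. h x * indicator A x \<partial>?M) = 0" if "A \<in> sets borel" for A
  proof -
    have sig: "sigma_sets UNIV {S::'a set. open S} = sets borel"
      by (simp add: borel_def)
    have "Int_stable {S::'a set. open S}" "{S::'a set. open S} \<subseteq> Pow UNIV"
      "A \<in> sigma_sets UNIV {S::'a set. open S}"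
      using that by (auto simp: borel_def Int_stable_def)
    then show ?thesis
    proof (induction rule: sigma_sets_induct_disjoint)
      case (compl A)
      then have "A \<in> sets lebesgue" by (simp add: sig)
      have "(\<integral>x. h x * indicator (UNIV - A) x \<partial>?M)
          = (\<integral>x. h x * indicator UNIV x - h x * indicator A x \<partial>?M)"
        by (intro Bochner_Integration.integral_cong) (auto simp: indicator_def)
      also have "\<dots> = 0 - 0"
        using h \<open>A \<in> sets lebesgue\<close> compl open_zero[of UNIV]
        by (subst Bochner_Integration.integral_diff) (auto intro: int_ind)
      finally show ?case by simp
    next
      case (union A)
      then have A: "A i \<in> sets lebesgue" for i
        unfolding sig by (simp add: image_subset_iff)
      have "(\<lambda>n. \<integral>x. h x * indicator (\<Union>i<n. A i) x \<partial>?M) \<longlonglongrightarrow> (\<integral>x. h x * indicator (\<Union>i. A i) x \<partial>?M)"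
      proof (rule integral_dominated_convergence[where w = "\<lambda>x. norm (h x)"])
        show "AE x in ?M. (\<lambda>n. h x * indicator (\<Union>i<n. A i) x) \<longlonglongrightarrow> h x * indicator (\<Union>i. A i) x"
          by (intro AE_I2 tendsto_mult_left LIMSEQ_indicator_UN)
        show "AE x in ?M. norm (h x * indicator (\<Union>i<n. A i) x) \<le> norm (h x)" for n
          by (intro AE_I2) (simp add: indicator_def)
      qed (use h A meas_ind in \<open>auto intro!: borel_measurable_times meas_ind\<close>)
      moreover have "(\<integral>x. h x * indicator (\<Union>i<n. A i) x \<partial>?M) = 0" for n
      proof -
        have "(\<integral>x. h x * indicator (\<Union>i<n. A i) x \<partial>?M) = (\<integral>x. (\<Sum>i<n. h x * indicator (A i) x) \<partial>?M)"
          using union(1) by (intro Bochner_Integration.integral_cong)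
            (auto simp: indicator_UN_disjoint[OF _ disjoint_family_on_mono[OF subset_UNIV]] sum_distrib_left)
        also have "\<dots> = 0"
          using union A by (subst Bochner_Integration.integral_sum) (auto intro: int_ind)
        finally show ?thesis .
      qed
      ultimately show ?case by (simp add: LIMSEQ_const_iff)
    qed (auto simp: open_zero)
  qed
  show ?thesis
  proof (rule density_unique_real[OF h integrable_zero])
    fix A assume "A \<in> sets ?M"
    then have A: "A \<in> sets lebesgue"
      using \<Omega> by (auto simp: sets_restrict_space)
    let ?B = "main_part lborel A"
    have B: "?B \<in> sets borel" using main_part_sets[OF A] by simp
    have "AE x in lborel. x \<in> ?B \<longleftrightarrow> x \<in> A" using A by (rule AE_in_main_part)
    then have "AE x in lebesgue. x \<in> ?B \<longleftrightarrow> x \<in> A" by (rule AE_completion)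
    then have "AE x in ?M. x \<in> ?B \<longleftrightarrow> x \<in> A" by (auto simp: AE_restrict_space_iff)
    then have "(\<integral>x. h x * indicator A x \<partial>?M) = (\<integral>x. h x * indicator ?B x \<partial>?M)"
      using A B by (intro integral_cong_AE borel_measurable_times meas_ind)
        (auto simp: indicator_def sets_completionI_sets)
    then show "(LINT x:A|?M. h x) = (LINT x:A|?M. 0)"
      using borel_zero[OF B] by (simp add: set_lebesgue_integral_def mult.commute)
  qed
qed

section \<open>Translations\<close>

lemma lebesgue_translation: "distr lebesgue lebesgue (\<lambda>x::'a::euclidean_space. s + x) = lebesgue"
  using lebesgue_affine_euclidean[where c = "\<lambda>_::'a. 1" and t = s]
  by (simp add: euclidean_representation density_1)

lemma measurable_lebesgue_translation:
  "(\<lambda>x::'a::euclidean_space. s + x) \<in> lebesgue \<rightarrow>\<^sub>M lebesgue"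
  using lebesgue_affine_measurable[where c = "\<lambda>_::'a. 1" and t = s]
  by (simp add: euclidean_representation)

lemma
  fixes f :: "'a::euclidean_space \<Rightarrow> real"
  assumes "f \<in> borel_measurable lebesgue"
  shows borel_measurable_translation: "(\<lambda>x. f (s + x)) \<in> borel_measurable lebesgue"
    and integral_translation: "(\<integral>x. f (s + x) \<partial>lebesgue) = (\<integral>x. f x \<partial>lebesgue)"
    and integrable_translation: "integrable lebesgue (\<lambda>x. f (s + x)) \<longleftrightarrow> integrable lebesgue f"
proof -
  show "(\<lambda>x. f (s + x)) \<in> borel_measurable lebesgue"
    using measurable_compose[OF measurable_lebesgue_translation assms] .
  show "(\<integral>x. f (s + x) \<partial>lebesgue) = (\<integral>x. f x \<partial>lebesgue)"
    using integral_distr[OF measurable_lebesgue_translation assms, of s] lebesgue_translation[of s] by simp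
  show "integrable lebesgue (\<lambda>x. f (s + x)) \<longleftrightarrow> integrable lebesgue f"
    using integrable_distr_eq[OF measurable_lebesgue_translation assms, of s] lebesgue_translation[of s] by simp
qed

section \<open>Difference quotients\<close>

lemma square_diff_le: "(a - b)\<^sup>2 \<le> 2 * a\<^sup>2 + 2 * b\<^sup>2" for a b :: real
  using zero_le_power2[of "a + b"] by (simp add: power2_eq_square algebra_simps)

text \<open>
  Continuously differentiable functions with compact support, together with their derivative. The
  estimates below need one derivative only, and products of test functions enter in this form.
\<close>

definition C1_compact :: "('a::euclidean_space \<Rightarrow> real) \<Rightarrow> ('a \<Rightarrow> 'a \<Rightarrow> real) \<Rightarrow> bool" where
  "C1_compact F F' \<longleftrightarrow> (\<forall>x. (F has_derivative F' x) (at x)) \<and> (\<forall>s. continuous_on UNIV (\<lambda>x. F' x s)) \<and>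
     (\<exists>K. compact K \<and> (\<forall>x. x \<notin> K \<longrightarrow> F x = 0))"

lemma integrable_continuous_compact_support:
  fixes f :: "'a::euclidean_space \<Rightarrow> real"
  assumes "continuous_on UNIV f" "compact K" "\<And>x. x \<notin> K \<Longrightarrow> f x = 0"
  shows "integrable lebesgue f"
proof -
  have "integrable lborel (\<lambda>x. indicator K x *\<^sub>R f x)"
    using assms(2) continuous_on_subset[OF assms(1)] by (intro borel_integrable_compact) auto
  moreover have "(\<lambda>x. indicator K x *\<^sub>R f x) = f"
    using assms(3) by (auto simp: indicator_def fun_eq_iff)
  ultimately show ?thesis
    by (simp add: integrable_completion borel_measurable_integrable)
qed

lemma derivative_zero_outside:
  fixes F :: "'a::euclidean_space \<Rightarrow> real"
  assumes "(F has_derivative F') (at x)" "compact K" "\<And>x. x \<notin> K \<Longrightarrow> F x = 0" "x \<notin> K"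
  shows "F' = (\<lambda>s. 0)"
proof -
  have "(F has_derivative (\<lambda>s. 0)) (at x)"
    by (rule has_derivative_transform_within_open[of "\<lambda>_. 0" _ _ _ "- K"])
       (use assms in \<open>auto simp: open_Compl compact_imp_closed\<close>)
  then show ?thesis using assms(1) has_derivative_unique by blast
qed

lemma C1_compact_integrable:
  assumes "C1_compact F F'"
  shows "integrable lebesgue F" "integrable lebesgue (\<lambda>x. F' x s)"
    "integrable lebesgue (\<lambda>x. (F x)\<^sup>2)" "integrable lebesgue (\<lambda>x. (F' x s)\<^sup>2)" "continuous_on UNIV F"
    "F \<in> borel_measurable lebesgue"
proof -
  obtain K where K: "compact K" "\<And>x. x \<notin> K \<Longrightarrow> F x = 0"
    and F': "\<And>x. (F has_derivative F' x) (at x)" and c: "continuous_on UNIV (\<lambda>x. F' x s)"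
    using assms unfolding C1_compact_def by blast
  have z: "F' x s = 0" if "x \<notin> K" for x
    using derivative_zero_outside[OF F' K that] by simp
  show cF: "continuous_on UNIV F"
    by (intro continuous_at_imp_continuous_on ballI has_derivative_continuous[OF F'])
  show int: "integrable lebesgue F"
    using cF K by (rule integrable_continuous_compact_support)
  show "integrable lebesgue (\<lambda>x. F' x s)"
    using c K(1) z by (rule integrable_continuous_compact_support)
  show "integrable lebesgue (\<lambda>x. (F x)\<^sup>2)"
    by (rule integrable_continuous_compact_support[OF continuous_on_power[OF cF] K(1)]) (simp add: K(2))
  show "integrable lebesgue (\<lambda>x. (F' x s)\<^sup>2)"
    by (rule integrable_continuous_compact_support[OF continuous_on_power[OF c] K(1)]) (simp add: z)
  show "F \<in> borel_measurable lebesgue"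
    using int by (rule borel_measurable_integrable)
qed

text \<open>
  By the mean value theorem the difference quotients are bounded by the maximum of the directional
  derivative, and they vanish outside one compact set, the support swept along the segment
  from \<open>0\<close> to \<open>- s\<close>. So dominated convergence applies to them and to their squares.
\<close>

lemma difference_quotient_convergence:
  fixes F :: "'a::euclidean_space \<Rightarrow> real" and s :: 'a
  assumes F: "C1_compact F F'"
  defines "D \<equiv> \<lambda>n x. real (Suc n) * (F ((1 / real (Suc n)) *\<^sub>R s + x) - F x)"
  shows "(\<lambda>n. \<integral>x. D n x \<partial>lebesgue) \<longlonglongrightarrow> (\<integral>x. F' x s \<partial>lebesgue)"
    and "(\<lambda>n. \<integral>x. (D n x)\<^sup>2 \<partial>lebesgue) \<longlonglongrightarrow> (\<integral>x. (F' x s)\<^sup>2 \<partial>lebesgue)"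
proof -
  obtain K where K: "compact K" "\<And>x. x \<notin> K \<Longrightarrow> F x = 0"
    and F': "\<And>x. (F has_derivative F' x) (at x)" and c: "continuous_on UNIV (\<lambda>x. F' x s)"
    using F unfolding C1_compact_def by blast
  have z: "F' x s = 0" if "x \<notin> K" for x
    using derivative_zero_outside[OF F' K that] by simp
  have "compact ((\<lambda>x. F' x s) ` K)"
    using K(1) c continuous_on_subset compact_continuous_image by blast
  then obtain B where "B > 0" and "\<And>y. y \<in> (\<lambda>x. F' x s) ` K \<Longrightarrow> norm y \<le> B"
    using compact_imp_bounded bounded_pos by metis
  then have B: "\<bar>F' x s\<bar> \<le> B" for x
    using z[of x] by (cases "x \<in> K") auto
  have line: "((\<lambda>t. F (t *\<^sub>R s + x)) has_real_derivative F' (t *\<^sub>R s + x) s) (at t)" for x t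
  proof -
    have "((\<lambda>t. F (t *\<^sub>R s + x)) has_derivative (\<lambda>h. F' (t *\<^sub>R s + x) (h *\<^sub>R s))) (at t)"
      by (rule has_derivative_compose[OF _ F', where f = "\<lambda>t. t *\<^sub>R s + x"])
         (auto intro!: derivative_eq_intros)
    moreover have "F' (t *\<^sub>R s + x) (h *\<^sub>R s) = F' (t *\<^sub>R s + x) s * h" for h
      using linear_scale[OF has_derivative_linear[OF F']] by simp
    ultimately show ?thesis by (simp add: has_field_derivative_def)
  qed
  have D_le: "\<bar>D n x\<bar> \<le> B" for n x
  proof -
    have "\<exists>t>0. t < 1 / real (Suc n) \<and> F ((1 / real (Suc n)) *\<^sub>R s + x) - F (0 *\<^sub>R s + x)
        = (1 / real (Suc n) - 0) * F' (t *\<^sub>R s + x) s"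
      by (rule MVT2) (auto intro: line)
    then obtain t where "F ((1 / real (Suc n)) *\<^sub>R s + x) - F x = (1 / real (Suc n)) * F' (t *\<^sub>R s + x) s"
      by auto
    then have "D n x = F' (t *\<^sub>R s + x) s" by (simp add: D_def)
    then show ?thesis using B by simp
  qed
  define L where "L = (\<lambda>(x, t). x - t *\<^sub>R s) ` (K \<times> {0..1::real})"
  have "compact L"
    unfolding L_def using K(1)
    by (intro compact_continuous_image compact_Times) (auto simp: split_beta intro!: continuous_intros)
  have D0: "D n x = 0" if "x \<notin> L" for n x
  proof -
    have "x + t *\<^sub>R s \<notin> K" if "t \<in> {0..1}" for t
    proof
      assume "x + t *\<^sub>R s \<in> K"
      then have "x \<in> L" unfolding L_def using that by (intro image_eqI[of _ _ "(x + t *\<^sub>R s, t)"]) auto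
      then show False using \<open>x \<notin> L\<close> by simp
    qed
    from this[of 0] this[of "1 / real (Suc n)"] show ?thesis
      by (simp add: D_def K(2) add.commute divide_simps)
  qed
  have bound: "\<bar>D n x\<bar> \<le> B * indicator L x" for n x
    using D_le[of n x] D0[of x n] by (cases "x \<in> L") auto
  have "emeasure lebesgue L < \<infinity>"
    using \<open>compact L\<close> lmeasurable_compact fmeasurableD2 by (metis infinity_ennreal_def top.not_eq_extremum)
  then have intL: "integrable lebesgue (\<lambda>x. C * indicat_real L x)" for C
    using \<open>compact L\<close> lmeasurable_compact by (intro integrable_mult_right integrable_real_indicator) (auto dest: fmeasurableD)
  have lim: "(\<lambda>n. D n x) \<longlonglongrightarrow> F' x s" for x
  proof -
    have "((\<lambda>h. (F ((0 + h) *\<^sub>R s + x) - F (0 *\<^sub>R s + x)) / h) \<longlongrightarrow> F' (0 *\<^sub>R s + x) s) (at 0)"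
      using line[of x 0] unfolding DERIV_def .
    moreover have "filterlim (\<lambda>n. 1 / real (Suc n)) (at 0) sequentially"
      unfolding filterlim_at using LIMSEQ_inverse_real_of_nat by (auto simp: inverse_eq_divide)
    ultimately have "((\<lambda>n. (F ((0 + 1 / real (Suc n)) *\<^sub>R s + x) - F (0 *\<^sub>R s + x)) / (1 / real (Suc n))) \<longlongrightarrow> F' (0 *\<^sub>R s + x) s) sequentially"
      by (rule filterlim_compose)
    then show ?thesis by (simp add: D_def mult.commute)
  qed
  have cF: "continuous_on UNIV F" using C1_compact_integrable[OF F] by blast
  have "continuous_on UNIV (D n)" for n
    unfolding D_def by (intro continuous_intros continuous_on_compose2[OF cF]) auto
  then have meas: "D n \<in> borel_measurable lebesgue" for n
    by (intro measurable_completion) (auto intro: borel_measurable_continuous_onI)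
  have meas': "(\<lambda>x. F' x s) \<in> borel_measurable lebesgue" using c
    by (intro measurable_completion) (auto intro: borel_measurable_continuous_onI)
  show "(\<lambda>n. \<integral>x. D n x \<partial>lebesgue) \<longlonglongrightarrow> (\<integral>x. F' x s \<partial>lebesgue)"
    by (rule integral_dominated_convergence[where w = "\<lambda>x. B * indicator L x"])
       (use meas meas' intL lim bound in auto)
  show "(\<lambda>n. \<integral>x. (D n x)\<^sup>2 \<partial>lebesgue) \<longlonglongrightarrow> (\<integral>x. (F' x s)\<^sup>2 \<partial>lebesgue)"
  proof (rule integral_dominated_convergence[where w = "\<lambda>x. B\<^sup>2 * indicator L x"])
    have "(D n x)\<^sup>2 \<le> B\<^sup>2 * indicator L x" for n x
      using D_le[of n x] D0[of x n] abs_le_square_iff[of "D n x" B] \<open>B > 0\<close>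
      by (cases "x \<in> L") auto
    then show "AE x in lebesgue. norm ((D n x)\<^sup>2) \<le> B\<^sup>2 * indicator L x" for n by simp
    show "AE x in lebesgue. (\<lambda>n. (D n x)\<^sup>2) \<longlonglongrightarrow> (F' x s)\<^sup>2"
      by (intro AE_I2 tendsto_power lim)
  qed (use meas meas' intL in auto)
qed

text \<open>
  Integration by parts without Fubini: each difference quotient has integral \<open>0\<close> because Lebesgue
  measure is translation invariant.
\<close>

lemma integral_derivative_C1_compact:
  assumes F: "C1_compact F F'"
  shows "(\<integral>x. F' x s \<partial>lebesgue) = 0"
proof -
  have "(\<integral>x. real (Suc n) * (F ((1 / real (Suc n)) *\<^sub>R s + x) - F x) \<partial>lebesgue) = 0" for n
    using C1_compact_integrable[OF F] by (simp add: integrable_translation integral_translation)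
  then show ?thesis
    using difference_quotient_convergence(1)[OF F, of s] by (simp add: LIMSEQ_const_iff)
qed

text \<open>
  Splitting the translation by \<open>s\<close> into \<open>N\<close> equal steps and using \<open>(\<Sum>i<N. c i)\<^sup>2 \<le> N \<cdot> (\<Sum>i<N. (c i)\<^sup>2)\<close>
  bounds the left-hand side by \<open>N\<^sup>2\<close> times the corresponding integral for one step, that is, by the
  integrated square of the difference quotient with increment \<open>s / N\<close>. Then \<open>N\<close> tends to infinity.
\<close>

lemma translation_difference_le_derivative:
  assumes F: "C1_compact F F'"
  shows "(\<integral>x. (F (s + x) - F x)\<^sup>2 \<partial>lebesgue) \<le> (\<integral>x. (F' x s)\<^sup>2 \<partial>lebesgue)"
proof -
  note [measurable] = C1_compact_integrable(6)[OF F]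
  have [measurable]: "(\<lambda>x. F (v + x)) \<in> borel_measurable lebesgue" for v
    by (intro borel_measurable_translation C1_compact_integrable(6)[OF F])
  have int: "integrable lebesgue (\<lambda>x. (F (v + x) - F (w + x))\<^sup>2)" for v w
  proof (rule Bochner_Integration.integrable_bound)
    show "integrable lebesgue (\<lambda>x. 2 * (F (v + x))\<^sup>2 + 2 * (F (w + x))\<^sup>2)"
      using C1_compact_integrable(3)[OF F] by (auto simp: integrable_translation[of "\<lambda>x. (F x)\<^sup>2"])
    show "AE x in lebesgue. norm ((F (v + x) - F (w + x))\<^sup>2) \<le> norm (2 * (F (v + x))\<^sup>2 + 2 * (F (w + x))\<^sup>2)"
      using square_diff_le by simp
  qed measurable
  have "(\<integral>x. (F (s + x) - F x)\<^sup>2 \<partial>lebesgue)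
      \<le> (\<integral>x. (real (Suc n) * (F ((1 / real (Suc n)) *\<^sub>R s + x) - F x))\<^sup>2 \<partial>lebesgue)" for n
  proof -
    let ?N = "real (Suc n)"
    define G where "G i x = F ((real i / ?N) *\<^sub>R s + x)" for i x
    define Q where "Q x = (F ((1 / ?N) *\<^sub>R s + x) - F x)\<^sup>2" for x
    have [measurable]: "Q \<in> borel_measurable lebesgue"
      unfolding Q_def by measurable
    have step: "(\<integral>x. (G (Suc i) x - G i x)\<^sup>2 \<partial>lebesgue) = (\<integral>x. (F ((1 / ?N) *\<^sub>R s + x) - F x)\<^sup>2 \<partial>lebesgue)" for i
    proof -
      have "(real (Suc i) / ?N) *\<^sub>R s + x = (1 / ?N) *\<^sub>R s + ((real i / ?N) *\<^sub>R s + x)" for x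
        by (simp add: add_divide_distrib scaleR_left.add add.assoc)
      then have "(G (Suc i) x - G i x)\<^sup>2 = Q ((real i / ?N) *\<^sub>R s + x)" for x
        unfolding G_def Q_def by presburger
      then have "(\<integral>x. (G (Suc i) x - G i x)\<^sup>2 \<partial>lebesgue) = (\<integral>x. Q ((real i / ?N) *\<^sub>R s + x) \<partial>lebesgue)"
        by (simp only:)
      also have "\<dots> = (\<integral>x. Q x \<partial>lebesgue)"
        by (rule integral_translation) measurable
      finally show ?thesis by (simp only: Q_def)
    qed
    have "(F (s + x) - F x)\<^sup>2 \<le> ?N * (\<Sum>i<Suc n. (G (Suc i) x - G i x)\<^sup>2)" for x
    proof -
      have "F (s + x) - F x = (\<Sum>i<Suc n. G (Suc i) x - G i x)"
        by (subst sum_lessThan_telescope) (simp add: G_def)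
      then show ?thesis
        using sum_squared_le_sum_of_squares[of "\<lambda>i. G (Suc i) x - G i x" "{..<Suc n}"]
        by (simp add: mult.commute)
    qed
    then have "(\<integral>x. (F (s + x) - F x)\<^sup>2 \<partial>lebesgue)
        \<le> (\<integral>x. ?N * (\<Sum>i<Suc n. (G (Suc i) x - G i x)\<^sup>2) \<partial>lebesgue)"
      using int[of s 0] unfolding G_def
      by (intro integral_mono integrable_mult_right Bochner_Integration.integrable_sum int) auto
    also have "\<dots> = ?N * (\<Sum>i<Suc n. \<integral>x. (G (Suc i) x - G i x)\<^sup>2 \<partial>lebesgue)"
      unfolding G_def
      by (subst integral_mult_right_zero, subst Bochner_Integration.integral_sum) (auto intro: int)
    also have "\<dots> = ?N * (\<Sum>i<Suc n. \<integral>x. (F ((1 / ?N) *\<^sub>R s + x) - F x)\<^sup>2 \<partial>lebesgue)"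
      by (simp only: step)
    also have "\<dots> = ?N * (?N * (\<integral>x. (F ((1 / ?N) *\<^sub>R s + x) - F x)\<^sup>2 \<partial>lebesgue))"
      by simp
    also have "\<dots> = (\<integral>x. (?N * (F ((1 / ?N) *\<^sub>R s + x) - F x))\<^sup>2 \<partial>lebesgue)"
      by (simp only: power_mult_distrib integral_mult_right_zero power2_eq_square[of ?N] mult.assoc)
    finally show ?thesis .
  qed
  then show ?thesis
    using LIMSEQ_le_const[OF difference_quotient_convergence(2)[OF F, of s]] by blast
qed

section \<open>Square-integrable functions\<close>

lemma L2_space_measurable: "f \<in> L2_space \<Omega> \<Longrightarrow> f \<in> borel_measurable (lebesgue_on \<Omega>)"
  by (simp add: L2_space_def)

lemma L2_space_integrable_power2: "f \<in> L2_space \<Omega> \<Longrightarrow> integrable (lebesgue_on \<Omega>) (\<lambda>x. (f x)\<^sup>2)"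
  by (simp add: L2_space_def)

lemma abs_mult_le_squares: "\<bar>a * b\<bar> \<le> a\<^sup>2 + b\<^sup>2" for a b :: real
  using zero_le_power2[of "a + b"] zero_le_power2[of "a - b"] sum_power2_ge_zero[of a b]
  by (simp add: power2_eq_square abs_le_iff algebra_simps)

lemma L2_space_integrable_mult:
  assumes "f \<in> L2_space \<Omega>" "g \<in> L2_space \<Omega>"
  shows "integrable (lebesgue_on \<Omega>) (\<lambda>x. f x * g x)"
proof (rule Bochner_Integration.integrable_bound)
  show "integrable (lebesgue_on \<Omega>) (\<lambda>x. (f x)\<^sup>2 + (g x)\<^sup>2)"
    using assms by (simp add: L2_space_def)
  show "AE x in lebesgue_on \<Omega>. norm (f x * g x) \<le> norm ((f x)\<^sup>2 + (g x)\<^sup>2)"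
    using abs_mult_le_squares by simp
qed (use assms in \<open>auto simp: L2_space_def\<close>)

lemma L2_space_lin:
  assumes "f \<in> L2_space \<Omega>" "g \<in> L2_space \<Omega>"
  shows "(\<lambda>x. f x + c * g x) \<in> L2_space \<Omega>"
proof -
  have "integrable (lebesgue_on \<Omega>) (\<lambda>x. (f x)\<^sup>2 + 2 * c * (f x * g x) + c\<^sup>2 * (g x)\<^sup>2)"
    using assms L2_space_integrable_mult[OF assms] by (simp add: L2_space_def)
  moreover have "(\<lambda>x. (f x)\<^sup>2 + 2 * c * (f x * g x) + c\<^sup>2 * (g x)\<^sup>2) = (\<lambda>x. (f x + c * g x)\<^sup>2)"
    by (simp add: power2_eq_square algebra_simps)
  ultimately show ?thesis
    using assms unfolding L2_space_def by (auto intro!: borel_measurable_add borel_measurable_times)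
qed

lemma L2_space_diff:
  "f \<in> L2_space \<Omega> \<Longrightarrow> g \<in> L2_space \<Omega> \<Longrightarrow> (\<lambda>x. f x - g x) \<in> L2_space \<Omega>"
  using L2_space_lin[of f \<Omega> g "-1"] by simp

lemma L2_space_bounded:
  assumes "open \<Omega>" "bounded \<Omega>" "f \<in> borel_measurable (lebesgue_on \<Omega>)" "\<And>x. x \<in> \<Omega> \<Longrightarrow> \<bar>f x\<bar> \<le> B"
  shows "f \<in> L2_space \<Omega>"
proof -
  interpret finite_measure "lebesgue_on \<Omega>"
    using assms(1,2) by (intro finite_measure_lebesgue_on lmeasurable_open)
  have "integrable (lebesgue_on \<Omega>) (\<lambda>x. (f x)\<^sup>2)"
  proof (rule integrable_const_bound[of _ "B\<^sup>2"])
    show "AE x in lebesgue_on \<Omega>. norm ((f x)\<^sup>2) \<le> B\<^sup>2"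
      using assms(4) by (intro AE_I2) (auto simp: abs_le_square_iff[symmetric] intro: order_trans[OF _ abs_ge_self])
  qed (use assms(3) in measurable)
  then show ?thesis using assms(3) by (simp add: L2_space_def)
qed

lemma L2_space_integrable:
  assumes "open \<Omega>" "bounded \<Omega>" "f \<in> L2_space \<Omega>"
  shows "integrable (lebesgue_on \<Omega>) f"
  using L2_space_integrable_mult[OF assms(3) L2_space_bounded[OF assms(1,2), of "\<lambda>_. 1" 1]] by simp

section \<open>Test functions as elements of the Sobolev space\<close>

lemma integral_lebesgue_on_zero_outside:
  fixes f :: "'a::euclidean_space \<Rightarrow> real"
  assumes "open \<Omega>" "\<And>x. x \<notin> \<Omega> \<Longrightarrow> f x = 0"
  shows "(\<integral>x. f x \<partial>lebesgue_on \<Omega>) = (\<integral>x. f x \<partial>lebesgue)"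
proof -
  have "(\<integral>x. f x \<partial>lebesgue_on \<Omega>) = (\<integral>x. indicator \<Omega> x *\<^sub>R f x \<partial>lebesgue)"
    using assms(1) by (intro integral_restrict_space) auto
  also have "(\<lambda>x. indicator \<Omega> x *\<^sub>R f x) = f"
    using assms(2) by (auto simp: indicator_def fun_eq_iff)
  finally show ?thesis .
qed

lemma frechet_derivative_Basis:
  fixes f :: "'a::euclidean_space \<Rightarrow> real"
  assumes "f differentiable (at x)"
  shows "frechet_derivative f (at x) s = s \<bullet> (\<Sum>b\<in>Basis. pderiv_dir b f x *\<^sub>R b)"
proof -
  have lin: "linear (frechet_derivative f (at x))"
    using assms by (rule linear_frechet_derivative)
  have "frechet_derivative f (at x) s = frechet_derivative f (at x) (\<Sum>b\<in>Basis. (s \<bullet> b) *\<^sub>R b)"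
    by (simp add: euclidean_representation)
  also have "\<dots> = (\<Sum>b\<in>Basis. (s \<bullet> b) * pderiv_dir b f x)"
    by (simp add: linear_sum[OF lin] linear_scale[OF lin] pderiv_dir_def)
  finally show ?thesis by (simp add: inner_sum_right mult.commute)
qed

lemma test_funs_smooth_supported:
  assumes "\<phi> \<in> test_funs \<Omega>"
  shows "smooth_fun \<phi>" "\<And>x. \<phi> differentiable (at x)" "\<And>x. x \<notin> \<Omega> \<Longrightarrow> \<phi> x = 0"
  using assms unfolding test_funs_def by (auto intro: smooth_fun_differentiable)

lemma test_funs_C1_compact:
  assumes "\<phi> \<in> test_funs \<Omega>"
  shows "C1_compact \<phi> (\<lambda>x. frechet_derivative \<phi> (at x))"
proof -
  obtain K where "compact K" "\<forall>x. x \<notin> K \<longrightarrow> \<phi> x = 0"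
    using assms unfolding test_funs_def by blast
  moreover have "(\<phi> has_derivative frechet_derivative \<phi> (at x)) (at x)" for x
    using test_funs_smooth_supported(2)[OF assms] frechet_derivative_works by blast
  moreover have "continuous_on UNIV (\<lambda>x. frechet_derivative \<phi> (at x) s)" for s
    unfolding frechet_derivative_Basis[OF test_funs_smooth_supported(2)[OF assms]]
    by (intro continuous_intros smooth_fun_continuous smooth_fun_pderiv test_funs_smooth_supported(1)[OF assms]) auto
  ultimately show ?thesis unfolding C1_compact_def by blast
qed

lemma test_funs_L2:
  assumes "open \<Omega>" "\<phi> \<in> test_funs \<Omega>"
  shows "\<phi> \<in> L2_space \<Omega>" "pderiv_dir b \<phi> \<in> L2_space \<Omega>"
proof -
  note C = C1_compact_integrable[OF test_funs_C1_compact[OF assms(2)]]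
  have "f \<in> L2_space \<Omega>" if "integrable lebesgue f" "integrable lebesgue (\<lambda>x. (f x)\<^sup>2)" for f
    using that assms(1) integrable_mult_indicator[of \<Omega> lebesgue "\<lambda>x. (f x)\<^sup>2"] unfolding L2_space_def
    by (auto intro!: measurable_restrict_space1 simp: integrable_restrict_space)
  then show "\<phi> \<in> L2_space \<Omega>" "pderiv_dir b \<phi> \<in> L2_space \<Omega>"
    using C unfolding pderiv_dir_def by auto
qed

lemma C1_compact_mult:
  assumes "C1_compact F F'" "C1_compact G G'"
  shows "C1_compact (\<lambda>x. F x * G x) (\<lambda>x s. F x * G' x s + F' x s * G x)"
proof -
  obtain K where "compact K" "\<forall>x. x \<notin> K \<longrightarrow> F x = 0"
    using assms(1) unfolding C1_compact_def by blast
  then have "\<exists>K. compact K \<and> (\<forall>x. x \<notin> K \<longrightarrow> F x * G x = 0)" by auto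
  then show ?thesis
    using assms C1_compact_integrable(5)[OF assms(1)] C1_compact_integrable(5)[OF assms(2)] unfolding C1_compact_def
    by (auto intro!: continuous_intros has_derivative_mult)
qed

text \<open>
  The integral of the derivative of a product of two test functions vanishes.
\<close>

lemma test_funs_weak_pderiv:
  assumes "open \<Omega>" "\<phi> \<in> test_funs \<Omega>"
  shows "has_weak_pderiv \<Omega> b \<phi> (pderiv_dir b \<phi>)"
  unfolding has_weak_pderiv_def
proof
  fix \<xi> assume \<xi>: "\<xi> \<in> test_funs \<Omega>"
  have C: "C1_compact (\<lambda>x. \<phi> x * \<xi> x) (\<lambda>x s. \<phi> x * frechet_derivative \<xi> (at x) s + frechet_derivative \<phi> (at x) s * \<xi> x)"
    by (intro C1_compact_mult test_funs_C1_compact[OF assms(2)] test_funs_C1_compact[OF \<xi>])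
  have "(\<integral>x. \<phi> x * pderiv_dir b \<xi> x + pderiv_dir b \<phi> x * \<xi> x \<partial>lebesgue_on \<Omega>)
      = (\<integral>x. \<phi> x * pderiv_dir b \<xi> x + pderiv_dir b \<phi> x * \<xi> x \<partial>lebesgue)"
    using assms \<xi> by (intro integral_lebesgue_on_zero_outside) (auto simp: test_funs_smooth_supported(3))
  also have "\<dots> = 0"
    using integral_derivative_C1_compact[OF C] by (simp add: pderiv_dir_def)
  finally show "(\<integral>x. \<phi> x * pderiv_dir b \<xi> x \<partial>lebesgue_on \<Omega>) = - (\<integral>x. pderiv_dir b \<phi> x * \<xi> x \<partial>lebesgue_on \<Omega>)"
    using assms \<xi> by (simp add: L2_space_integrable_mult test_funs_L2)
qed

section \<open>Weak gradients\<close>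

lemma has_weak_pderiv_lin:
  assumes \<Omega>: "open \<Omega>" and L2: "f \<in> L2_space \<Omega>" "f' \<in> L2_space \<Omega>" "g \<in> L2_space \<Omega>" "g' \<in> L2_space \<Omega>"
    and "has_weak_pderiv \<Omega> b f g" "has_weak_pderiv \<Omega> b f' g'"
  shows "has_weak_pderiv \<Omega> b (\<lambda>x. f x + c * f' x) (\<lambda>x. g x + c * g' x)"
  unfolding has_weak_pderiv_def
proof
  fix \<phi> assume \<phi>: "\<phi> \<in> test_funs \<Omega>"
  note P = test_funs_L2(1)[OF \<Omega> \<phi>] test_funs_L2(2)[OF \<Omega> \<phi>, of b]
  have "(\<integral>x. (f x + c * f' x) * pderiv_dir b \<phi> x \<partial>lebesgue_on \<Omega>)
     = (\<integral>x. f x * pderiv_dir b \<phi> x + c * (f' x * pderiv_dir b \<phi> x) \<partial>lebesgue_on \<Omega>)"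
    by (simp add: algebra_simps)
  also have "\<dots> = (\<integral>x. f x * pderiv_dir b \<phi> x \<partial>lebesgue_on \<Omega>) + c * (\<integral>x. f' x * pderiv_dir b \<phi> x \<partial>lebesgue_on \<Omega>)"
    using L2 P by (simp add: L2_space_integrable_mult)
  also have "\<dots> = - ((\<integral>x. g x * \<phi> x \<partial>lebesgue_on \<Omega>) + c * (\<integral>x. g' x * \<phi> x \<partial>lebesgue_on \<Omega>))"
    using assms(6,7) \<phi> unfolding has_weak_pderiv_def by simp
  also have "(\<integral>x. g x * \<phi> x \<partial>lebesgue_on \<Omega>) + c * (\<integral>x. g' x * \<phi> x \<partial>lebesgue_on \<Omega>)
     = (\<integral>x. g x * \<phi> x + c * (g' x * \<phi> x) \<partial>lebesgue_on \<Omega>)"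
    using L2 P by (simp add: L2_space_integrable_mult)
  also have "\<dots> = (\<integral>x. (g x + c * g' x) * \<phi> x \<partial>lebesgue_on \<Omega>)"
    by (simp add: algebra_simps)
  finally show "(\<integral>x. (f x + c * f' x) * pderiv_dir b \<phi> x \<partial>lebesgue_on \<Omega>)
     = - (\<integral>x. (g x + c * g' x) * \<phi> x \<partial>lebesgue_on \<Omega>)" .
qed

lemma weak_pderiv_unique:
  assumes \<Omega>: "open \<Omega>" "bounded \<Omega>" and L2: "g \<in> L2_space \<Omega>" "g' \<in> L2_space \<Omega>"
    and "has_weak_pderiv \<Omega> b f g" "has_weak_pderiv \<Omega> b f g'"
  shows "AE x in lebesgue_on \<Omega>. g x = g' x"
proof -
  have "AE x in lebesgue_on \<Omega>. g x - g' x = 0"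
  proof (rule test_funs_orthogonal_imp_AE_zero[OF \<Omega>(1)])
    show "integrable (lebesgue_on \<Omega>) (\<lambda>x. g x - g' x)"
      using L2_space_integrable[OF \<Omega>] L2 by simp
    show "(\<integral>x. (g x - g' x) * \<phi> x \<partial>lebesgue_on \<Omega>) = 0" if \<phi>: "\<phi> \<in> test_funs \<Omega>" for \<phi>
      using assms(5,6) \<phi> L2 test_funs_L2[OF \<Omega>(1) \<phi>] unfolding has_weak_pderiv_def
      by (simp add: left_diff_distrib L2_space_integrable_mult)
  qed
  then show ?thesis by simp
qed

lemma is_weak_grad_weak_grad:
  assumes "v \<in> sobolev 1 \<Omega>"
  shows "is_weak_grad \<Omega> v (weak_grad \<Omega> v)"
proof -
  from assms have "\<forall>b\<in>Basis. \<exists>g\<in>L2_space \<Omega>. has_weak_pderiv \<Omega> b v g"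
    by (simp add: One_nat_def)
  then obtain g where g: "\<And>b. b \<in> Basis \<Longrightarrow> g b \<in> L2_space \<Omega> \<and> has_weak_pderiv \<Omega> b v (g b)"
    by metis
  have "is_weak_grad \<Omega> v (\<lambda>x. \<Sum>b\<in>Basis. g b x *\<^sub>R b)"
    using g by (simp add: is_weak_grad_def)
  then show ?thesis unfolding weak_grad_def by (rule someI[where P = "is_weak_grad \<Omega> v"])
qed

lemma sobolev1I:
  assumes "v \<in> L2_space \<Omega>" "is_weak_grad \<Omega> v g"
  shows "v \<in> sobolev 1 \<Omega>"
  using assms by (auto simp: One_nat_def is_weak_grad_def)

lemma sobolev1_L2: "v \<in> sobolev 1 \<Omega> \<Longrightarrow> v \<in> L2_space \<Omega>"
  by (simp add: One_nat_def)

lemma weak_grad_unique: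
  assumes \<Omega>: "open \<Omega>" "bounded \<Omega>" and "is_weak_grad \<Omega> v g" "is_weak_grad \<Omega> v g'"
  shows "AE x in lebesgue_on \<Omega>. g x = g' x"
proof -
  have "AE x in lebesgue_on \<Omega>. \<forall>b\<in>Basis. g x \<bullet> b = g' x \<bullet> b"
    using assms weak_pderiv_unique[OF \<Omega>] unfolding is_weak_grad_def
    by (intro AE_finite_allI) auto
  then show ?thesis by (rule eventually_mono) (auto intro: euclidean_eqI)
qed

lemma is_weak_grad_lin:
  fixes \<Omega> :: "'a::euclidean_space set"
  assumes "open \<Omega>" "v \<in> L2_space \<Omega>" "w \<in> L2_space \<Omega>" "is_weak_grad \<Omega> v g" "is_weak_grad \<Omega> w h"
  shows "is_weak_grad \<Omega> (\<lambda>x. v x + c * w x) (\<lambda>x. g x + c *\<^sub>R h x)"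
  unfolding is_weak_grad_def inner_add_left inner_scaleR_left
proof (intro ballI conjI)
  fix b :: 'a assume b: "b \<in> Basis"
  have L2: "(\<lambda>x. g x \<bullet> b) \<in> L2_space \<Omega>" "(\<lambda>x. h x \<bullet> b) \<in> L2_space \<Omega>"
    and weak: "has_weak_pderiv \<Omega> b v (\<lambda>x. g x \<bullet> b)" "has_weak_pderiv \<Omega> b w (\<lambda>x. h x \<bullet> b)"
    using assms(4,5) b unfolding is_weak_grad_def by simp_all
  show "(\<lambda>x. g x \<bullet> b + c * (h x \<bullet> b)) \<in> L2_space \<Omega>"
    using L2 by (rule L2_space_lin)
  show "has_weak_pderiv \<Omega> b (\<lambda>x. v x + c * w x) (\<lambda>x. g x \<bullet> b + c * (h x \<bullet> b))"
    using assms(1-3) L2 weak by (rule has_weak_pderiv_lin)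
qed

lemma sobolev1_lin:
  assumes "open \<Omega>" "v \<in> sobolev 1 \<Omega>" "w \<in> sobolev 1 \<Omega>"
  shows "(\<lambda>x. v x + c * w x) \<in> sobolev 1 \<Omega>"
proof -
  note L2 = assms(2,3)[THEN sobolev1_L2] and g = assms(2,3)[THEN is_weak_grad_weak_grad]
  show ?thesis
    by (rule sobolev1I[OF L2_space_lin[OF L2] is_weak_grad_lin[OF assms(1) L2 g]])
qed

lemma integrable_inner_weak_grads:
  assumes "is_weak_grad \<Omega> v g" "is_weak_grad \<Omega> w h"
  shows "integrable (lebesgue_on \<Omega>) (\<lambda>x. g x \<bullet> h x)"
  using assms unfolding is_weak_grad_def
  by (subst euclidean_inner) (intro Bochner_Integration.integrable_sum L2_space_integrable_mult, auto)

text \<open>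
  Any weak gradients may be used to evaluate the Dirichlet form, since they agree almost everywhere
  with the selected ones. Bilinearity follows by exhibiting a weak gradient of a linear combination.
\<close>

lemma dirichlet_form_eq:
  assumes "open \<Omega>" "bounded \<Omega>" "v \<in> L2_space \<Omega>" "w \<in> L2_space \<Omega>" "is_weak_grad \<Omega> v g" "is_weak_grad \<Omega> w h"
  shows "dirichlet_form \<Omega> v w = (\<integral>x. g x \<bullet> h x \<partial>lebesgue_on \<Omega>)"
proof -
  have gw: "is_weak_grad \<Omega> v (weak_grad \<Omega> v)" "is_weak_grad \<Omega> w (weak_grad \<Omega> w)"
    using assms by (auto intro!: is_weak_grad_weak_grad sobolev1I)
  have "AE x in lebesgue_on \<Omega>. weak_grad \<Omega> v x = g x" "AE x in lebesgue_on \<Omega>. weak_grad \<Omega> w x = h x"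
    using weak_grad_unique[OF assms(1,2)] gw assms by auto
  then have "AE x in lebesgue_on \<Omega>. weak_grad \<Omega> v x \<bullet> weak_grad \<Omega> w x = g x \<bullet> h x"
    by eventually_elim simp
  then show ?thesis
    unfolding dirichlet_form_def
    using integrable_inner_weak_grads[OF gw] integrable_inner_weak_grads[OF assms(5,6)]
    by (intro integral_cong_AE) auto
qed

lemma dirichlet_form_commute: "dirichlet_form \<Omega> v w = dirichlet_form \<Omega> w v"
  by (simp add: dirichlet_form_def inner_commute)

lemma dirichlet_form_nonneg: "0 \<le> dirichlet_form \<Omega> v v"
  by (simp add: dirichlet_form_def)

lemma dirichlet_form_lin:
  assumes "open \<Omega>" "bounded \<Omega>" "v \<in> sobolev 1 \<Omega>" "w \<in> sobolev 1 \<Omega>" "u \<in> sobolev 1 \<Omega>"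
  shows "dirichlet_form \<Omega> (\<lambda>x. v x + c * w x) u = dirichlet_form \<Omega> v u + c * dirichlet_form \<Omega> w u"
proof -
  note g = assms(3-5)[THEN is_weak_grad_weak_grad] and L = assms(3-5)[THEN sobolev1_L2]
  have "dirichlet_form \<Omega> (\<lambda>x. v x + c * w x) u
      = (\<integral>x. (weak_grad \<Omega> v x + c *\<^sub>R weak_grad \<Omega> w x) \<bullet> weak_grad \<Omega> u x \<partial>lebesgue_on \<Omega>)"
    by (rule dirichlet_form_eq[OF assms(1,2) L2_space_lin[OF L(1,2)] L(3)
          is_weak_grad_lin[OF assms(1) L(1,2) g(1,2)] g(3)])
  also have "\<dots> = (\<integral>x. weak_grad \<Omega> v x \<bullet> weak_grad \<Omega> u x + c * (weak_grad \<Omega> w x \<bullet> weak_grad \<Omega> u x) \<partial>lebesgue_on \<Omega>)"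
    by (simp add: inner_add_left)
  also have "\<dots> = dirichlet_form \<Omega> v u + c * dirichlet_form \<Omega> w u"
    unfolding dirichlet_form_def using g by (simp add: integrable_inner_weak_grads)
  finally show ?thesis .
qed

lemma dirichlet_form_lin_square:
  assumes "open \<Omega>" "bounded \<Omega>" "v \<in> sobolev 1 \<Omega>" "w \<in> sobolev 1 \<Omega>"
  shows "dirichlet_form \<Omega> (\<lambda>x. v x + c * w x) (\<lambda>x. v x + c * w x)
     = dirichlet_form \<Omega> v v + 2 * c * dirichlet_form \<Omega> v w + c\<^sup>2 * dirichlet_form \<Omega> w w"
proof -
  let ?z = "\<lambda>x. v x + c * w x"
  have z: "?z \<in> sobolev 1 \<Omega>" using assms(1,3,4) by (rule sobolev1_lin)
  have "dirichlet_form \<Omega> ?z ?z = dirichlet_form \<Omega> v ?z + c * dirichlet_form \<Omega> w ?z"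
    using assms z by (rule dirichlet_form_lin)
  also have "dirichlet_form \<Omega> v ?z = dirichlet_form \<Omega> v v + c * dirichlet_form \<Omega> w v"
    by (subst dirichlet_form_commute) (rule dirichlet_form_lin[OF assms assms(3)])
  also have "dirichlet_form \<Omega> w ?z = dirichlet_form \<Omega> v w + c * dirichlet_form \<Omega> w w"
    by (subst dirichlet_form_commute) (rule dirichlet_form_lin[OF assms assms(4)])
  finally show ?thesis
    using dirichlet_form_commute[of \<Omega> w v] by (simp add: algebra_simps power2_eq_square)
qed

text \<open>
  The parallelogram inequality: the form is nonnegative at \<open>v - c \<cdot> w\<close>.
\<close>

lemma dirichlet_form_lin_le:
  assumes "open \<Omega>" "bounded \<Omega>" "v \<in> sobolev 1 \<Omega>" "w \<in> sobolev 1 \<Omega>"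
  shows "dirichlet_form \<Omega> (\<lambda>x. v x + c * w x) (\<lambda>x. v x + c * w x)
     \<le> 2 * dirichlet_form \<Omega> v v + 2 * c\<^sup>2 * dirichlet_form \<Omega> w w"
  using dirichlet_form_lin_square[OF assms, of c] dirichlet_form_lin_square[OF assms, of "- c"]
    dirichlet_form_nonneg[of \<Omega> "\<lambda>x. v x + - c * w x"]
  by (simp add: algebra_simps)

lemma test_funs_is_weak_grad:
  assumes "open \<Omega>" "\<phi> \<in> test_funs \<Omega>"
  shows "is_weak_grad \<Omega> \<phi> (\<lambda>x. \<Sum>b\<in>Basis. pderiv_dir b \<phi> x *\<^sub>R b)"
  using assms by (simp add: is_weak_grad_def test_funs_L2 test_funs_weak_pderiv)

lemma test_funs_sobolev1: "open \<Omega> \<Longrightarrow> \<phi> \<in> test_funs \<Omega> \<Longrightarrow> \<phi> \<in> sobolev 1 \<Omega>"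
  by (rule sobolev1I[OF test_funs_L2(1) test_funs_is_weak_grad])

lemma test_funs_translation_le:
  fixes \<Omega> :: "'a::euclidean_space set"
  assumes "open \<Omega>" "bounded \<Omega>" "\<phi> \<in> test_funs \<Omega>"
  shows "(\<integral>x. (\<phi> (s + x) - \<phi> x)\<^sup>2 \<partial>lebesgue) \<le> (norm s)\<^sup>2 * dirichlet_form \<Omega> \<phi> \<phi>"
proof -
  let ?g = "\<lambda>x. \<Sum>b\<in>Basis. pderiv_dir b \<phi> x *\<^sub>R b"
  note C = test_funs_C1_compact[OF assms(3)] and g = test_funs_is_weak_grad[OF assms(1,3)]
  obtain K where K: "compact K" "K \<subseteq> \<Omega>" "\<And>x. x \<notin> K \<Longrightarrow> \<phi> x = 0"
    using assms(3) unfolding test_funs_def by blast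
  have zero: "frechet_derivative \<phi> (at x) s = 0" if "x \<notin> \<Omega>" for x
  proof -
    have "(\<phi> has_derivative frechet_derivative \<phi> (at x)) (at x)"
      using C unfolding C1_compact_def by blast
    moreover have "x \<notin> K" using that K(2) by blast
    ultimately have "frechet_derivative \<phi> (at x) = (\<lambda>s. 0)"
      using K(1,3) derivative_zero_outside[of \<phi> _ x K] by blast
    then show ?thesis by simp
  qed
  have "(\<integral>x. (\<phi> (s + x) - \<phi> x)\<^sup>2 \<partial>lebesgue) \<le> (\<integral>x. (frechet_derivative \<phi> (at x) s)\<^sup>2 \<partial>lebesgue)"
    by (rule translation_difference_le_derivative[OF C])
  also have "\<dots> = (\<integral>x. (frechet_derivative \<phi> (at x) s)\<^sup>2 \<partial>lebesgue_on \<Omega>)"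
    using assms(1) zero by (intro integral_lebesgue_on_zero_outside[symmetric]) auto
  also have "\<dots> \<le> (\<integral>x. (norm s)\<^sup>2 * (?g x \<bullet> ?g x) \<partial>lebesgue_on \<Omega>)"
  proof (rule integral_mono)
    show "integrable (lebesgue_on \<Omega>) (\<lambda>x. (frechet_derivative \<phi> (at x) s)\<^sup>2)"
      using integrable_mult_indicator[OF _ C1_compact_integrable(4)[OF C], of \<Omega> s] assms(1)
      by (simp add: integrable_restrict_space)
    show "integrable (lebesgue_on \<Omega>) (\<lambda>x. (norm s)\<^sup>2 * (?g x \<bullet> ?g x))"
      by (rule integrable_mult_right) (rule integrable_inner_weak_grads[OF g g])
    show "(frechet_derivative \<phi> (at x) s)\<^sup>2 \<le> (norm s)\<^sup>2 * (?g x \<bullet> ?g x)" for x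
      unfolding frechet_derivative_Basis[OF test_funs_smooth_supported(2)[OF assms(3)]] power2_norm_eq_inner
      by (rule Cauchy_Schwarz_ineq)
  qed
  also have "\<dots> = (norm s)\<^sup>2 * dirichlet_form \<Omega> \<phi> \<phi>"
    using dirichlet_form_eq[OF assms(1,2) test_funs_L2(1)[OF assms(1,3)] test_funs_L2(1)[OF assms(1,3)] g g]
    by simp
  finally show ?thesis .
qed

section \<open>The space \<open>H\<^sup>1\<^sub>0(\<Omega>)\<close>\<close>

text \<open>
  The square of the \<open>H\<^sup>1\<close> norm. Convergence to \<open>0\<close> is the same for both, and the square avoids
  Minkowski's inequality: a parallelogram bound is enough to handle sums.
\<close>

definition H1_square :: "'a::euclidean_space set \<Rightarrow> ('a \<Rightarrow> real) \<Rightarrow> real" where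
  "H1_square \<Omega> v = (\<integral>x. (v x)\<^sup>2 \<partial>lebesgue_on \<Omega>) + dirichlet_form \<Omega> v v"

lemma H1_square_nonneg: "0 \<le> H1_square \<Omega> v"
  by (simp add: H1_square_def dirichlet_form_nonneg)

lemma L2_norm_power2: "(L2_norm \<Omega> u)\<^sup>2 = (\<integral>x. (u x)\<^sup>2 \<partial>lebesgue_on \<Omega>)"
  by (simp add: L2_norm_def)

lemma H10_space_iff:
  "v \<in> H10_space \<Omega> \<longleftrightarrow> v \<in> sobolev 1 \<Omega> \<and>
     (\<exists>\<phi>. (\<forall>k. \<phi> k \<in> test_funs \<Omega>) \<and> (\<lambda>k. H1_square \<Omega> (\<lambda>x. v x - \<phi> k x)) \<longlonglongrightarrow> 0)"
proof -
  have eq: "H1_norm \<Omega> w = sqrt (H1_square \<Omega> w)" for w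
    by (simp add: H1_norm_def H1_square_def L2_norm_power2)
  have "((\<lambda>k. H1_norm \<Omega> (w k)) \<longlonglongrightarrow> 0) \<longleftrightarrow> ((\<lambda>k. H1_square \<Omega> (w k)) \<longlonglongrightarrow> 0)" for w :: "nat \<Rightarrow> 'a \<Rightarrow> real"
  proof
    assume "(\<lambda>k. H1_norm \<Omega> (w k)) \<longlonglongrightarrow> 0"
    then have "(\<lambda>k. (H1_norm \<Omega> (w k))\<^sup>2) \<longlonglongrightarrow> 0\<^sup>2" by (rule tendsto_power)
    then show "(\<lambda>k. H1_square \<Omega> (w k)) \<longlonglongrightarrow> 0" by (simp add: eq H1_square_nonneg)
  next
    assume "(\<lambda>k. H1_square \<Omega> (w k)) \<longlonglongrightarrow> 0"
    then have "(\<lambda>k. sqrt (H1_square \<Omega> (w k))) \<longlonglongrightarrow> sqrt 0" by (rule tendsto_real_sqrt)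
    then show "(\<lambda>k. H1_norm \<Omega> (w k)) \<longlonglongrightarrow> 0" by (simp add: eq)
  qed
  then show ?thesis unfolding H10_space_def by simp
qed

lemma H10_sobolev1: "v \<in> H10_space \<Omega> \<Longrightarrow> v \<in> sobolev 1 \<Omega>"
  by (simp add: H10_space_def)

lemma H10_L2: "v \<in> H10_space \<Omega> \<Longrightarrow> v \<in> L2_space \<Omega>"
  using H10_sobolev1 sobolev1_L2 by auto

lemma H1_square_lin_le:
  assumes "open \<Omega>" "bounded \<Omega>" "v \<in> sobolev 1 \<Omega>" "w \<in> sobolev 1 \<Omega>"
  shows "H1_square \<Omega> (\<lambda>x. v x + c * w x) \<le> 2 * H1_square \<Omega> v + 2 * c\<^sup>2 * H1_square \<Omega> w"
proof -
  note L2 = assms(3,4)[THEN sobolev1_L2]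
  have "(\<integral>x. (v x + c * w x)\<^sup>2 \<partial>lebesgue_on \<Omega>) \<le> (\<integral>x. 2 * (v x)\<^sup>2 + 2 * c\<^sup>2 * (w x)\<^sup>2 \<partial>lebesgue_on \<Omega>)"
  proof (rule integral_mono)
    show "integrable (lebesgue_on \<Omega>) (\<lambda>x. (v x + c * w x)\<^sup>2)"
      by (rule L2_space_integrable_power2[OF L2_space_lin[OF L2]])
    show "integrable (lebesgue_on \<Omega>) (\<lambda>x. 2 * (v x)\<^sup>2 + 2 * c\<^sup>2 * (w x)\<^sup>2)"
      using L2 by (simp add: L2_space_integrable_power2)
    show "(v x + c * w x)\<^sup>2 \<le> 2 * (v x)\<^sup>2 + 2 * c\<^sup>2 * (w x)\<^sup>2" for x
      using square_diff_le[of "v x" "- c * w x"] by (simp add: power_mult_distrib)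
  qed
  also have "\<dots> = 2 * (\<integral>x. (v x)\<^sup>2 \<partial>lebesgue_on \<Omega>) + 2 * c\<^sup>2 * (\<integral>x. (w x)\<^sup>2 \<partial>lebesgue_on \<Omega>)"
    using L2 by (simp add: L2_space_integrable_power2)
  finally show ?thesis
    using dirichlet_form_lin_le[OF assms, of c] by (simp add: H1_square_def algebra_simps)
qed

lemma H10_lin:
  assumes \<Omega>: "open \<Omega>" "bounded \<Omega>" and v: "v \<in> H10_space \<Omega>" and w: "w \<in> H10_space \<Omega>"
  shows "(\<lambda>x. v x + c * w x) \<in> H10_space \<Omega>"
proof -
  obtain \<phi> where \<phi>: "\<And>k. \<phi> k \<in> test_funs \<Omega>" "(\<lambda>k. H1_square \<Omega> (\<lambda>x. v x - \<phi> k x)) \<longlonglongrightarrow> 0"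
    using v unfolding H10_space_iff by blast
  obtain \<xi> where \<xi>: "\<And>k. \<xi> k \<in> test_funs \<Omega>" "(\<lambda>k. H1_square \<Omega> (\<lambda>x. w x - \<xi> k x)) \<longlonglongrightarrow> 0"
    using w unfolding H10_space_iff by blast
  have H1: "(\<lambda>x. v x - \<phi> k x) \<in> sobolev 1 \<Omega>" "(\<lambda>x. w x - \<xi> k x) \<in> sobolev 1 \<Omega>" for k
    using sobolev1_lin[OF \<Omega>(1) H10_sobolev1[OF v] test_funs_sobolev1[OF \<Omega>(1) \<phi>(1)], of "-1"]
      sobolev1_lin[OF \<Omega>(1) H10_sobolev1[OF w] test_funs_sobolev1[OF \<Omega>(1) \<xi>(1)], of "-1"]
    by simp_all
  have le: "H1_square \<Omega> (\<lambda>x. (v x + c * w x) - (\<phi> k x + c * \<xi> k x))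
      \<le> 2 * H1_square \<Omega> (\<lambda>x. v x - \<phi> k x) + 2 * c\<^sup>2 * H1_square \<Omega> (\<lambda>x. w x - \<xi> k x)" for k
  proof -
    have "(\<lambda>x. (v x + c * w x) - (\<phi> k x + c * \<xi> k x)) = (\<lambda>x. (v x - \<phi> k x) + c * (w x - \<xi> k x))"
      by (simp add: algebra_simps)
    then show ?thesis using H1_square_lin_le[OF \<Omega> H1(1)[of k] H1(2)[of k], of c] by simp
  qed
  have lim: "(\<lambda>k. 2 * H1_square \<Omega> (\<lambda>x. v x - \<phi> k x) + 2 * c\<^sup>2 * H1_square \<Omega> (\<lambda>x. w x - \<xi> k x)) \<longlonglongrightarrow> 2 * 0 + 2 * c\<^sup>2 * 0"
    by (intro tendsto_intros \<phi> \<xi>)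
  have "(\<lambda>k. H1_square \<Omega> (\<lambda>x. (v x + c * w x) - (\<phi> k x + c * \<xi> k x))) \<longlonglongrightarrow> 0"
    by (rule tendsto_sandwich[OF _ _ tendsto_const lim[simplified]])
       (use le H1_square_nonneg in \<open>auto intro!: always_eventually\<close>)
  moreover have "\<forall>k. (\<lambda>x. \<phi> k x + c * \<xi> k x) \<in> test_funs \<Omega>"
    using test_funs_lin[OF \<phi>(1) \<xi>(1)] by simp
  moreover have "(\<lambda>x. v x + c * w x) \<in> sobolev 1 \<Omega>"
    by (rule sobolev1_lin[OF \<Omega>(1) H10_sobolev1[OF v] H10_sobolev1[OF w]])
  ultimately show ?thesis
    unfolding H10_space_iff by (intro conjI exI[of _ "\<lambda>k x. \<phi> k x + c * \<xi> k x"])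
qed

lemma H1_square_zero:
  assumes "open \<Omega>" "bounded \<Omega>"
  shows "H1_square \<Omega> (\<lambda>x. 0) = 0"
proof -
  have "(\<lambda>x. 0) \<in> sobolev 1 \<Omega>"
    using test_funs_sobolev1[OF assms(1) zero_test_funs] .
  from dirichlet_form_lin[OF assms this this this, of "-1"] show ?thesis
    by (simp add: H1_square_def)
qed

lemma zero_H10:
  assumes "open \<Omega>" "bounded \<Omega>"
  shows "(\<lambda>x. 0) \<in> H10_space \<Omega>"
  unfolding H10_space_iff
  using test_funs_sobolev1[OF assms(1) zero_test_funs] zero_test_funs H1_square_zero[OF assms]
  by (intro conjI exI[of _ "\<lambda>k x. 0"]) auto

section \<open>Translates of zero extensions\<close>

definition zero_ext :: "'a set \<Rightarrow> ('a \<Rightarrow> real) \<Rightarrow> 'a \<Rightarrow> real" where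
  "zero_ext \<Omega> v x = (if x \<in> \<Omega> then v x else 0)"

lemma L2_zero_ext:
  fixes \<Omega> :: "'a::euclidean_space set"
  assumes "open \<Omega>" "v \<in> L2_space \<Omega>"
  shows "zero_ext \<Omega> v \<in> borel_measurable lebesgue"
    and "integrable lebesgue (\<lambda>x. (zero_ext \<Omega> v x)\<^sup>2)"
    and "(\<integral>x. (zero_ext \<Omega> v x)\<^sup>2 \<partial>lebesgue) = (\<integral>x. (v x)\<^sup>2 \<partial>lebesgue_on \<Omega>)"
proof -
  show meas: "zero_ext \<Omega> v \<in> borel_measurable lebesgue"
    using L2_space_measurable[OF assms(2)] assms(1) unfolding zero_ext_def
    by (subst borel_measurable_if) auto
  have eq: "(\<lambda>x. (zero_ext \<Omega> v x)\<^sup>2) = (\<lambda>x. indicator \<Omega> x *\<^sub>R (v x)\<^sup>2)"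
    by (auto simp: zero_ext_def indicator_def)
  show "integrable lebesgue (\<lambda>x. (zero_ext \<Omega> v x)\<^sup>2)"
    using L2_space_integrable_power2[OF assms(2)] assms(1) unfolding eq
    by (subst (asm) integrable_restrict_space) auto
  show "(\<integral>x. (zero_ext \<Omega> v x)\<^sup>2 \<partial>lebesgue) = (\<integral>x. (v x)\<^sup>2 \<partial>lebesgue_on \<Omega>)"
    unfolding eq using assms(1) by (subst integral_restrict_space) auto
qed

lemma zero_ext_translation_integrable:
  fixes \<Omega> :: "'a::euclidean_space set"
  assumes "open \<Omega>" "v \<in> L2_space \<Omega>"
  shows "integrable lebesgue (\<lambda>x. (zero_ext \<Omega> v (s + x))\<^sup>2)"
    and "integrable lebesgue (\<lambda>x. (zero_ext \<Omega> v (s + x) - zero_ext \<Omega> v x)\<^sup>2)"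
    and "(\<integral>x. (zero_ext \<Omega> v (s + x) - zero_ext \<Omega> v x)\<^sup>2 \<partial>lebesgue) \<le> 4 * (\<integral>x. (v x)\<^sup>2 \<partial>lebesgue_on \<Omega>)"
proof -
  note E = L2_zero_ext[OF assms]
  have meas: "(\<lambda>x. (zero_ext \<Omega> v x)\<^sup>2) \<in> borel_measurable lebesgue" using E(2) by (rule borel_measurable_integrable)
  show i1: "integrable lebesgue (\<lambda>x. (zero_ext \<Omega> v (s + x))\<^sup>2)"
    using integrable_translation[OF meas, of s] E(2) by simp
  have i2: "integrable lebesgue (\<lambda>x. 2 * (zero_ext \<Omega> v (s + x))\<^sup>2 + 2 * (zero_ext \<Omega> v x)\<^sup>2)"
    using i1 E(2) by simp
  show i3: "integrable lebesgue (\<lambda>x. (zero_ext \<Omega> v (s + x) - zero_ext \<Omega> v x)\<^sup>2)"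
  proof (rule Bochner_Integration.integrable_bound[OF i2])
    show "AE x in lebesgue. norm ((zero_ext \<Omega> v (s + x) - zero_ext \<Omega> v x)\<^sup>2)
        \<le> norm (2 * (zero_ext \<Omega> v (s + x))\<^sup>2 + 2 * (zero_ext \<Omega> v x)\<^sup>2)"
      using square_diff_le by simp
    show "(\<lambda>x. (zero_ext \<Omega> v (s + x) - zero_ext \<Omega> v x)\<^sup>2) \<in> borel_measurable lebesgue"
      by (intro borel_measurable_power borel_measurable_diff borel_measurable_translation E(1))
  qed
  have "(\<integral>x. (zero_ext \<Omega> v (s + x) - zero_ext \<Omega> v x)\<^sup>2 \<partial>lebesgue)
      \<le> (\<integral>x. 2 * (zero_ext \<Omega> v (s + x))\<^sup>2 + 2 * (zero_ext \<Omega> v x)\<^sup>2 \<partial>lebesgue)"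
    by (rule integral_mono[OF i3 i2 square_diff_le])
  also have "\<dots> = 4 * (\<integral>x. (v x)\<^sup>2 \<partial>lebesgue_on \<Omega>)"
    using i1 E(2) integral_translation[OF meas, of s] by (simp add: E(3))
  finally show "(\<integral>x. (zero_ext \<Omega> v (s + x) - zero_ext \<Omega> v x)\<^sup>2 \<partial>lebesgue) \<le> 4 * (\<integral>x. (v x)\<^sup>2 \<partial>lebesgue_on \<Omega>)" .
qed

text \<open>
  For test functions this is the bound by the directional derivative together with the
  Cauchy-Schwarz inequality. It survives the passage to the limit because translation differences are
  controlled by the \<open>L\<^sup>2\<close> norm. The factor \<open>4\<close> is the price of splitting off the approximation error
  twice with \<open>(a + b)\<^sup>2 \<le> 2 \<cdot> a\<^sup>2 + 2 \<cdot> b\<^sup>2\<close>.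
\<close>

lemma H10_translation_le:
  fixes \<Omega> :: "'a::euclidean_space set"
  assumes \<Omega>: "open \<Omega>" "bounded \<Omega>" and v: "v \<in> H10_space \<Omega>"
  shows "(\<integral>x. (zero_ext \<Omega> v (s + x) - zero_ext \<Omega> v x)\<^sup>2 \<partial>lebesgue) \<le> 4 * (norm s)\<^sup>2 * dirichlet_form \<Omega> v v"
proof -
  obtain \<phi> where \<phi>: "\<And>k. \<phi> k \<in> test_funs \<Omega>" "(\<lambda>k. H1_square \<Omega> (\<lambda>x. v x - \<phi> k x)) \<longlonglongrightarrow> 0"
    using v unfolding H10_space_iff by blast
  have "(\<integral>x. (zero_ext \<Omega> v (s + x) - zero_ext \<Omega> v x)\<^sup>2 \<partial>lebesgue)
      \<le> 4 * (norm s)\<^sup>2 * dirichlet_form \<Omega> v v + (4 * (norm s)\<^sup>2 + 8) * H1_square \<Omega> (\<lambda>x. v x - \<phi> k x)" for k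
  proof -
    define r where "r x = v x - \<phi> k x" for x
    note \<phi>1 = test_funs_sobolev1[OF \<Omega>(1) \<phi>(1)[of k]]
    have r1: "r \<in> sobolev 1 \<Omega>"
      using sobolev1_lin[OF \<Omega>(1) H10_sobolev1[OF v] \<phi>1, of "-1"] by (simp add: r_def[abs_def])
    have \<phi>_ext: "zero_ext \<Omega> (\<phi> k) = \<phi> k"
      using test_funs_smooth_supported(3)[OF \<phi>(1)] by (auto simp: zero_ext_def)
    have split: "zero_ext \<Omega> v x = \<phi> k x + zero_ext \<Omega> r x" for x
      using test_funs_smooth_supported(3)[OF \<phi>(1)[of k], of x] by (auto simp: zero_ext_def r_def)
    note i\<phi> = zero_ext_translation_integrable(2)[OF \<Omega>(1) sobolev1_L2[OF \<phi>1], of s, unfolded \<phi>_ext]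
      and ir = zero_ext_translation_integrable(2)[OF \<Omega>(1) sobolev1_L2[OF r1], of s]
    have "(\<integral>x. (zero_ext \<Omega> v (s + x) - zero_ext \<Omega> v x)\<^sup>2 \<partial>lebesgue)
        \<le> (\<integral>x. 2 * (\<phi> k (s + x) - \<phi> k x)\<^sup>2 + 2 * (zero_ext \<Omega> r (s + x) - zero_ext \<Omega> r x)\<^sup>2 \<partial>lebesgue)"
    proof (rule integral_mono)
      show "integrable lebesgue (\<lambda>x. (zero_ext \<Omega> v (s + x) - zero_ext \<Omega> v x)\<^sup>2)"
        by (rule zero_ext_translation_integrable(2)[OF \<Omega>(1) H10_L2[OF v]])
      show "integrable lebesgue (\<lambda>x. 2 * (\<phi> k (s + x) - \<phi> k x)\<^sup>2 + 2 * (zero_ext \<Omega> r (s + x) - zero_ext \<Omega> r x)\<^sup>2)"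
        using i\<phi> ir by simp
      show "(zero_ext \<Omega> v (s + x) - zero_ext \<Omega> v x)\<^sup>2
          \<le> 2 * (\<phi> k (s + x) - \<phi> k x)\<^sup>2 + 2 * (zero_ext \<Omega> r (s + x) - zero_ext \<Omega> r x)\<^sup>2" for x
        using square_diff_le[of "\<phi> k (s + x) - \<phi> k x" "- (zero_ext \<Omega> r (s + x) - zero_ext \<Omega> r x)"]
          power2_minus[of "zero_ext \<Omega> r (s + x) - zero_ext \<Omega> r x"]
        unfolding split by (simp only: diff_minus_eq_add add_diff_add)
    qed
    also have "\<dots> = 2 * (\<integral>x. (\<phi> k (s + x) - \<phi> k x)\<^sup>2 \<partial>lebesgue)
        + 2 * (\<integral>x. (zero_ext \<Omega> r (s + x) - zero_ext \<Omega> r x)\<^sup>2 \<partial>lebesgue)"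
      using i\<phi> ir by simp
    also have "\<dots> \<le> 2 * ((norm s)\<^sup>2 * dirichlet_form \<Omega> (\<phi> k) (\<phi> k)) + 2 * (4 * (\<integral>x. (r x)\<^sup>2 \<partial>lebesgue_on \<Omega>))"
      using test_funs_translation_le[OF \<Omega> \<phi>(1)[of k], of s]
        zero_ext_translation_integrable(3)[OF \<Omega>(1) sobolev1_L2[OF r1], of s]
      by (intro add_mono mult_left_mono) auto
    also have "dirichlet_form \<Omega> (\<phi> k) (\<phi> k) \<le> 2 * dirichlet_form \<Omega> v v + 2 * dirichlet_form \<Omega> r r"
      using dirichlet_form_lin_le[OF \<Omega> H10_sobolev1[OF v] r1, of "-1"] by (simp add: r_def)
    finally have "(\<integral>x. (zero_ext \<Omega> v (s + x) - zero_ext \<Omega> v x)\<^sup>2 \<partial>lebesgue)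
       \<le> 2 * ((norm s)\<^sup>2 * (2 * dirichlet_form \<Omega> v v + 2 * dirichlet_form \<Omega> r r)) + 2 * (4 * (\<integral>x. (r x)\<^sup>2 \<partial>lebesgue_on \<Omega>))"
      by (simp add: mult_left_mono)
    also have "\<dots> \<le> 4 * (norm s)\<^sup>2 * dirichlet_form \<Omega> v v + (4 * (norm s)\<^sup>2 + 8) * H1_square \<Omega> r"
      using dirichlet_form_nonneg[of \<Omega> r] by (simp add: H1_square_def algebra_simps)
    finally show ?thesis unfolding r_def .
  qed
  moreover have "(\<lambda>k. 4 * (norm s)\<^sup>2 * dirichlet_form \<Omega> v v + (4 * (norm s)\<^sup>2 + 8) * H1_square \<Omega> (\<lambda>x. v x - \<phi> k x))
      \<longlonglongrightarrow> 4 * (norm s)\<^sup>2 * dirichlet_form \<Omega> v v + (4 * (norm s)\<^sup>2 + 8) * 0"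
    by (intro tendsto_intros \<phi>)
  ultimately show ?thesis
    using LIMSEQ_le_const by fastforce
qed

text \<open>
  A translation by more than the diameter of \<open>\<Omega>\<close> separates \<open>v\<close> from its translate, so that the
  translation difference has twice the squared \<open>L\<^sup>2\<close> norm of \<open>v\<close>: this is Poincare's inequality.
\<close>

lemma dirichlet_form_definite:
  fixes \<Omega> :: "'a::euclidean_space set"
  assumes \<Omega>: "open \<Omega>" "bounded \<Omega>" and v: "v \<in> H10_space \<Omega>" and le: "dirichlet_form \<Omega> v v \<le> 0"
  shows "AE x in lebesgue_on \<Omega>. v x = 0"
proof -
  obtain B where B: "B > 0" "\<And>x. x \<in> \<Omega> \<Longrightarrow> norm x \<le> B"
    using \<Omega>(2) bounded_pos by metis
  obtain b :: 'a where b: "b \<in> Basis" using nonempty_Basis by blast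
  define s where "s = (3 * B) *\<^sub>R b"
  have disj: "s + x \<notin> \<Omega>" if "x \<in> \<Omega>" for x
  proof
    assume "s + x \<in> \<Omega>"
    then have "norm s \<le> B + B"
      using norm_triangle_ineq4[of "s + x" x] B(2)[OF that] B(2)[of "s + x"] by simp
    then show False using B(1) b by (simp add: s_def)
  qed
  note E = L2_zero_ext[OF \<Omega>(1) H10_L2[OF v]]
  have eq: "(zero_ext \<Omega> v (s + x) - zero_ext \<Omega> v x)\<^sup>2 = (zero_ext \<Omega> v (s + x))\<^sup>2 + (zero_ext \<Omega> v x)\<^sup>2" for x
    using disj[of x] by (auto simp: zero_ext_def)
  have "(\<integral>x. (zero_ext \<Omega> v x)\<^sup>2 \<partial>lebesgue) \<le> (\<integral>x. (zero_ext \<Omega> v (s + x) - zero_ext \<Omega> v x)\<^sup>2 \<partial>lebesgue)"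
    using E(2) zero_ext_translation_integrable[OF \<Omega>(1) H10_L2[OF v], of s]
    by (intro integral_mono) (auto simp: eq)
  also have "\<dots> \<le> 4 * (norm s)\<^sup>2 * dirichlet_form \<Omega> v v"
    by (rule H10_translation_le[OF \<Omega> v])
  also have "\<dots> \<le> 0" using le by (simp add: mult_nonneg_nonpos)
  finally have "(\<integral>x. (v x)\<^sup>2 \<partial>lebesgue_on \<Omega>) = 0"
    unfolding E(3) by (intro antisym integral_nonneg) auto
  then show ?thesis
    using integral_nonneg_eq_0_iff_AE[OF L2_space_integrable_power2[OF H10_L2[OF v]]] by simp
qed

text \<open>
  If \<open>v z \<noteq> 0\<close>, then \<open>\<bar>v\<bar> \<ge> c > 0\<close> on the part of a ball around \<open>z\<close> inside \<open>\<Omega>\<close>. As \<open>\<Omega>\<close> is the interior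
  of its closure, the ball contains a small ball \<open>A\<close> inside \<open>\<Omega>\<close> and a translate \<open>s + A\<close> outside.
  Move each point of \<open>A\<close> by \<open>s\<close> in \<open>N\<close> steps: it leaves \<open>\<Omega>\<close> in one of them, and there the zero
  extension jumps by at least \<open>c\<close>. Hence the \<open>N\<close> translation differences with increment \<open>s / N\<close> add up to
  at least \<open>c\<^sup>2\<close> times the measure of \<open>A\<close>, but each is of order \<open>1 / N\<^sup>2\<close>.
\<close>

lemma H10_continuous_zero_on_frontier:
  fixes \<Omega> :: "'a::euclidean_space set"
  assumes \<Omega>: "open \<Omega>" "bounded \<Omega>" "interior (closure \<Omega>) = \<Omega>"
    and v: "v \<in> H10_space \<Omega>" "continuous_on (closure \<Omega>) v"
    and z: "z \<in> closure \<Omega>" "z \<notin> \<Omega>"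
  shows "v z = 0"
proof (rule ccontr)
  assume nz: "v z \<noteq> 0"
  define c where "c = \<bar>v z\<bar> / 2"
  have c: "c > 0" using nz by (simp add: c_def)
  obtain \<rho> where \<rho>: "\<rho> > 0" "\<And>x. x \<in> closure \<Omega> \<Longrightarrow> dist x z < \<rho> \<Longrightarrow> dist (v x) (v z) < c"
    using v(2) z(1) c unfolding continuous_on_iff by metis
  have big: "\<bar>v x\<bar> \<ge> c" if "x \<in> \<Omega>" "x \<in> ball z \<rho>" for x
  proof -
    have "\<bar>v x - v z\<bar> < c"
      using \<rho>(2)[of x] that closure_subset[of \<Omega>] by (auto simp: dist_commute dist_real_def)
    then show ?thesis using abs_triangle_ineq2_sym[of "v z" "v x"] by (simp add: c_def)
  qed
  have "ball z \<rho> \<inter> \<Omega> \<noteq> {}"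
    using z(1) \<rho>(1) unfolding closure_approachable by (force simp: dist_commute)
  moreover have "open (ball z \<rho> \<inter> \<Omega>)" using \<Omega>(1) by auto
  ultimately obtain a r1 where a: "r1 > 0" "ball a r1 \<subseteq> ball z \<rho> \<inter> \<Omega>"
    by (metis equals0I open_contains_ball)
  have "\<not> ball z \<rho> \<subseteq> closure \<Omega>"
    using z(2) \<rho>(1) \<Omega>(3) mem_interior by blast
  then have "ball z \<rho> - closure \<Omega> \<noteq> {}" by auto
  moreover have "open (ball z \<rho> - closure \<Omega>)" by (intro open_Diff) auto
  ultimately obtain b r2 where b: "r2 > 0" "ball b r2 \<subseteq> ball z \<rho> - closure \<Omega>"
    by (metis equals0I open_contains_ball)
  define r where "r = min r1 r2"
  define s where "s = b - a"
  define A where "A = ball a r"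
  have r: "r > 0" using a b by (simp add: r_def)
  have A_in: "x \<in> ball z \<rho>" "x \<in> \<Omega>" "s + x \<in> ball z \<rho>" "s + x \<notin> \<Omega>" if "x \<in> A" for x
  proof -
    have "x \<in> ball a r1" using that by (simp add: A_def r_def)
    then show "x \<in> ball z \<rho>" "x \<in> \<Omega>" using a(2) by auto
    have "dist b (s + x) = dist a x" by (simp add: s_def dist_norm algebra_simps)
    then have "s + x \<in> ball b r2" using that by (simp add: A_def r_def)
    then show "s + x \<in> ball z \<rho>" "s + x \<notin> \<Omega>" using b(2) closure_subset[of \<Omega>] by auto
  qed
  let ?E = "zero_ext \<Omega> v"
  define C where "C = 4 * (norm s)\<^sup>2 * dirichlet_form \<Omega> v v"
  note meas = L2_zero_ext(1)[OF \<Omega>(1) H10_L2[OF v(1)]]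
  have A_meas: "A \<in> lmeasurable" by (simp add: A_def)
  have key: "c\<^sup>2 * measure lebesgue A \<le> C / real (Suc n)" for n
  proof -
    let ?N = "real (Suc n)"
    define G where "G i x = ?E ((real i / ?N) *\<^sub>R s + x)" for i x
    have step_eq: "(G (Suc i) x - G i x)\<^sup>2
        = (\<lambda>x. (?E ((1 / ?N) *\<^sub>R s + x) - ?E x)\<^sup>2) ((real i / ?N) *\<^sub>R s + x)" for i x
    proof -
      have "(real (Suc i) / ?N) *\<^sub>R s + x = (1 / ?N) *\<^sub>R s + ((real i / ?N) *\<^sub>R s + x)"
        by (simp add: add_divide_distrib scaleR_left.add add.assoc)
      then show ?thesis unfolding G_def by presburger
    qed
    define Q where "Q x = (?E ((1 / ?N) *\<^sub>R s + x) - ?E x)\<^sup>2" for x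
    have Q_int: "integrable lebesgue Q"
      unfolding Q_def by (rule zero_ext_translation_integrable(2)[OF \<Omega>(1) H10_L2[OF v(1)]])
    have Q_meas: "Q \<in> borel_measurable lebesgue" using Q_int by (rule borel_measurable_integrable)
    have int: "integrable lebesgue (\<lambda>x. Q ((real i / ?N) *\<^sub>R s + x))" for i
      using integrable_translation[OF Q_meas] Q_int by simp
    have "c\<^sup>2 * indicator A x \<le> (\<Sum>i<Suc n. Q ((real i / ?N) *\<^sub>R s + x))" for x
    proof (cases "x \<in> A")
      case True
      have "\<exists>i<Suc n. (real i / ?N) *\<^sub>R s + x \<in> \<Omega> \<and> (real (Suc i) / ?N) *\<^sub>R s + x \<notin> \<Omega>"
      proof (rule ccontr)
        assume none: "\<not> ?thesis"
        have "(real i / ?N) *\<^sub>R s + x \<in> \<Omega>" if "i \<le> Suc n" for i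
          using that
        proof (induction i)
          case 0
          then show ?case using A_in(2)[OF True] by simp
        next
          case (Suc i)
          then show ?case using none by (meson Suc_le_lessD less_imp_le_nat)
        qed
        from this[of "Suc n"] show False using A_in(4)[OF True] by simp
      qed
      then obtain i where i: "i < Suc n" "(real i / ?N) *\<^sub>R s + x \<in> \<Omega>" "(real (Suc i) / ?N) *\<^sub>R s + x \<notin> \<Omega>"
        by blast
      define t where "t = real i / ?N"
      have t: "0 \<le> t" "t \<le> 1" using i(1) by (auto simp: t_def divide_simps)
      have "(1 - t) *\<^sub>R x + t *\<^sub>R (s + x) \<in> ball z \<rho>"
        using convexD[OF convex_ball A_in(1)[OF True] A_in(3)[OF True], of "1 - t" t] t by simp
      moreover have "(1 - t) *\<^sub>R x + t *\<^sub>R (s + x) = t *\<^sub>R s + x" by (simp add: algebra_simps)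
      ultimately have "c \<le> \<bar>v (t *\<^sub>R s + x)\<bar>" using big i(2) by (simp add: t_def)
      then have "c\<^sup>2 \<le> (v (t *\<^sub>R s + x))\<^sup>2" using c by (metis abs_le_square_iff abs_of_pos)
      also have "\<dots> = (G (Suc i) x - G i x)\<^sup>2"
        using i(2,3) by (simp add: G_def zero_ext_def t_def)
      also have "\<dots> = Q ((real i / ?N) *\<^sub>R s + x)" unfolding step_eq Q_def ..
      also have "\<dots> \<le> (\<Sum>i<Suc n. Q ((real i / ?N) *\<^sub>R s + x))"
        using i(1) by (intro member_le_sum) (auto simp: Q_def)
      finally show ?thesis using True by simp
    next
      case False
      have "0 \<le> (\<Sum>i<Suc n. Q ((real i / ?N) *\<^sub>R s + x))"
        by (intro sum_nonneg) (simp add: Q_def)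
      then show ?thesis using False by simp
    qed
    then have "(\<integral>x. c\<^sup>2 * indicator A x \<partial>lebesgue) \<le> (\<integral>x. (\<Sum>i<Suc n. Q ((real i / ?N) *\<^sub>R s + x)) \<partial>lebesgue)"
      using A_meas int by (intro integral_mono integrable_mult_right integrable_real_indicator Bochner_Integration.integrable_sum)
        (auto simp: fmeasurable_def)
    also have "\<dots> = (\<Sum>i<Suc n. \<integral>x. Q ((real i / ?N) *\<^sub>R s + x) \<partial>lebesgue)"
      using int by (rule Bochner_Integration.integral_sum)
    also have "\<dots> = ?N * (\<integral>x. Q x \<partial>lebesgue)"
      by (simp add: integral_translation[OF Q_meas] del: of_nat_Suc)
    also have "\<dots> \<le> ?N * (4 * (norm ((1 / ?N) *\<^sub>R s))\<^sup>2 * dirichlet_form \<Omega> v v)"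
      unfolding Q_def by (intro mult_left_mono H10_translation_le \<Omega> v) auto
    also have "\<dots> = C / ?N"
      by (simp add: C_def power2_eq_square field_simps del: of_nat_Suc)
    finally show ?thesis using A_meas by (simp add: fmeasurableD)
  qed
  have "(\<lambda>n. C * inverse (real (Suc n))) \<longlonglongrightarrow> C * 0"
    by (intro tendsto_intros LIMSEQ_inverse_real_of_nat)
  then have "c\<^sup>2 * measure lebesgue A \<le> 0"
    using key LIMSEQ_le_const[of _ "C * 0" "c\<^sup>2 * measure lebesgue A"] by (auto simp: divide_inverse)
  moreover have "measure lebesgue A > 0"
    unfolding A_def using r by (simp add: content_ball_pos measure_completion)
  ultimately show False using c by (simp add: mult_le_0_iff)
qed

section \<open>Finite element functions\<close>

lemma affine_interpolation:
  fixes C :: "'a::euclidean_space set" and g :: "'a \<Rightarrow> real"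
  assumes "\<not> affine_dependent C"
  shows "\<exists>a c. \<forall>z\<in>C. a \<bullet> z + c = g z"
proof (cases "C = {}")
  case False
  then obtain z0 where z0: "z0 \<in> C" by auto
  then have "independent ((\<lambda>x. - z0 + x) ` (C - {z0}))"
    using assms affine_dependent_iff_dependent2 by blast
  then obtain f where f: "linear f" "\<And>y. y \<in> (\<lambda>x. - z0 + x) ` (C - {z0}) \<Longrightarrow> f y = g (z0 + y) - g z0"
    using linear_independent_extend[of _ "\<lambda>y. g (z0 + y) - g z0"] by blast
  define a where "a = (\<Sum>b\<in>Basis. f b *\<^sub>R b)"
  have fa: "f y = a \<bullet> y" for y
  proof -
    have "f y = f (\<Sum>b\<in>Basis. (y \<bullet> b) *\<^sub>R b)" by (simp add: euclidean_representation)
    also have "\<dots> = (\<Sum>b\<in>Basis. (y \<bullet> b) * f b)"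
      by (simp add: linear_sum[OF f(1)] linear_scale[OF f(1)])
    finally show ?thesis by (simp add: a_def inner_sum_left inner_commute[of y] mult.commute)
  qed
  have "a \<bullet> z + (g z0 - a \<bullet> z0) = g z" if "z \<in> C" for z
  proof (cases "z = z0")
    case False
    then have "f (- z0 + z) = g z - g z0" using f(2)[of "- z0 + z"] that by auto
    then show ?thesis by (simp add: fa inner_diff_right)
  qed simp
  then show ?thesis by blast
qed simp

lemma convex_affine_nonneg: "convex {x. 0 \<le> a \<bullet> x + (c::real)}"
proof -
  have "{x. 0 \<le> a \<bullet> x + c} = {x. a \<bullet> x \<ge> - c}" by auto
  then show ?thesis by (simp add: convex_halfspace_ge)
qed

lemma convex_affine_eq: "convex {x. a \<bullet> x + c = b \<bullet> x + (d::real)}"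
proof -
  have "{x. a \<bullet> x + c = b \<bullet> x + d} = {x. (a - b) \<bullet> x = d - c}" by (auto simp: inner_diff_left)
  then show ?thesis by (simp add: convex_hyperplane)
qed

lemma admissible_triangulation_elements:
  fixes \<T> :: "'a::euclidean_space set set"
  assumes "admissible_triangulation \<Omega> \<T>"
  shows "finite \<T>" "closure \<Omega> = \<Union>\<T>" "\<And>T. T \<in> \<T> \<Longrightarrow> closed T"
    and "\<And>T. T \<in> \<T> \<Longrightarrow> \<exists>C. finite C \<and> \<not> affine_dependent C \<and> T = convex hull C \<and> C = {z. z extreme_point_of T}"
    and "\<And>T T'. T \<in> \<T> \<Longrightarrow> T' \<in> \<T> \<Longrightarrow> T \<inter> T' face_of T"
proof -
  note A = assms[unfolded admissible_triangulation_def triangulation_def]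
  show "finite \<T>" "closure \<Omega> = \<Union>\<T>" "\<And>T T'. T \<in> \<T> \<Longrightarrow> T' \<in> \<T> \<Longrightarrow> T \<inter> T' face_of T"
    using A by auto
  show "closed T" if "T \<in> \<T>" for T using A that closed_simplex by blast
  show "\<exists>C. finite C \<and> \<not> affine_dependent C \<and> T = convex hull C \<and> C = {z. z extreme_point_of T}" if "T \<in> \<T>" for T
  proof -
    have "\<exists>n. n simplex T" using A that by simp
    then obtain C where C: "finite C" "\<not> affine_dependent C" "T = convex hull C"
      unfolding simplex by (elim exE conjE)
    then have "C = {z. z extreme_point_of T}"
      by (simp add: extreme_point_of_convex_hull_affine_independent)
    then show ?thesis using C by (intro exI[of _ C] conjI)
  qed
qed

lemma finite_vertices:
  assumes "admissible_triangulation \<Omega> \<T>"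
  shows "finite (vertices \<T>)"
proof -
  have "vertices \<T> = (\<Union>T\<in>\<T>. {z. z extreme_point_of T})"
    by (auto simp: vertices_def)
  moreover have "finite {z. z extreme_point_of T}" if "T \<in> \<T>" for T
    using admissible_triangulation_elements(4)[OF assms that] by auto
  ultimately show ?thesis using admissible_triangulation_elements(1)[OF assms] by simp
qed

lemma vertices_subset_closure:
  assumes "admissible_triangulation \<Omega> \<T>"
  shows "vertices \<T> \<subseteq> closure \<Omega>"
  unfolding admissible_triangulation_elements(2)[OF assms] vertices_def extreme_point_of_def by blast

lemma FE_space_lin:
  assumes "v \<in> FE_space \<Omega> \<T>" "w \<in> FE_space \<Omega> \<T>"
  shows "(\<lambda>x. v x + c * w x) \<in> FE_space \<Omega> \<T>"
proof -
  have "\<exists>a d. \<forall>x\<in>T. v x + c * w x = a \<bullet> x + d" if "T \<in> \<T>" for T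
  proof -
    have "\<exists>a d. \<forall>x\<in>T. v x = a \<bullet> x + d" "\<exists>a d. \<forall>x\<in>T. w x = a \<bullet> x + d"
      using assms that unfolding FE_space_def by simp_all
    then obtain a1 d1 a2 d2 where "\<forall>x\<in>T. v x = a1 \<bullet> x + d1" "\<forall>x\<in>T. w x = a2 \<bullet> x + d2"
      by (elim exE)
    then have "\<forall>x\<in>T. v x + c * w x = (a1 + c *\<^sub>R a2) \<bullet> x + (d1 + c * d2)"
      by (simp add: inner_add_left distrib_left)
    then show ?thesis by (intro exI)
  qed
  moreover have "continuous_on (closure \<Omega>) (\<lambda>x. v x + c * w x)"
    using assms unfolding FE_space_def by (intro continuous_on_add continuous_on_mult_left) simp_all
  moreover have "\<forall>x. x \<notin> closure \<Omega> \<longrightarrow> v x + c * w x = 0"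
    using assms unfolding FE_space_def by simp
  ultimately show ?thesis
    unfolding FE_space_def by simp
qed

text \<open>
  On each simplex an affine function that is nonnegative at the extreme points is nonnegative.
\<close>

lemma FE_space_nonneg:
  assumes tri: "admissible_triangulation \<Omega> \<T>" and v: "v \<in> FE_space \<Omega> \<T>"
    and nonneg: "\<And>z. z \<in> vertices \<T> \<Longrightarrow> 0 \<le> v z"
  shows "0 \<le> v x"
proof (cases "x \<in> closure \<Omega>")
  case True
  then obtain T where T: "T \<in> \<T>" "x \<in> T"
    using admissible_triangulation_elements(2)[OF tri] by blast
  obtain C where C: "T = convex hull C" "C = {z. z extreme_point_of T}"
    using admissible_triangulation_elements(4)[OF tri T(1)] by blast
  obtain a c where ac: "\<And>x. x \<in> T \<Longrightarrow> v x = a \<bullet> x + c"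
    using v T(1) unfolding FE_space_def by blast
  have "C \<subseteq> {x. 0 \<le> a \<bullet> x + c}"
  proof
    fix z assume z: "z \<in> C"
    then have "z \<in> vertices \<T>" using C(2) T(1) by (auto simp: vertices_def)
    moreover have "z \<in> T" using z C(1) hull_inc by metis
    ultimately show "z \<in> {x. 0 \<le> a \<bullet> x + c}" using nonneg ac by fastforce
  qed
  then have "T \<subseteq> {x. 0 \<le> a \<bullet> x + c}"
    unfolding C(1) by (rule hull_minimal) (rule convex_affine_nonneg)
  then show ?thesis using T(2) ac by auto
next
  case False
  then show ?thesis using v by (simp add: FE_space_def)
qed

lemma FE_space_eqI:
  assumes tri: "admissible_triangulation \<Omega> \<T>" and "v \<in> FE_space \<Omega> \<T>" "w \<in> FE_space \<Omega> \<T>"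
    and eq: "\<And>z. z \<in> vertices \<T> \<Longrightarrow> v z = w z"
  shows "v = w"
proof
  fix x
  have "0 \<le> v x + (-1) * w x"
    by (rule FE_space_nonneg[OF tri FE_space_lin[OF assms(2,3)]]) (simp add: eq)
  moreover have "0 \<le> w x + (-1) * v x"
    by (rule FE_space_nonneg[OF tri FE_space_lin[OF assms(3,2)]]) (simp add: eq)
  ultimately show "v x = w x" by simp
qed

text \<open>
  Vertex values determine an affine function on each simplex. Conformity makes these functions agree
  on an intersection of two simplices: it is a common face, hence the convex hull of vertices that
  both simplices share.
\<close>

lemma FE_space_interpolation:
  fixes \<Omega> :: "'a::euclidean_space set"
  assumes tri: "admissible_triangulation \<Omega> \<T>"
  shows "\<exists>v\<in>FE_space \<Omega> \<T>. \<forall>z\<in>vertices \<T>. v z = g z"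
proof -
  note elements = admissible_triangulation_elements[OF tri]
  have "\<forall>T\<in>\<T>. \<exists>a c. \<forall>z. z extreme_point_of T \<longrightarrow> a \<bullet> z + c = g z"
    using elements(4) affine_interpolation by (metis mem_Collect_eq)
  then obtain a c where ac: "\<And>T z. T \<in> \<T> \<Longrightarrow> z extreme_point_of T \<Longrightarrow> a T \<bullet> z + c T = g z"
    by metis
  have agree: "a T \<bullet> x + c T = a T' \<bullet> x + c T'" if T: "T \<in> \<T>" "T' \<in> \<T>" and x: "x \<in> T \<inter> T'" for T T' x
  proof -
    have F: "T \<inter> T' face_of T" "T \<inter> T' face_of T'"
      using elements(5)[OF T] elements(5)[OF T(2,1)] by (simp_all add: Int_commute)
    have "compact T" "convex T" "compact T'" "convex T'"
      using elements(4)[OF T(1)] elements(4)[OF T(2)] finite_imp_compact_convex_hull convex_convex_hull by metis+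
    then have "T \<inter> T' = convex hull {z. z extreme_point_of (T \<inter> T')}"
      by (intro Krein_Milman_Minkowski compact_Int convex_Int)
    also have "\<dots> \<subseteq> {x. a T \<bullet> x + c T = a T' \<bullet> x + c T'}"
    proof (intro hull_minimal convex_affine_eq subsetI)
      fix z assume "z \<in> {z. z extreme_point_of (T \<inter> T')}"
      then have "z extreme_point_of T" "z extreme_point_of T'"
        using extreme_point_of_face[OF F(1), of z] extreme_point_of_face[OF F(2), of z] by simp_all
      then show "z \<in> {x. a T \<bullet> x + c T = a T' \<bullet> x + c T'}"
        using ac T by simp
    qed
    finally show ?thesis using x by blast
  qed
  define v where "v x = (if x \<in> closure \<Omega> then let T = (SOME T. T \<in> \<T> \<and> x \<in> T) in a T \<bullet> x + c T else 0)" for x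
  have v: "v x = a T \<bullet> x + c T" if "T \<in> \<T>" "x \<in> T" for T x
  proof -
    define T' where "T' = (SOME T. T \<in> \<T> \<and> x \<in> T)"
    have T': "T' \<in> \<T> \<and> x \<in> T'"
      unfolding T'_def by (rule someI[of "\<lambda>T. T \<in> \<T> \<and> x \<in> T" T]) (use that in simp)
    have "x \<in> closure \<Omega>" using that elements(2) by auto
    then have "v x = a T' \<bullet> x + c T'" by (simp add: v_def T'_def Let_def)
    also have "\<dots> = a T \<bullet> x + c T" using T' that by (intro agree) simp_all
    finally show ?thesis .
  qed
  have "continuous_on (\<Union>T\<in>\<T>. T) v"
  proof (rule continuous_on_closed_Union)
    show "continuous_on T v" if "T \<in> \<T>" for T
    proof (rule continuous_on_eq)
      show "continuous_on T (\<lambda>x. a T \<bullet> x + c T)" by (intro continuous_intros)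
      show "a T \<bullet> x + c T = v x" if "x \<in> T" for x using v[OF \<open>T \<in> \<T>\<close> that] by simp
    qed
  qed (use elements(1,3) in simp_all)
  moreover have "\<forall>T\<in>\<T>. \<exists>a c. \<forall>x\<in>T. v x = a \<bullet> x + c"
    using v by metis
  moreover have "\<forall>x. x \<notin> closure \<Omega> \<longrightarrow> v x = 0"
    by (simp add: v_def)
  ultimately have "v \<in> FE_space \<Omega> \<T>"
    using elements(2) unfolding FE_space_def by simp
  moreover have "v z = g z" if z: "z \<in> vertices \<T>" for z
  proof -
    obtain T where T: "T \<in> \<T>" "z extreme_point_of T" using z unfolding vertices_def by blast
    then have "z \<in> T" by (simp add: extreme_point_of_def)
    then show ?thesis using v[OF T(1)] ac[OF T] by simp
  qed
  ultimately show ?thesis by blast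
qed

lemma nodal_basis:
  assumes tri: "admissible_triangulation \<Omega> \<T>"
  shows "nodal_basis \<Omega> \<T> z \<in> FE_space \<Omega> \<T>"
    and "z' \<in> vertices \<T> \<Longrightarrow> nodal_basis \<Omega> \<T> z z' = (if z' = z then 1 else 0)"
proof -
  let ?P = "\<lambda>v. v \<in> FE_space \<Omega> \<T> \<and> (\<forall>z'\<in>vertices \<T>. v z' = (if z' = z then 1 else 0))"
  obtain v0 where v0: "?P v0"
    using FE_space_interpolation[OF tri, of "\<lambda>z'. if z' = z then 1 else 0"] by blast
  have "?P (nodal_basis \<Omega> \<T> z)"
    unfolding nodal_basis_def
  proof (rule theI[of ?P, OF v0])
    show "v = v0" if "?P v" for v
      by (rule FE_space_eqI[OF tri]) (use that v0 in simp_all)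
  qed
  then show "nodal_basis \<Omega> \<T> z \<in> FE_space \<Omega> \<T>"
    and "z' \<in> vertices \<T> \<Longrightarrow> nodal_basis \<Omega> \<T> z z' = (if z' = z then 1 else 0)"
    by auto
qed

lemma FE_space_integrable:
  fixes \<Omega> :: "'a::euclidean_space set"
  assumes \<Omega>: "open \<Omega>" "bounded \<Omega>" and v: "v \<in> FE_space \<Omega> \<T>"
  shows "integrable (lebesgue_on \<Omega>) v"
proof -
  have c: "continuous_on (closure \<Omega>) v" using v by (simp add: FE_space_def)
  have "compact (closure \<Omega>)" using \<Omega>(2) by simp
  then have "bounded (v ` closure \<Omega>)" by (intro compact_imp_bounded compact_continuous_image c)
  then obtain B where "\<And>x. x \<in> closure \<Omega> \<Longrightarrow> \<bar>v x\<bar> \<le> B"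
    unfolding bounded_iff by auto
  then have B: "\<And>x. x \<in> \<Omega> \<Longrightarrow> \<bar>v x\<bar> \<le> B" using closure_subset by blast
  have "v \<in> borel_measurable (lebesgue_on \<Omega>)"
    using continuous_on_subset[OF c closure_subset] \<Omega>(1)
    by (intro continuous_imp_measurable_on_sets_lebesgue) auto
  then show ?thesis
    by (rule L2_space_integrable[OF \<Omega> L2_space_bounded[OF \<Omega> _ B]])
qed

text \<open>
  The quadrature weights of mass lumping.
\<close>

definition nodal_weight :: "'a::euclidean_space set \<Rightarrow> 'a set set \<Rightarrow> 'a \<Rightarrow> real" where
  "nodal_weight \<Omega> \<T> z = (\<integral>x. nodal_basis \<Omega> \<T> z x \<partial>lebesgue_on \<Omega>)"

lemma nodal_weight_nonneg:
  assumes tri: "admissible_triangulation \<Omega> \<T>"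
  shows "0 \<le> nodal_weight \<Omega> \<T> z"
proof -
  have "0 \<le> nodal_basis \<Omega> \<T> z x" for x
    by (rule FE_space_nonneg[OF tri nodal_basis(1)[OF tri]]) (simp add: nodal_basis(2)[OF tri])
  then show ?thesis
    unfolding nodal_weight_def by (intro Bochner_Integration.integral_nonneg) simp
qed

lemma integral_lagrange_interp:
  assumes \<Omega>: "open \<Omega>" "bounded \<Omega>" and tri: "admissible_triangulation \<Omega> \<T>"
  shows "(\<integral>x. lagrange_interp \<Omega> \<T> g x \<partial>lebesgue_on \<Omega>) = (\<Sum>z\<in>vertices \<T>. nodal_weight \<Omega> \<T> z * g z)"
  unfolding lagrange_interp_def nodal_weight_def
  using FE_space_integrable[OF \<Omega> nodal_basis(1)[OF tri]]
  by (subst Bochner_Integration.integral_sum) (simp_all add: mult.commute)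

section \<open>Semilinear equations in a finite-dimensional function space\<close>

text \<open>
  The fourth power is, up to a factor, the antiderivative of the penalty nonlinearity; it enters the
  energy whose critical points are the discrete states.
\<close>

lemma neg_part_power4_deriv:
  "((\<lambda>t. (neg_part t) ^ 4) has_real_derivative 4 * (neg_part t) ^ 3) (at t)"
proof -
  consider "t > 0" | "t < 0" | "t = 0" by linarith
  then show ?thesis
  proof cases
    case 1
    show ?thesis
      by (rule has_field_derivative_transform_within_open[of "\<lambda>t. 0" _ _ "{0<..}"])
         (use 1 in \<open>auto simp: neg_part_def min_def\<close>)
  next
    case 2
    show ?thesis
      by (rule has_field_derivative_transform_within_open[of "\<lambda>t. t ^ 4" _ _ "{..<0}"])
         (use 2 in \<open>auto simp: neg_part_def min_def intro!: derivative_eq_intros\<close>)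
  next
    case 3
    have "((\<lambda>h. (neg_part h) ^ 4 / h) \<longlongrightarrow> 0) (at 0)"
    proof (rule Lim_null_comparison)
      have "norm ((neg_part h) ^ 4 / h) \<le> \<bar>h\<bar> ^ 3" for h
      proof (cases "h < 0")
        case True
        then have "(neg_part h) ^ 4 / h = h ^ 3"
          by (simp add: neg_part_def power4_eq_xxxx power3_eq_cube)
        then show ?thesis by (simp add: power_abs)
      qed (simp add: neg_part_def)
      then show "\<forall>\<^sub>F h in at 0. norm ((neg_part h) ^ 4 / h) \<le> \<bar>h\<bar> ^ 3" by simp
      have "((\<lambda>h. \<bar>h\<bar> ^ 3) \<longlongrightarrow> \<bar>0\<bar> ^ 3) (at (0::real))" by (intro tendsto_intros)
      then show "((\<lambda>h. \<bar>h\<bar> ^ 3) \<longlongrightarrow> 0) (at (0::real))" by simp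
    qed
    then show ?thesis using 3 by (simp add: DERIV_def neg_part_def)
  qed
qed

text \<open>
  Linear subspaces of the space of real functions on a set, with one closure condition for sums and
  multiples together.
\<close>

locale function_space =
  fixes V :: "('x \<Rightarrow> real) set"
  assumes lin: "v \<in> V \<Longrightarrow> w \<in> V \<Longrightarrow> (\<lambda>x. v x + c * w x) \<in> V"
    and zero: "(\<lambda>x. 0) \<in> V"
begin

lemma lincomb: "finite I \<Longrightarrow> (\<And>i. i \<in> I \<Longrightarrow> b i \<in> V) \<Longrightarrow> (\<lambda>x. \<Sum>i\<in>I. c i * b i x) \<in> V"
proof (induction rule: finite_induct)
  case (insert i I)
  then have "(\<lambda>x. (\<Sum>i\<in>I. c i * b i x) + c i * b i x) \<in> V" by (intro lin) auto
  then show ?case using insert by (simp add: add.commute)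
qed (simp add: zero)

lemma functional_lincomb:
  assumes F: "\<And>v w c. v \<in> V \<Longrightarrow> w \<in> V \<Longrightarrow> F (\<lambda>x. v x + c * w x) = F v + c * F w"
    and "finite I" "\<And>i. i \<in> I \<Longrightarrow> b i \<in> V"
  shows "F (\<lambda>x. \<Sum>i\<in>I. c i * b i x) = (\<Sum>i\<in>I. c i * F (b i) :: real)"
  using assms(2,3)
proof (induction rule: finite_induct)
  case empty
  then show ?case using F[OF zero zero, of "-1"] by simp
next
  case (insert i I)
  have "F (\<lambda>x. (\<Sum>i\<in>I. c i * b i x) + c i * b i x) = F (\<lambda>x. \<Sum>i\<in>I. c i * b i x) + c i * F (b i)"
    using insert by (intro F lincomb) auto
  then show ?case using insert by (simp add: add.commute)
qed

end

text \<open>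
  Gram-Schmidt, by induction on a finite set \<open>Z\<close> of points on which the functions of \<open>V\<close> are
  determined: the functions vanishing at one further point form a subspace of codimension at most
  one, and if it is proper then a missing direction is orthogonalised against its basis.
\<close>

lemma orthonormal_basis_exists:
  fixes a :: "('x \<Rightarrow> real) \<Rightarrow> ('x \<Rightarrow> real) \<Rightarrow> real"
  assumes "finite Z" "function_space V"
    and "\<And>v. v \<in> V \<Longrightarrow> (\<forall>z\<in>Z. v z = 0) \<Longrightarrow> v = (\<lambda>x. 0)"
    and "\<And>v w u c. v \<in> V \<Longrightarrow> w \<in> V \<Longrightarrow> u \<in> V \<Longrightarrow> a (\<lambda>x. v x + c * w x) u = a v u + c * a w u"
    and "\<And>v w. a v w = a w v"
    and "\<And>v. v \<in> V \<Longrightarrow> v \<noteq> (\<lambda>x. 0) \<Longrightarrow> a v v > 0"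
  shows "\<exists>I b. I \<subseteq> Z \<and> (\<forall>i\<in>I. b i \<in> V) \<and> (\<forall>i\<in>I. \<forall>j\<in>I. a (b i) (b j) = (if i = j then 1 else 0)) \<and>
      (\<forall>v\<in>V. \<exists>c. v = (\<lambda>x. \<Sum>i\<in>I. c i * b i x))"
  using assms
proof (induction Z arbitrary: V rule: finite_induct)
  case empty
  then show ?case by (intro exI[of _ "{}"]) auto
next
  case (insert z Z V)
  interpret function_space V by fact
  define V0 where "V0 = {v \<in> V. v z = 0}"
  have "function_space V0"
  proof
    show "(\<lambda>x. v x + c * w x) \<in> V0" if "v \<in> V0" "w \<in> V0" for v w c
      using that lin[of v w c] by (simp add: V0_def)
    show "(\<lambda>x. 0) \<in> V0" using zero by (simp add: V0_def)
  qed
  moreover have "v = (\<lambda>x. 0)" if "v \<in> V0" "\<forall>z\<in>Z. v z = 0" for v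
    using insert.prems(2)[of v] that by (auto simp: V0_def)
  ultimately have "\<exists>I b. I \<subseteq> Z \<and> (\<forall>i\<in>I. b i \<in> V0) \<and> (\<forall>i\<in>I. \<forall>j\<in>I. a (b i) (b j) = (if i = j then 1 else 0)) \<and>
      (\<forall>v\<in>V0. \<exists>c. v = (\<lambda>x. \<Sum>i\<in>I. c i * b i x))"
  proof (rule insert.IH)
    show "a (\<lambda>x. v x + c * w x) u = a v u + c * a w u" if "v \<in> V0" "w \<in> V0" "u \<in> V0" for v w u c
      using that insert.prems(3)[of v w u c] by (simp add: V0_def)
    show "a v v > 0" if "v \<in> V0" "v \<noteq> (\<lambda>x. 0)" for v
      using that insert.prems(5)[of v] by (simp add: V0_def)
  qed (assumption | rule insert.prems(4))+
  then obtain I b where Ib: "I \<subseteq> Z \<and> (\<forall>i\<in>I. b i \<in> V0) \<and>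
      (\<forall>i\<in>I. \<forall>j\<in>I. a (b i) (b j) = (if i = j then 1 else 0)) \<and>
      (\<forall>v\<in>V0. \<exists>c. v = (\<lambda>x. \<Sum>i\<in>I. c i * b i x))"
    by (elim exE)
  then have I: "I \<subseteq> Z" by (elim conjE)
  have b0: "b i \<in> V0" if "i \<in> I" for i using Ib that by (elim conjE) (erule bspec)
  have on: "a (b i) (b j) = (if i = j then 1 else 0)" if "i \<in> I" "j \<in> I" for i j
    using Ib that by (elim conjE) simp
  have span: "\<exists>c. v = (\<lambda>x. \<Sum>i\<in>I. c i * b i x)" if "v \<in> V0" for v
    using Ib that by (elim conjE) (erule bspec)
  have bV: "b i \<in> V" "b i z = 0" if "i \<in> I" for i using b0[OF that] by (auto simp: V0_def)
  have finI: "finite I" using I insert.hyps(1) finite_subset by blast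
  show ?case
  proof (cases "V = V0")
    case True
    then show ?thesis using I b0 on span by (intro exI[of _ I] exI[of _ b]) auto
  next
    case False
    then obtain w0 where w0: "w0 \<in> V" "w0 z \<noteq> 0" by (auto simp: V0_def)
    \<comment> \<open>The functions \<open>b i\<close> vanish at \<open>z\<close>, so subtracting the projection keeps the value \<open>w0 z \<noteq> 0\<close>.\<close>
    define w1 where "w1 = (\<lambda>x. w0 x + (-1) * (\<Sum>i\<in>I. a w0 (b i) * b i x))"
    have w1: "w1 \<in> V" unfolding w1_def by (intro lin w0 lincomb finI bV)
    have w1z: "w1 z = w0 z" by (simp add: w1_def bV)
    have w1b: "a w1 (b j) = 0" if j: "j \<in> I" for j
    proof -
      have "a w1 (b j) = a w0 (b j) + (-1) * a (\<lambda>x. \<Sum>i\<in>I. a w0 (b i) * b i x) (b j)"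
        unfolding w1_def by (intro insert.prems(3) w0 lincomb finI bV j)
      also have "a (\<lambda>x. \<Sum>i\<in>I. a w0 (b i) * b i x) (b j) = (\<Sum>i\<in>I. a w0 (b i) * a (b i) (b j))"
        by (rule functional_lincomb[of "\<lambda>v. a v (b j)"]) (auto intro: insert.prems(3) bV finI j)
      also have "\<dots> = (\<Sum>i\<in>I. if i = j then a w0 (b i) else 0)"
        by (intro sum.cong) (auto simp: on j)
      also have "\<dots> = a w0 (b j)" using finI j by simp
      finally show ?thesis by simp
    qed
    have pos: "a w1 w1 > 0" using insert.prems(5)[OF w1] w1z w0(2) by (metis)
    define r where "r = 1 / sqrt (a w1 w1)"
    define w where "w = (\<lambda>x. 0 + r * w1 x)"
    have r: "r > 0" "r * r * a w1 w1 = 1" using pos by (auto simp: r_def field_simps)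
    have w: "w \<in> V" unfolding w_def by (intro lin zero w1)
    have a_w: "a w u = r * a w1 u" if "u \<in> V" for u
      using insert.prems(3)[OF zero w1 that, of r] insert.prems(3)[OF zero zero that, of "-1"] by (simp add: w_def)
    have ww: "a w w = 1"
      using a_w[OF w] insert.prems(4)[of w1 w] a_w[OF w1] r(2) by simp
    have wb: "a w (b j) = 0" "a (b j) w = 0" if "j \<in> I" for j
      using a_w[OF bV(1)[OF that]] w1b[OF that] insert.prems(4)[of w "b j"] by auto
    have zI: "z \<notin> I" using I insert.hyps(2) by blast
    define b' where "b' = b(z := w)"
    have b'I: "b' i = b i" if "i \<in> I" for i using that zI by (auto simp: b'_def)
    have b'z: "b' z = w" by (simp add: b'_def)
    have "\<exists>c. v = (\<lambda>x. \<Sum>i\<in>insert z I. c i * b' i x)" if v: "v \<in> V" for v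
    proof -
      define t where "t = v z / w z"
      have wz: "w z \<noteq> 0" using r(1) w1z w0(2) by (simp add: w_def)
      have "(\<lambda>x. v x + (- t) * w x) \<in> V0"
        using lin[OF v w, of "- t"] wz by (simp add: V0_def t_def)
      then obtain c where c: "(\<lambda>x. v x + (- t) * w x) = (\<lambda>x. \<Sum>i\<in>I. c i * b i x)"
        using span by blast
      define c' where "c' = c(z := t)"
      have "v x = (\<Sum>i\<in>insert z I. c' i * b' i x)" for x
      proof -
        have "(\<Sum>i\<in>insert z I. c' i * b' i x) = c' z * b' z x + (\<Sum>i\<in>I. c' i * b' i x)"
          using finI zI by simp
        also have "(\<Sum>i\<in>I. c' i * b' i x) = (\<Sum>i\<in>I. c i * b i x)"
          using zI by (intro sum.cong) (auto simp: c'_def b'I)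
        finally show ?thesis using fun_cong[OF c, of x] by (simp add: c'_def b'z)
      qed
      then show ?thesis by blast
    qed
    then show ?thesis
      using I w bV ww wb on zI
      by (intro exI[of _ "insert z I"] exI[of _ b']) (auto simp: b'I b'z)
  qed
qed

text \<open>
  The equation is the Euler-Lagrange equation of the energy
  \<open>a v v / 2 + (\<Sum>z\<in>Z. \<omega> z / 4 \<cdot> (neg_part (v z - \<psi> z)) ^ 4) - l v\<close>. In coordinates with respect to an
  orthonormal basis the quadratic part is the sum of squares of the coordinates, so the energy
  exceeds its value at \<open>0\<close> outside a cube, and on the cube it attains its minimum. The coordinates are
  functions from the index set to the reals, and compactness of the cube is Tychonoff's theorem.
\<close>

lemma semilinear_equation_solvable:
  fixes a :: "('x \<Rightarrow> real) \<Rightarrow> ('x \<Rightarrow> real) \<Rightarrow> real" and l :: "('x \<Rightarrow> real) \<Rightarrow> real"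
  assumes fin: "finite Z" and V: "function_space V"
    and det: "\<And>v. v \<in> V \<Longrightarrow> (\<forall>z\<in>Z. v z = 0) \<Longrightarrow> v = (\<lambda>x. 0)"
    and a_lin: "\<And>v w u c. v \<in> V \<Longrightarrow> w \<in> V \<Longrightarrow> u \<in> V \<Longrightarrow> a (\<lambda>x. v x + c * w x) u = a v u + c * a w u"
    and a_sym: "\<And>v w. a v w = a w v"
    and a_pos: "\<And>v. v \<in> V \<Longrightarrow> v \<noteq> (\<lambda>x. 0) \<Longrightarrow> a v v > 0"
    and l_lin: "\<And>v w c. v \<in> V \<Longrightarrow> w \<in> V \<Longrightarrow> l (\<lambda>x. v x + c * w x) = l v + c * l w"
    and \<omega>: "\<And>z. z \<in> Z \<Longrightarrow> \<omega> z \<ge> 0"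
  shows "\<exists>y\<in>V. \<forall>\<phi>\<in>V. a y \<phi> + (\<Sum>z\<in>Z. \<omega> z * ((neg_part (y z - \<psi> z)) ^ 3 * \<phi> z)) = l \<phi>"
proof -
  interpret function_space V by fact
  have "\<exists>I b. I \<subseteq> Z \<and> (\<forall>i\<in>I. b i \<in> V) \<and>
      (\<forall>i\<in>I. \<forall>j\<in>I. a (b i) (b j) = (if i = j then 1 else 0)) \<and>
      (\<forall>v\<in>V. \<exists>c. v = (\<lambda>x. \<Sum>i\<in>I. c i * b i x))"
    by (rule orthonormal_basis_exists[where a = a, OF fin V det a_lin a_sym a_pos])
  then obtain I b where Ib: "I \<subseteq> Z \<and> (\<forall>i\<in>I. b i \<in> V) \<and>
      (\<forall>i\<in>I. \<forall>j\<in>I. a (b i) (b j) = (if i = j then 1 else 0)) \<and>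
      (\<forall>v\<in>V. \<exists>c. v = (\<lambda>x. \<Sum>i\<in>I. c i * b i x))"
    by (elim exE)
  then have I: "I \<subseteq> Z" by (elim conjE)
  have b: "b i \<in> V" if "i \<in> I" for i using Ib that by (elim conjE) (erule bspec)
  have on: "a (b i) (b j) = (if i = j then 1 else 0)" if "i \<in> I" "j \<in> I" for i j
    using Ib that by (elim conjE) simp
  have span: "\<exists>c. v = (\<lambda>x. \<Sum>i\<in>I. c i * b i x)" if "v \<in> V" for v
    using Ib that by (elim conjE) (erule bspec)
  have finI: "finite I" using I fin finite_subset by blast
  define S where "S c = (\<lambda>x. \<Sum>i\<in>I. c i * b i x)" for c :: "'x \<Rightarrow> real"
  have S: "S c \<in> V" for c unfolding S_def by (rule lincomb[OF finI b])
  have aS: "a (S c) (S c) = (\<Sum>i\<in>I. (c i)\<^sup>2)" for c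
  proof -
    have aSb: "a (S c) (b j) = c j" if j: "j \<in> I" for j
    proof -
      have "a (S c) (b j) = (\<Sum>i\<in>I. c i * a (b i) (b j))"
        unfolding S_def by (rule functional_lincomb[of "\<lambda>v. a v (b j)"]) (auto intro: a_lin b finI j)
      also have "\<dots> = (\<Sum>i\<in>I. if i = j then c i else 0)"
        by (intro sum.cong) (auto simp: on j)
      finally show ?thesis using finI j by simp
    qed
    have "a (S c) (S c) = (\<Sum>i\<in>I. c i * a (b i) (S c))"
      by (subst S_def) (rule functional_lincomb[of "\<lambda>v. a v (S c)"], auto intro: a_lin b finI S)
    also have "\<dots> = (\<Sum>i\<in>I. (c i)\<^sup>2)"
      by (intro sum.cong) (auto simp: a_sym[of "b _"] aSb power2_eq_square)
    finally show ?thesis .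
  qed
  have lS: "l (S c) = (\<Sum>i\<in>I. c i * l (b i))" for c
    unfolding S_def by (rule functional_lincomb) (auto intro: l_lin b finI)
  define E where "E v = a v v / 2 + (\<Sum>z\<in>Z. \<omega> z / 4 * (neg_part (v z - \<psi> z)) ^ 4) - l v" for v
  define L where "L = (\<Sum>i\<in>I. (l (b i))\<^sup>2)"
  have L: "L \<ge> 0" unfolding L_def by (intro sum_nonneg) auto
  have E0: "E (\<lambda>x. 0) \<ge> 0"
  proof -
    have "a (\<lambda>x. 0) (\<lambda>x. 0) = 0" "l (\<lambda>x. 0) = 0"
      using a_lin[OF zero zero zero, of "-1"] l_lin[OF zero zero, of "-1"] by simp_all
    then show ?thesis unfolding E_def using \<omega> by (auto intro!: sum_nonneg)
  qed
  \<comment> \<open>The linear term is absorbed by \<open>(c / 2 - l)\<^sup>2 \<ge> 0\<close>, so one large coordinate makes the energy large.\<close>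
  have coercive: "E (S c) \<ge> (c j)\<^sup>2 / 4 - L" if j: "j \<in> I" for c j
  proof -
    have "(c j)\<^sup>2 / 4 - L \<le> (\<Sum>i\<in>I. (c i)\<^sup>2 / 4) - L"
      using finI j by (intro diff_right_mono member_le_sum) auto
    also have "\<dots> = (\<Sum>i\<in>I. (c i)\<^sup>2 / 4 - (l (b i))\<^sup>2)"
      by (simp add: L_def sum_subtractf)
    also have "\<dots> \<le> (\<Sum>i\<in>I. (c i)\<^sup>2 / 2 - c i * l (b i))"
    proof (rule sum_mono)
      fix i
      have "0 \<le> (c i / 2 - l (b i))\<^sup>2" by simp
      then show "(c i)\<^sup>2 / 4 - (l (b i))\<^sup>2 \<le> (c i)\<^sup>2 / 2 - c i * l (b i)"
        by (simp add: power2_eq_square algebra_simps)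
    qed
    also have "\<dots> = a (S c) (S c) / 2 - l (S c)"
      by (simp add: aS lS sum_subtractf sum_divide_distrib)
    also have "\<dots> \<le> E (S c)"
      unfolding E_def using \<omega> by (auto intro!: sum_nonneg)
    finally show ?thesis .
  qed
  \<comment> \<open>The summand \<open>1\<close> ensures \<open>R \<ge> 1\<close>, so that a coordinate beyond \<open>R\<close> has a square beyond \<open>R\<close>.\<close>
  define R where "R = 4 * (E (\<lambda>x. 0) + L) + 1"
  have R: "R \<ge> 1" using E0 L by (simp add: R_def)
  define K where "K = PiE UNIV (\<lambda>i. if i \<in> I then {- R..R} else {0})"
  have "compactin (product_topology (\<lambda>_. euclideanreal) UNIV) K"
    unfolding K_def compactin_PiE by auto
  then have K: "compact K" by (simp add: euclidean_product_topology)
  have S_cont: "continuous_on UNIV (\<lambda>c. S c x)" for x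
    unfolding S_def by (intro continuous_intros continuous_on_product_coordinates)
  have "continuous_on UNIV (\<lambda>c. E (S c))"
    unfolding E_def aS lS neg_part_def
    by (intro continuous_intros continuous_on_product_coordinates S_cont) simp_all
  then have "continuous_on K (\<lambda>c. E (S c))" by (rule continuous_on_subset) simp
  moreover have zero_in: "(\<lambda>i. 0) \<in> K" using R by (auto simp: K_def)
  ultimately obtain c0 where c0: "c0 \<in> K" "\<And>c. c \<in> K \<Longrightarrow> E (S c0) \<le> E (S c)"
    using continuous_attains_inf[OF K] by (metis empty_iff)
  define y where "y = S c0"
  have y: "y \<in> V" by (simp add: y_def S)
  have min: "E y \<le> E v" if v: "v \<in> V" for v
  proof -
    obtain c1 where c1: "v = (\<lambda>x. \<Sum>i\<in>I. c1 i * b i x)" using span[OF v] by blast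
    define c where "c i = (if i \<in> I then c1 i else 0)" for i
    have vc: "v = S c" unfolding S_def c1 by (intro ext sum.cong) (auto simp: c_def)
    show ?thesis
    proof (cases "c \<in> K")
      case True
      then show ?thesis using c0(2) vc y_def by simp
    next
      case False
      have "\<exists>j\<in>I. \<bar>c j\<bar> > R"
      proof (rule ccontr)
        assume "\<not> (\<exists>j\<in>I. \<bar>c j\<bar> > R)"
        then have le: "\<bar>c i\<bar> \<le> R" if "i \<in> I" for i
          using that by (meson not_le)
        have "c i \<in> (if i \<in> I then {- R..R} else {0})" for i
        proof (cases "i \<in> I")
          case True
          then show ?thesis using le[OF True] by (simp add: abs_le_iff)
        qed (simp add: c_def)
        then have "c \<in> K" unfolding K_def by (intro PiE_I) simp_all
        then show False using False by simp
      qed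
      then obtain j where j: "j \<in> I" "\<bar>c j\<bar> > R" by (elim bexE)
      have "R \<le> R * R" using R by simp
      also have "\<dots> \<le> \<bar>c j\<bar> * \<bar>c j\<bar>" using j(2) R by (intro mult_mono) auto
      finally have "E (\<lambda>x. 0) + L \<le> (c j)\<^sup>2 / 4"
        by (simp add: R_def power2_eq_square)
      then have "E (\<lambda>x. 0) \<le> E (S c)" using coercive[OF j(1), of c] by simp
      moreover have "S (\<lambda>i. 0) = (\<lambda>x. 0)" by (simp add: S_def)
      ultimately show ?thesis using c0(2)[OF zero_in] by (simp add: y_def vc)
    qed
  qed
  have "a y \<phi> + (\<Sum>z\<in>Z. \<omega> z * ((neg_part (y z - \<psi> z)) ^ 3 * \<phi> z)) = l \<phi>" if \<phi>: "\<phi> \<in> V" for \<phi>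
  proof -
    define h where "h t = E (\<lambda>x. y x + t * \<phi> x)" for t
    have h_eq: "h t = (a y y + 2 * t * a y \<phi> + t * t * a \<phi> \<phi>) / 2
        + (\<Sum>z\<in>Z. \<omega> z / 4 * (neg_part (y z + t * \<phi> z - \<psi> z)) ^ 4) - (l y + t * l \<phi>)" for t
    proof -
      let ?u = "\<lambda>x. y x + t * \<phi> x"
      have u: "?u \<in> V" by (rule lin[OF y \<phi>])
      have "a ?u ?u = a y ?u + t * a \<phi> ?u" by (rule a_lin[OF y \<phi> u])
      also have "a y ?u = a y y + t * a \<phi> y" unfolding a_sym[of y ?u] by (rule a_lin[OF y \<phi> y])
      also have "a \<phi> ?u = a y \<phi> + t * a \<phi> \<phi>" unfolding a_sym[of \<phi> ?u] by (rule a_lin[OF y \<phi> \<phi>])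
      finally have "a ?u ?u = a y y + 2 * t * a y \<phi> + t * t * a \<phi> \<phi>"
        using a_sym[of \<phi> y] by (simp add: algebra_simps)
      then show ?thesis unfolding h_def E_def using l_lin[OF y \<phi>] by simp
    qed
    have "((\<lambda>t. (neg_part (y z + t * \<phi> z - \<psi> z)) ^ 4) has_real_derivative
        4 * (neg_part (y z - \<psi> z)) ^ 3 * \<phi> z) (at 0)" for z
    proof -
      have "((\<lambda>t. y z + t * \<phi> z - \<psi> z) has_real_derivative \<phi> z) (at 0)"
        by (auto intro!: derivative_eq_intros)
      from DERIV_chain2[OF neg_part_power4_deriv this] show ?thesis by simp
    qed
    then have "((\<lambda>t. \<Sum>z\<in>Z. \<omega> z / 4 * (neg_part (y z + t * \<phi> z - \<psi> z)) ^ 4) has_real_derivative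
        (\<Sum>z\<in>Z. \<omega> z / 4 * (4 * (neg_part (y z - \<psi> z)) ^ 3 * \<phi> z))) (at 0)"
      by (intro DERIV_sum DERIV_cmult)
    moreover have "(\<Sum>z\<in>Z. \<omega> z / 4 * (4 * (neg_part (y z - \<psi> z)) ^ 3 * \<phi> z))
       = (\<Sum>z\<in>Z. \<omega> z * ((neg_part (y z - \<psi> z)) ^ 3 * \<phi> z))" (is "_ = ?N")
      by (intro sum.cong) auto
    ultimately have D: "((\<lambda>t. \<Sum>z\<in>Z. \<omega> z / 4 * (neg_part (y z + t * \<phi> z - \<psi> z)) ^ 4) has_real_derivative ?N) (at 0)"
      by simp
    have Dh: "(h has_real_derivative (a y \<phi> + ?N - l \<phi>)) (at 0)"
    proof -
      define H where "H t = (\<Sum>z\<in>Z. \<omega> z / 4 * (neg_part (y z + t * \<phi> z - \<psi> z)) ^ 4)" for t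
      have "(H has_real_derivative ?N) (at 0)" using D unfolding H_def .
      then show ?thesis
        unfolding h_eq[abs_def] H_def[symmetric] by (auto intro!: derivative_eq_intros)
    qed
    have "h 0 \<le> h t" for t
      unfolding h_def using min[OF lin[OF y \<phi>, of t]] by simp
    then have "a y \<phi> + ?N - l \<phi> = 0"
      by (intro DERIV_local_min[OF Dh, of 1]) simp_all
    then show ?thesis by simp
  qed
  then show ?thesis using y by blast
qed

section \<open>The discrete state equation\<close>

lemma function_space_FE_space0:
  fixes \<Omega> :: "'a::euclidean_space set"
  assumes "open \<Omega>" "bounded \<Omega>"
  shows "function_space (FE_space0 \<Omega> \<T>)"
proof
  show "(\<lambda>x. v x + c * w x) \<in> FE_space0 \<Omega> \<T>" if "v \<in> FE_space0 \<Omega> \<T>" "w \<in> FE_space0 \<Omega> \<T>" for v w c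
    using that FE_space_lin[of v \<Omega> \<T> w c] H10_lin[OF assms, of v w c] by (simp add: FE_space0_def)
  have "\<exists>a c. \<forall>x\<in>T. (0::real) = a \<bullet> x + c" for T :: "'a set"
    by (intro exI[of _ 0]) simp
  then show "(\<lambda>x. 0) \<in> FE_space0 \<Omega> \<T>"
    using zero_H10[OF assms] by (simp add: FE_space0_def FE_space_def)
qed

lemma FE_space0_regularity:
  assumes "v \<in> FE_space0 \<Omega> \<T>"
  shows "v \<in> FE_space \<Omega> \<T>" "v \<in> H10_space \<Omega>" "v \<in> sobolev 1 \<Omega>" "v \<in> L2_space \<Omega>"
    "continuous_on (closure \<Omega>) v"
  using assms H10_sobolev1 H10_L2 by (auto simp: FE_space0_def FE_space_def)

text \<open>
  Definiteness almost everywhere upgrades to all points by continuity.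
\<close>

lemma FE_space0_definite:
  fixes \<Omega> :: "'a::euclidean_space set"
  assumes \<Omega>: "open \<Omega>" "bounded \<Omega>" and v: "v \<in> FE_space0 \<Omega> \<T>" and le: "dirichlet_form \<Omega> v v \<le> 0"
  shows "v = (\<lambda>x. 0)"
proof -
  define C where "C = {x \<in> closure \<Omega>. v x = 0}"
  have "closed C"
    unfolding C_def by (rule continuous_closed_preimage_constant[OF FE_space0_regularity(5)[OF v] closed_closure])
  have "AE x in lebesgue_on \<Omega>. v x = 0"
    by (rule dirichlet_form_definite[OF \<Omega> FE_space0_regularity(2)[OF v] le])
  then have "AE x\<in>\<Omega> in lebesgue. v x = 0"
    using \<Omega>(1) by (simp add: AE_restrict_space_iff)
  then have "AE x\<in>\<Omega> in lebesgue. x \<in> C"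
    by (rule eventually_mono) (use closure_subset in \<open>auto simp: C_def\<close>)
  then have "\<Omega> \<subseteq> C"
    using mem_closed_if_AE_lebesgue_open[OF \<Omega>(1) \<open>closed C\<close>] by blast
  then have "closure \<Omega> \<subseteq> C" using \<open>closed C\<close> by (rule closure_minimal)
  then show ?thesis
    using FE_space0_regularity(1)[OF v] by (auto simp: C_def FE_space_def fun_eq_iff)
qed

lemma neg_part_cube_mono: "0 \<le> ((neg_part b) ^ 3 - (neg_part a) ^ 3) * (b - a)"
proof (cases "a \<le> b")
  case True
  then have "(neg_part a) ^ 3 \<le> (neg_part b) ^ 3"
    by (intro power_mono_odd) (auto simp: neg_part_def)
  then show ?thesis using True by simp
next
  case False
  then have "(neg_part b) ^ 3 \<le> (neg_part a) ^ 3"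
    by (intro power_mono_odd) (auto simp: neg_part_def)
  then show ?thesis using False by (simp add: mult_nonpos_nonpos)
qed

lemma discrete_state_iff:
  assumes \<Omega>: "open \<Omega>" "bounded \<Omega>" and tri: "admissible_triangulation \<Omega> \<T>"
  shows "discrete_state \<Omega> \<T> \<gamma> \<psi> f u y \<longleftrightarrow> y \<in> FE_space0 \<Omega> \<T> \<and>
    (\<forall>\<phi>\<in>FE_space0 \<Omega> \<T>. dirichlet_form \<Omega> y \<phi>
       + (\<Sum>z\<in>vertices \<T>. (\<gamma>^3 * nodal_weight \<Omega> \<T> z) * ((neg_part (y z - \<psi> z))^3 * \<phi> z))
       = (\<integral>x. (f x + u x) * \<phi> x \<partial>lebesgue_on \<Omega>))"
  unfolding discrete_state_def integral_lagrange_interp[OF assms]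
  by (simp add: sum_distrib_left mult.assoc)

lemma discrete_adjoint_iff:
  assumes \<Omega>: "open \<Omega>" "bounded \<Omega>" and tri: "admissible_triangulation \<Omega> \<T>"
  shows "discrete_adjoint \<Omega> \<T> \<gamma> \<psi> y\<^sub>0 y p \<longleftrightarrow> p \<in> FE_space0 \<Omega> \<T> \<and>
    (\<forall>\<phi>\<in>FE_space0 \<Omega> \<T>. dirichlet_form \<Omega> p \<phi>
       + (\<Sum>z\<in>vertices \<T>. (\<gamma>^3 * nodal_weight \<Omega> \<T> z) * (3 * (neg_part (y z - \<psi> z))\<^sup>2 * p z * \<phi> z))
       = (\<integral>x. (y x - y\<^sub>0 x) * \<phi> x \<partial>lebesgue_on \<Omega>))"
  unfolding discrete_adjoint_def integral_lagrange_interp[OF assms]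
  by (simp add: sum_distrib_left mult_ac)

lemma discrete_state_diff:
  assumes \<Omega>: "open \<Omega>" "bounded \<Omega>" and tri: "admissible_triangulation \<Omega> \<T>"
    and L2: "f \<in> L2_space \<Omega>" "u \<in> L2_space \<Omega>" "v \<in> L2_space \<Omega>"
    and y: "discrete_state \<Omega> \<T> \<gamma> \<psi> f u y" and y': "discrete_state \<Omega> \<T> \<gamma> \<psi> f v y'"
    and \<phi>: "\<phi> \<in> FE_space0 \<Omega> \<T>"
  shows "dirichlet_form \<Omega> (\<lambda>x. y' x - y x) \<phi>
       + (\<Sum>z\<in>vertices \<T>. (\<gamma>^3 * nodal_weight \<Omega> \<T> z)
            * (((neg_part (y' z - \<psi> z))^3 - (neg_part (y z - \<psi> z))^3) * \<phi> z))
       = (\<integral>x. (v x - u x) * \<phi> x \<partial>lebesgue_on \<Omega>)"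
proof -
  note Y = y[unfolded discrete_state_iff[OF \<Omega> tri]] and Y' = y'[unfolded discrete_state_iff[OF \<Omega> tri]]
  note [simp] = L2_space_integrable_mult[OF _ FE_space0_regularity(4)[OF \<phi>]]
  have "dirichlet_form \<Omega> (\<lambda>x. y' x - y x) \<phi> = dirichlet_form \<Omega> y' \<phi> - dirichlet_form \<Omega> y \<phi>"
    using dirichlet_form_lin[OF \<Omega> FE_space0_regularity(3)[OF conjunct1[OF Y']]
        FE_space0_regularity(3)[OF conjunct1[OF Y]] FE_space0_regularity(3)[OF \<phi>], of "-1"] by simp
  moreover have "(\<integral>x. (v x - u x) * \<phi> x \<partial>lebesgue_on \<Omega>)
      = (\<integral>x. (f x + v x) * \<phi> x \<partial>lebesgue_on \<Omega>) - (\<integral>x. (f x + u x) * \<phi> x \<partial>lebesgue_on \<Omega>)"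
    using L2 by (simp add: distrib_right left_diff_distrib)
  moreover have "(\<Sum>z\<in>vertices \<T>. (\<gamma>^3 * nodal_weight \<Omega> \<T> z)
            * (((neg_part (y' z - \<psi> z))^3 - (neg_part (y z - \<psi> z))^3) * \<phi> z))
      = (\<Sum>z\<in>vertices \<T>. (\<gamma>^3 * nodal_weight \<Omega> \<T> z) * ((neg_part (y' z - \<psi> z))^3 * \<phi> z))
      - (\<Sum>z\<in>vertices \<T>. (\<gamma>^3 * nodal_weight \<Omega> \<T> z) * ((neg_part (y z - \<psi> z))^3 * \<phi> z))"
    by (simp add: left_diff_distrib right_diff_distrib sum_subtractf)
  ultimately show ?thesis
    using bspec[OF conjunct2[OF Y] \<phi>] bspec[OF conjunct2[OF Y'] \<phi>] by linarith
qed

lemma FE_space0_diff: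
  fixes \<Omega> :: "'a::euclidean_space set"
  assumes "open \<Omega>" "bounded \<Omega>" "v \<in> FE_space0 \<Omega> \<T>" "w \<in> FE_space0 \<Omega> \<T>"
  shows "(\<lambda>x. v x - w x) \<in> FE_space0 \<Omega> \<T>"
  using function_space.lin[OF function_space_FE_space0[OF assms(1,2)] assms(3,4), of "-1"] by simp

text \<open>
  Testing the difference of the equations with the difference of the states, the monotone
  nonlinearity contributes a nonnegative term, so the Dirichlet energy of the difference vanishes.
\<close>

lemma discrete_state_unique:
  fixes \<Omega> :: "'a::euclidean_space set"
  assumes \<Omega>: "open \<Omega>" "bounded \<Omega>" and tri: "admissible_triangulation \<Omega> \<T>" and \<gamma>: "\<gamma> > 0"
    and L2: "f \<in> L2_space \<Omega>" "u \<in> L2_space \<Omega>"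
    and y: "discrete_state \<Omega> \<T> \<gamma> \<psi> f u y" and y': "discrete_state \<Omega> \<T> \<gamma> \<psi> f u y'"
  shows "y' = y"
proof -
  define e where "e = (\<lambda>x. y' x - y x)"
  have e: "e \<in> FE_space0 \<Omega> \<T>"
    unfolding e_def using y y' by (intro FE_space0_diff \<Omega>) (simp_all add: discrete_state_def)
  have "0 \<le> (\<Sum>z\<in>vertices \<T>. (\<gamma>^3 * nodal_weight \<Omega> \<T> z)
            * (((neg_part (y' z - \<psi> z))^3 - (neg_part (y z - \<psi> z))^3) * e z))"
  proof (rule sum_nonneg)
    fix z
    have "0 \<le> ((neg_part (y' z - \<psi> z))^3 - (neg_part (y z - \<psi> z))^3) * e z"
      using neg_part_cube_mono[of "y' z - \<psi> z" "y z - \<psi> z"] by (simp add: e_def)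
    moreover have "0 \<le> \<gamma>^3 * nodal_weight \<Omega> \<T> z"
      using \<gamma> nodal_weight_nonneg[OF tri] by simp
    ultimately show "0 \<le> (\<gamma>^3 * nodal_weight \<Omega> \<T> z)
        * (((neg_part (y' z - \<psi> z))^3 - (neg_part (y z - \<psi> z))^3) * e z)"
      by (rule mult_nonneg_nonneg[rotated])
  qed
  then have "dirichlet_form \<Omega> e e \<le> 0"
    using discrete_state_diff[OF \<Omega> tri L2(1,2,2) y y' e] by (simp add: e_def[symmetric])
  then have "e = (\<lambda>x. 0)" by (rule FE_space0_definite[OF \<Omega> e])
  then show ?thesis by (auto simp: e_def fun_eq_iff)
qed

lemma discrete_state_exists:
  fixes \<Omega> :: "'a::euclidean_space set"
  assumes \<Omega>: "open \<Omega>" "bounded \<Omega>" and tri: "admissible_triangulation \<Omega> \<T>" and \<gamma>: "\<gamma> > 0"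
    and L2: "f \<in> L2_space \<Omega>" "u \<in> L2_space \<Omega>"
  shows "\<exists>y. discrete_state \<Omega> \<T> \<gamma> \<psi> f u y"
proof -
  let ?V = "FE_space0 \<Omega> \<T>"
  have fu: "(\<lambda>x. f x + u x) \<in> L2_space \<Omega>" using L2_space_lin[OF L2, of 1] by simp
  have "\<exists>y\<in>?V. \<forall>\<phi>\<in>?V. dirichlet_form \<Omega> y \<phi>
      + (\<Sum>z\<in>vertices \<T>. (\<gamma>^3 * nodal_weight \<Omega> \<T> z) * ((neg_part (y z - \<psi> z)) ^ 3 * \<phi> z))
      = (\<integral>x. (f x + u x) * \<phi> x \<partial>lebesgue_on \<Omega>)"
  proof (rule semilinear_equation_solvable[OF finite_vertices[OF tri] function_space_FE_space0[OF \<Omega>]])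
    show "v = (\<lambda>x. 0)" if "v \<in> ?V" "\<forall>z\<in>vertices \<T>. v z = 0" for v
      by (rule FE_space_eqI[OF tri FE_space0_regularity(1)[OF that(1)]
            FE_space0_regularity(1)[OF function_space.zero[OF function_space_FE_space0[OF \<Omega>]]]])
         (use that(2) in simp)
    show "dirichlet_form \<Omega> (\<lambda>x. v x + c * w x) u = dirichlet_form \<Omega> v u + c * dirichlet_form \<Omega> w u"
      if "v \<in> ?V" "w \<in> ?V" "u \<in> ?V" for v w u c
      using that by (intro dirichlet_form_lin[OF \<Omega>] FE_space0_regularity(3))
    show "dirichlet_form \<Omega> v w = dirichlet_form \<Omega> w v" for v w by (rule dirichlet_form_commute)
    show "0 < dirichlet_form \<Omega> v v" if "v \<in> ?V" "v \<noteq> (\<lambda>x. 0)" for v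
      using FE_space0_definite[OF \<Omega> that(1)] that(2) by linarith
    show "(\<integral>x. (f x + u x) * (v x + c * w x) \<partial>lebesgue_on \<Omega>)
        = (\<integral>x. (f x + u x) * v x \<partial>lebesgue_on \<Omega>) + c * (\<integral>x. (f x + u x) * w x \<partial>lebesgue_on \<Omega>)"
      if "v \<in> ?V" "w \<in> ?V" for v w c
    proof -
      have "(\<integral>x. (f x + u x) * (v x + c * w x) \<partial>lebesgue_on \<Omega>)
        = (\<integral>x. (f x + u x) * v x + c * ((f x + u x) * w x) \<partial>lebesgue_on \<Omega>)"
        by (intro Bochner_Integration.integral_cong) (simp_all add: algebra_simps)
      then show ?thesis
        using L2_space_integrable_mult[OF fu FE_space0_regularity(4)[OF that(1)]]
          L2_space_integrable_mult[OF fu FE_space0_regularity(4)[OF that(2)]] by simp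
    qed
    show "0 \<le> \<gamma>^3 * nodal_weight \<Omega> \<T> z" for z
      using \<gamma> nodal_weight_nonneg[OF tri] by simp
  qed
  then show ?thesis unfolding discrete_state_iff[OF \<Omega> tri] by blast
qed

lemma discrete_cost_eq:
  fixes \<Omega> :: "'a::euclidean_space set"
  assumes \<Omega>: "open \<Omega>" "bounded \<Omega>" and tri: "admissible_triangulation \<Omega> \<T>" and \<gamma>: "\<gamma> > 0"
    and L2: "f \<in> L2_space \<Omega>" "u \<in> L2_space \<Omega>"
    and y: "discrete_state \<Omega> \<T> \<gamma> \<psi> f u y"
  shows "discrete_cost \<Omega> \<T> \<gamma> \<alpha> \<psi> f y\<^sub>0 u
     = 1/2 * (\<integral>x. (y x - y\<^sub>0 x)\<^sup>2 \<partial>lebesgue_on \<Omega>) + \<alpha>/2 * (\<integral>x. (u x)\<^sup>2 \<partial>lebesgue_on \<Omega>)"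
proof -
  have "(THE y. discrete_state \<Omega> \<T> \<gamma> \<psi> f u y) = y"
    using y discrete_state_unique[OF \<Omega> tri \<gamma> L2 y] by (rule the_equality)
  then show ?thesis by (simp add: discrete_cost_def L2_norm_power2)
qed

section \<open>The optimality estimate\<close>

text \<open>
  Here \<open>a\<close> and \<open>b\<close> are the obstacle gaps of two states at a vertex. For \<open>a \<ge> 0\<close> the remainder is the
  increment itself, and the hypothesis on \<open>p\<close> is compared with \<open>b - a\<close>. For \<open>a < 0\<close> the hypothesis leaves
  \<open>\<bar>a\<bar> \<cdot> \<bar>R\<bar> / 3 \<le> (g b - g a) \<cdot> (b - a)\<close>, where \<open>R \<le> 0\<close> is the remainder and \<open>g\<close> the cube of the negative part; this is where
  the factor \<open>3\<close> in the definition of \<open>\<eta>\<close> comes from.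
\<close>

lemma neg_part_cube_remainder_le:
  assumes s: "s \<ge> 0"
    and pos: "a > 0 \<Longrightarrow> - s * a \<le> p" and zero: "a = 0 \<Longrightarrow> 0 \<le> p" and neg: "a < 0 \<Longrightarrow> s * a \<le> 3 * p"
  shows "p * ((neg_part b)^3 - (neg_part a)^3 - 3 * (neg_part a)\<^sup>2 * (b - a))
     \<le> s * (((neg_part b)^3 - (neg_part a)^3) * (b - a))"
proof -
  consider "a > 0" "b \<ge> 0" | "a > 0" "b < 0" | "a = 0" | "a < 0" "b \<le> 0" | "a < 0" "b > 0" by linarith
  then show ?thesis
  proof cases
    case 1
    then show ?thesis by (simp add: neg_part_def)
  next
    case 2
    have "s * b \<le> 0" using s 2 by (simp add: mult_nonneg_nonpos)
    then have "s * (b - a) \<le> p" using pos 2 by (simp add: algebra_simps)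
    moreover have "b ^ 3 \<le> 0" using 2 by (simp add: power_le_zero_eq)
    ultimately have "p * b ^ 3 \<le> s * (b - a) * b ^ 3" by (rule mult_right_mono_neg)
    then show ?thesis using 2 by (simp add: neg_part_def mult_ac)
  next
    case 3
    have "(neg_part b) ^ 3 \<le> 0" by (simp add: neg_part_def power_le_zero_eq)
    then have "p * (neg_part b) ^ 3 \<le> 0" using zero 3 by (simp add: mult_nonneg_nonpos)
    moreover have "0 \<le> s * ((neg_part b) ^ 3 * b)"
      using s neg_part_cube_mono[of b 0] by (simp add: neg_part_def)
    ultimately show ?thesis using 3 by (simp add: neg_part_def)
  next
    case 4
    have na: "neg_part a = a" "neg_part b = b" using 4 by (simp_all add: neg_part_def)
    have R: "b^3 - a^3 - 3 * a\<^sup>2 * (b - a) = (b - a)\<^sup>2 * (b + 2 * a)"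
      by (simp add: power2_eq_square power3_eq_cube algebra_simps)
    have "3 * (p * ((b - a)\<^sup>2 * (b + 2 * a))) = 3 * p * ((b - a)\<^sup>2 * (b + 2 * a))" by simp
    also have "\<dots> \<le> s * a * ((b - a)\<^sup>2 * (b + 2 * a))"
      using neg 4 by (intro mult_right_mono_neg) (auto simp: mult_nonneg_nonpos)
    also have "\<dots> = s * ((b - a)\<^sup>2 * (a * b + 2 * a\<^sup>2))"
      by (simp add: power2_eq_square algebra_simps)
    also have "\<dots> \<le> s * ((b - a)\<^sup>2 * (3 * (a\<^sup>2 + a * b + b\<^sup>2)))"
    proof (intro mult_left_mono s)
      have "0 \<le> (a + b)\<^sup>2 + 2 * b\<^sup>2" by simp
      then show "a * b + 2 * a\<^sup>2 \<le> 3 * (a\<^sup>2 + a * b + b\<^sup>2)"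
        by (simp add: power2_eq_square algebra_simps)
    qed auto
    also have "\<dots> = 3 * (s * ((b^3 - a^3) * (b - a)))"
      by (simp add: power2_eq_square power3_eq_cube algebra_simps)
    finally show ?thesis unfolding na R by (rule mult_left_le_imp_le) simp
  next
    case 5
    have na: "neg_part a = a" "neg_part b = 0" using 5 by (simp_all add: neg_part_def)
    have R: "0^3 - a^3 - 3 * a\<^sup>2 * (b - a) = a\<^sup>2 * (2 * a - 3 * b)"
      by (simp add: power2_eq_square power3_eq_cube algebra_simps)
    have "3 * (p * (a\<^sup>2 * (2 * a - 3 * b))) = 3 * p * (a\<^sup>2 * (2 * a - 3 * b))" by simp
    also have "\<dots> \<le> s * a * (a\<^sup>2 * (2 * a - 3 * b))"
      using neg 5 by (intro mult_right_mono_neg) (auto simp: mult_nonneg_nonpos)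
    also have "\<dots> = s * (a\<^sup>2 * (2 * a\<^sup>2 - 3 * (a * b)))"
      by (simp add: power2_eq_square algebra_simps)
    also have "\<dots> \<le> s * (a\<^sup>2 * (3 * a\<^sup>2 - 3 * (a * b)))"
      by (intro mult_left_mono s diff_right_mono) simp_all
    also have "\<dots> = 3 * (s * ((0^3 - a^3) * (b - a)))"
      by (simp add: power2_eq_square power3_eq_cube algebra_simps)
    finally show ?thesis unfolding na R by (rule mult_left_le_imp_le) simp
  qed
qed

lemma lambda1_le:
  assumes "v \<in> H10_space \<Omega>"
  shows "lambda1 \<Omega> * (\<integral>x. (v x)\<^sup>2 \<partial>lebesgue_on \<Omega>) \<le> dirichlet_form \<Omega> v v"
proof (cases "AE x in lebesgue_on \<Omega>. v x = 0")
  case True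
  then have "(\<integral>x. (v x)\<^sup>2 \<partial>lebesgue_on \<Omega>) = 0"
    by (intro integral_eq_zero_AE) (rule eventually_mono, assumption, simp)
  then show ?thesis by (simp add: dirichlet_form_nonneg)
next
  case False
  have "(\<integral>x. (v x)\<^sup>2 \<partial>lebesgue_on \<Omega>) \<noteq> 0"
    using False integral_nonneg_eq_0_iff_AE[OF L2_space_integrable_power2[OF H10_L2[OF assms]]] by simp
  moreover have "(\<integral>x. (v x)\<^sup>2 \<partial>lebesgue_on \<Omega>) \<ge> 0" by (intro Bochner_Integration.integral_nonneg) simp
  ultimately have pos: "(\<integral>x. (v x)\<^sup>2 \<partial>lebesgue_on \<Omega>) > 0" by linarith
  have "lambda1 \<Omega> \<le> dirichlet_form \<Omega> v v / (\<integral>x. (v x)\<^sup>2 \<partial>lebesgue_on \<Omega>)"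
    unfolding lambda1_def
  proof (rule cINF_lower)
    show "bdd_below ((\<lambda>\<phi>. dirichlet_form \<Omega> \<phi> \<phi> / (\<integral>x. (\<phi> x)\<^sup>2 \<partial>lebesgue_on \<Omega>)) `
        {\<phi> \<in> H10_space \<Omega>. \<not> (AE x in lebesgue_on \<Omega>. \<phi> x = 0)})"
      by (intro bdd_belowI2[of _ 0] divide_nonneg_nonneg dirichlet_form_nonneg Bochner_Integration.integral_nonneg) simp
  qed (use assms False in simp)
  then show ?thesis using pos by (simp add: pos_le_divide_eq)
qed

text \<open>
  Both hypotheses amount to a bound of \<open>\<bar>s - m\<bar>\<close> by the square root, since the square root also
  exceeds \<open>\<bar>m\<bar>\<close> and \<open>s \<ge> 0\<close>.
\<close>

lemma quadratic_threshold:
  fixes s m \<alpha> :: real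
  assumes "0 \<le> s" "\<alpha> > 0"
  shows "s \<le> m + sqrt (m\<^sup>2 + \<alpha>) \<Longrightarrow> s\<^sup>2 \<le> 2 * s * m + \<alpha>"
    and "s < m + sqrt (m\<^sup>2 + \<alpha>) \<Longrightarrow> s\<^sup>2 < 2 * s * m + \<alpha>"
proof -
  let ?D = "sqrt (m\<^sup>2 + \<alpha>)"
  have D: "?D\<^sup>2 = m\<^sup>2 + \<alpha>" "?D \<ge> 0" using assms(2) by (simp_all add: add_nonneg_nonneg)
  have m: "\<bar>m\<bar> < ?D" using assms(2) by (intro real_less_rsqrt) simp
  have sq: "(s - m)\<^sup>2 = s\<^sup>2 - 2 * s * m + m\<^sup>2" by (simp add: power2_eq_square algebra_simps)
  show "s\<^sup>2 \<le> 2 * s * m + \<alpha>" if "s \<le> m + ?D"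
  proof -
    have "\<bar>s - m\<bar> \<le> \<bar>?D\<bar>" using that m assms(1) D(2) by linarith
    then show ?thesis using D(1) sq unfolding abs_le_square_iff by linarith
  qed
  show "s\<^sup>2 < 2 * s * m + \<alpha>" if "s < m + ?D"
  proof -
    have "\<bar>s - m\<bar> < ?D" using that m assms(1) by linarith
    then have "\<bar>s - m\<bar>\<^sup>2 < ?D\<^sup>2" by (intro power_strict_mono) auto
    then show ?thesis using D(1) sq by simp
  qed
qed

text \<open>
  The quantitative core. The parameter \<open>s\<close> stands for \<open>\<bar>\<eta>\<bar>\<close>, and the three hypotheses at interior
  vertices are what its definition provides. Multiplication by \<open>2 \<cdot> \<alpha>\<close> makes the square on the left
  free of denominators. When the coefficient of \<open>\<integral> e\<^sup>2\<close> is positive, equality of the costs forces first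
  \<open>e = 0\<close> and then \<open>w = 0\<close> almost everywhere.
\<close>

lemma cost_gap:
  fixes \<Omega> :: "'a::euclidean_space set"
  assumes \<Omega>: "open \<Omega>" "bounded \<Omega>" "interior (closure \<Omega>) = \<Omega>"
    and tri: "admissible_triangulation \<Omega> \<T>" and \<gamma>: "\<gamma> > 0" and \<alpha>: "\<alpha> > 0"
    and L2: "f \<in> L2_space \<Omega>" "y\<^sub>0 \<in> L2_space \<Omega>" "u \<in> L2_space \<Omega>" "v \<in> L2_space \<Omega>"
    and y: "discrete_state \<Omega> \<T> \<gamma> \<psi> f u y" and y': "discrete_state \<Omega> \<T> \<gamma> \<psi> f v y'"
    and p: "discrete_adjoint \<Omega> \<T> \<gamma> \<psi> y\<^sub>0 y p"
    and up: "AE x in lebesgue_on \<Omega>. \<alpha> * u x + p x = 0"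
    and s: "s \<ge> 0"
    and pos: "\<And>z. z \<in> interior_vertices \<Omega> \<T> \<Longrightarrow> y z > \<psi> z \<Longrightarrow> - s * (y z - \<psi> z) \<le> p z"
    and zero: "\<And>z. z \<in> interior_vertices \<Omega> \<T> \<Longrightarrow> y z = \<psi> z \<Longrightarrow> 0 \<le> p z"
    and neg: "\<And>z. z \<in> interior_vertices \<Omega> \<T> \<Longrightarrow> y z < \<psi> z \<Longrightarrow> s * (y z - \<psi> z) \<le> 3 * p z"
  defines "e \<equiv> \<lambda>x. y' x - y x" and "w \<equiv> \<lambda>x. v x - u x"
  shows "(\<integral>x. (s * e x - \<alpha> * w x)\<^sup>2 \<partial>lebesgue_on \<Omega>)
      + (2 * s * (\<alpha> * lambda1 \<Omega>) + \<alpha> - s\<^sup>2) * (\<integral>x. (e x)\<^sup>2 \<partial>lebesgue_on \<Omega>)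
    \<le> 2 * \<alpha> * (discrete_cost \<Omega> \<T> \<gamma> \<alpha> \<psi> f y\<^sub>0 v - discrete_cost \<Omega> \<T> \<gamma> \<alpha> \<psi> f y\<^sub>0 u)"
proof -
  let ?M = "lebesgue_on \<Omega>"
  let ?\<omega> = "\<lambda>z. \<gamma>^3 * nodal_weight \<Omega> \<T> z"
  let ?g = "\<lambda>y z. (neg_part (y z - \<psi> z))^3"
  have yV: "y \<in> FE_space0 \<Omega> \<T>" "y' \<in> FE_space0 \<Omega> \<T>"
    using y y' by (simp_all add: discrete_state_def)
  have pV: "p \<in> FE_space0 \<Omega> \<T>" using p by (simp add: discrete_adjoint_def)
  have eV: "e \<in> FE_space0 \<Omega> \<T>" unfolding e_def by (rule FE_space0_diff[OF \<Omega>(1,2) yV(2,1)])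
  have eL: "e \<in> L2_space \<Omega>" and pL: "p \<in> L2_space \<Omega>" and yL: "y \<in> L2_space \<Omega>"
    using eV pV yV by (simp_all add: FE_space0_regularity(4))
  have wL: "w \<in> L2_space \<Omega>" unfolding w_def by (rule L2_space_diff[OF L2(4,3)])
  have dL: "(\<lambda>x. y x - y\<^sub>0 x) \<in> L2_space \<Omega>" by (rule L2_space_diff[OF yL L2(2)])
  note int = L2_space_integrable_mult L2_space_integrable_power2 eL pL yL wL dL L2
  define A where "A = (\<integral>x. (e x)\<^sup>2 \<partial>?M)"
  define W where "W = (\<integral>x. (w x)\<^sup>2 \<partial>?M)"
  define X where "X = (\<integral>x. w x * e x \<partial>?M)"
  define P where "P = (\<integral>x. w x * p x \<partial>?M)"
  define D where "D = (\<integral>x. (y x - y\<^sub>0 x) * e x \<partial>?M)"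
  have "(\<integral>x. (y' x - y\<^sub>0 x)\<^sup>2 \<partial>?M) = (\<integral>x. (y x - y\<^sub>0 x)\<^sup>2 + 2 * ((y x - y\<^sub>0 x) * e x) + (e x)\<^sup>2 \<partial>?M)"
    by (intro Bochner_Integration.integral_cong) (simp_all add: e_def power2_eq_square algebra_simps)
  also have "\<dots> = (\<integral>x. (y x - y\<^sub>0 x)\<^sup>2 \<partial>?M) + 2 * D + A"
    unfolding D_def A_def by (simp add: int)
  finally have cost_y: "(\<integral>x. (y' x - y\<^sub>0 x)\<^sup>2 \<partial>?M) = (\<integral>x. (y x - y\<^sub>0 x)\<^sup>2 \<partial>?M) + 2 * D + A" .
  have "(\<integral>x. (v x)\<^sup>2 \<partial>?M) = (\<integral>x. (u x)\<^sup>2 + 2 * (w x * u x) + (w x)\<^sup>2 \<partial>?M)"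
    by (intro Bochner_Integration.integral_cong) (simp_all add: w_def power2_eq_square algebra_simps)
  also have "\<dots> = (\<integral>x. (u x)\<^sup>2 \<partial>?M) + 2 * (\<integral>x. w x * u x \<partial>?M) + W"
    unfolding W_def by (simp add: int)
  finally have cost_v: "(\<integral>x. (v x)\<^sup>2 \<partial>?M) = (\<integral>x. (u x)\<^sup>2 \<partial>?M) + 2 * (\<integral>x. w x * u x \<partial>?M) + W" .
  have "AE x in ?M. \<alpha> * (w x * u x) = - (w x * p x)"
    using up
  proof eventually_elim
    case (elim x)
    then have "\<alpha> * u x = - p x" by linarith
    then have "w x * (\<alpha> * u x) = w x * (- p x)" by (simp only:)
    then show ?case by (simp add: mult_ac)
  qed
  then have "(\<integral>x. \<alpha> * (w x * u x) \<partial>?M) = (\<integral>x. - (w x * p x) \<partial>?M)"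
    by (intro integral_cong_AE borel_measurable_integrable) (simp_all add: int)
  then have control: "\<alpha> * (\<integral>x. w x * u x \<partial>?M) = - P" by (simp add: P_def)
  have cost: "discrete_cost \<Omega> \<T> \<gamma> \<alpha> \<psi> f y\<^sub>0 v - discrete_cost \<Omega> \<T> \<gamma> \<alpha> \<psi> f y\<^sub>0 u
      = D - P + A / 2 + \<alpha> / 2 * W"
    unfolding discrete_cost_eq[OF \<Omega>(1,2) tri \<gamma> L2(1,3) y] discrete_cost_eq[OF \<Omega>(1,2) tri \<gamma> L2(1,4) y']
      cost_y cost_v using control by (simp add: algebra_simps)
  \<comment> \<open>The energy \<open>dirichlet_form \<Omega> p e\<close> cancels between the first two equations.\<close>
  have adj: "dirichlet_form \<Omega> p e
       + (\<Sum>z\<in>vertices \<T>. ?\<omega> z * (3 * (neg_part (y z - \<psi> z))\<^sup>2 * p z * e z)) = D"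
    using p eV unfolding discrete_adjoint_iff[OF \<Omega>(1,2) tri] D_def by simp
  have st_p: "dirichlet_form \<Omega> p e + (\<Sum>z\<in>vertices \<T>. ?\<omega> z * ((?g y' z - ?g y z) * p z)) = P"
    using discrete_state_diff[OF \<Omega>(1,2) tri L2(1,3,4) y y' pV] dirichlet_form_commute[of \<Omega> p e]
    by (simp add: e_def w_def P_def)
  have st_e: "dirichlet_form \<Omega> e e + (\<Sum>z\<in>vertices \<T>. ?\<omega> z * ((?g y' z - ?g y z) * e z)) = X"
    using discrete_state_diff[OF \<Omega>(1,2) tri L2(1,3,4) y y' eV] by (simp add: e_def w_def X_def)
  have "P - D = (\<Sum>z\<in>vertices \<T>. ?\<omega> z * (p z * (?g y' z - ?g y z - 3 * (neg_part (y z - \<psi> z))\<^sup>2 * e z)))"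
    unfolding adj[symmetric] st_p[symmetric]
    by (simp add: sum_subtractf[symmetric]) (intro sum.cong, auto simp: algebra_simps)
  also have "\<dots> \<le> (\<Sum>z\<in>vertices \<T>. ?\<omega> z * (s * ((?g y' z - ?g y z) * e z)))"
  proof (intro sum_mono mult_left_mono)
    fix z assume z: "z \<in> vertices \<T>"
    show "p z * (?g y' z - ?g y z - 3 * (neg_part (y z - \<psi> z))\<^sup>2 * e z) \<le> s * ((?g y' z - ?g y z) * e z)"
    proof (cases "z \<in> \<Omega>")
      case True
      then have zi: "z \<in> interior_vertices \<Omega> \<T>" using z by (simp add: interior_vertices_def)
      have ez: "e z = (y' z - \<psi> z) - (y z - \<psi> z)" by (simp add: e_def)
      show ?thesis
        unfolding ez using pos[OF zi] zero[OF zi] neg[OF zi]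
        by (intro neg_part_cube_remainder_le s) auto
    next
      case False
      \<comment> \<open>At a boundary vertex \<open>e\<close> vanishes, so the two states coincide and both sides are \<open>0\<close>.\<close>
      have "z \<in> closure \<Omega>" using z vertices_subset_closure[OF tri] by blast
      then have "e z = 0"
        using H10_continuous_zero_on_frontier[OF \<Omega> FE_space0_regularity(2)[OF eV] FE_space0_regularity(5)[OF eV] _ False]
        by simp
      then have "y' z = y z" by (simp add: e_def)
      then show ?thesis using \<open>e z = 0\<close> by simp
    qed
    show "0 \<le> ?\<omega> z" using \<gamma> nodal_weight_nonneg[OF tri] by simp
  qed
  also have "\<dots> = s * (\<Sum>z\<in>vertices \<T>. ?\<omega> z * ((?g y' z - ?g y z) * e z))"
    by (simp add: sum_distrib_left mult_ac)
  also have "\<dots> = s * (X - dirichlet_form \<Omega> e e)"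
    unfolding st_e[symmetric] by simp
  also have "\<dots> \<le> s * (X - lambda1 \<Omega> * A)"
    using lambda1_le[OF FE_space0_regularity(2)[OF eV]] s unfolding A_def by (intro mult_left_mono) auto
  finally have "D - P \<ge> s * (lambda1 \<Omega> * A - X)" by (simp add: algebra_simps)
  then have main: "s * (lambda1 \<Omega> * A - X) + A / 2 + \<alpha> / 2 * W
      \<le> discrete_cost \<Omega> \<T> \<gamma> \<alpha> \<psi> f y\<^sub>0 v - discrete_cost \<Omega> \<T> \<gamma> \<alpha> \<psi> f y\<^sub>0 u"
    unfolding cost by simp
  have "(\<integral>x. (s * e x - \<alpha> * w x)\<^sup>2 \<partial>?M) = (\<integral>x. s\<^sup>2 * (e x)\<^sup>2 - 2 * s * \<alpha> * (w x * e x) + \<alpha>\<^sup>2 * (w x)\<^sup>2 \<partial>?M)"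
    by (intro Bochner_Integration.integral_cong) (simp_all add: power2_eq_square algebra_simps)
  also have "\<dots> = s\<^sup>2 * A - 2 * s * \<alpha> * X + \<alpha>\<^sup>2 * W"
    unfolding A_def X_def W_def by (simp add: int)
  finally have "(\<integral>x. (s * e x - \<alpha> * w x)\<^sup>2 \<partial>?M) + (2 * s * (\<alpha> * lambda1 \<Omega>) + \<alpha> - s\<^sup>2) * A
      = 2 * \<alpha> * (s * (lambda1 \<Omega> * A - X) + A / 2 + \<alpha> / 2 * W)"
    by (simp add: power2_eq_square algebra_simps)
  also have "\<dots> \<le> 2 * \<alpha> * (discrete_cost \<Omega> \<T> \<gamma> \<alpha> \<psi> f y\<^sub>0 v - discrete_cost \<Omega> \<T> \<gamma> \<alpha> \<psi> f y\<^sub>0 u)"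
    using main \<alpha> by (intro mult_left_mono) auto
  finally show ?thesis unfolding A_def .
qed

theorem theorem2p2:
  fixes \<Omega> :: "'a::euclidean_space set"
    and \<T> :: "'a set set"
    and \<psi> y\<^sub>0 f u\<^sub>h y\<^sub>h p\<^sub>h :: "'a \<Rightarrow> real"
    and \<alpha> \<gamma> \<eta> :: real
  assumes "DIM('a) = 2 \<or> DIM('a) = 3"
    and "bounded \<Omega>" and "polyhedral_domain \<Omega>"
    and "\<psi> \<in> H10_space \<Omega> \<inter> sobolev 2 \<Omega>" and "continuous_on (closure \<Omega>) \<psi>"
    and "y\<^sub>0 \<in> L2_space \<Omega>" and "f \<in> L2_space \<Omega>"
    and "\<alpha> > 0" and "\<gamma> > 0"
    and "admissible_triangulation \<Omega> \<T>"
    and "u\<^sub>h \<in> L2_space \<Omega>"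
    and "discrete_state \<Omega> \<T> \<gamma> \<psi> f u\<^sub>h y\<^sub>h"
    and "discrete_adjoint \<Omega> \<T> \<gamma> \<psi> y\<^sub>0 y\<^sub>h p\<^sub>h"
    and "AE x in lebesgue_on \<Omega>. \<alpha> * u\<^sub>h x + p\<^sub>h x = 0"
    and "\<forall>z\<in>interior_vertices \<Omega> \<T>. y\<^sub>h z - \<psi> z = 0 \<longrightarrow> p\<^sub>h z \<ge> 0"
    and "\<eta> = Min ({p\<^sub>h z / (y\<^sub>h z - \<psi> z) | z. z \<in> interior_vertices \<Omega> \<T> \<and> y\<^sub>h z > \<psi> z}
                 \<union> {3 * p\<^sub>h z / (\<psi> z - y\<^sub>h z) | z. z \<in> interior_vertices \<Omega> \<T> \<and> y\<^sub>h z < \<psi> z}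
                 \<union> {0})"
  shows "(\<bar>\<eta>\<bar> \<le> \<alpha> * lambda1 \<Omega> + sqrt (\<alpha>\<^sup>2 * (lambda1 \<Omega>)\<^sup>2 + \<alpha>)
            \<longrightarrow> global_minimum \<Omega> \<T> \<gamma> \<alpha> \<psi> f y\<^sub>0 u\<^sub>h)
       \<and> (\<bar>\<eta>\<bar> < \<alpha> * lambda1 \<Omega> + sqrt (\<alpha>\<^sup>2 * (lambda1 \<Omega>)\<^sup>2 + \<alpha>)
            \<longrightarrow> global_minimum \<Omega> \<T> \<gamma> \<alpha> \<psi> f y\<^sub>0 u\<^sub>h
              \<and> (\<forall>v. global_minimum \<Omega> \<T> \<gamma> \<alpha> \<psi> f y\<^sub>0 v
                     \<longrightarrow> (AE x in lebesgue_on \<Omega>. v x = u\<^sub>h x)))"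
proof -
  have \<Omega>: "open \<Omega>" "bounded \<Omega>" "interior (closure \<Omega>) = \<Omega>"
    using assms(2,3) by (simp_all add: polyhedral_domain_def)
  note tri = assms(10)
  let ?Pos = "{p\<^sub>h z / (y\<^sub>h z - \<psi> z) | z. z \<in> interior_vertices \<Omega> \<T> \<and> y\<^sub>h z > \<psi> z}"
  let ?Neg = "{3 * p\<^sub>h z / (\<psi> z - y\<^sub>h z) | z. z \<in> interior_vertices \<Omega> \<T> \<and> y\<^sub>h z < \<psi> z}"
  have "finite (interior_vertices \<Omega> \<T>)"
    unfolding interior_vertices_def using finite_vertices[OF tri] by simp
  then have fin: "finite (?Pos \<union> ?Neg \<union> {0})" by simp
  have \<eta>_le: "\<eta> \<le> t" if "t \<in> ?Pos \<union> ?Neg \<union> {0}" for t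
    unfolding assms(16) using fin that by (rule Min_le)
  have \<eta>0: "\<eta> \<le> 0" by (rule \<eta>_le) simp
  define s where "s = \<bar>\<eta>\<bar>"
  have s: "s \<ge> 0" "\<eta> = - s" using \<eta>0 by (simp_all add: s_def)
  have pos: "- s * (y\<^sub>h z - \<psi> z) \<le> p\<^sub>h z" if z: "z \<in> interior_vertices \<Omega> \<T>" "y\<^sub>h z > \<psi> z" for z
  proof -
    have "\<eta> \<le> p\<^sub>h z / (y\<^sub>h z - \<psi> z)" by (rule \<eta>_le) (use z in blast)
    then show ?thesis using z(2) by (simp add: s(2) pos_le_divide_eq)
  qed
  have neg: "s * (y\<^sub>h z - \<psi> z) \<le> 3 * p\<^sub>h z" if z: "z \<in> interior_vertices \<Omega> \<T>" "y\<^sub>h z < \<psi> z" for z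
  proof -
    have "\<eta> \<le> 3 * p\<^sub>h z / (\<psi> z - y\<^sub>h z)" by (rule \<eta>_le) (use z in blast)
    then have "- s * (\<psi> z - y\<^sub>h z) \<le> 3 * p\<^sub>h z" using z(2) by (simp add: s(2) pos_le_divide_eq)
    then show ?thesis by (simp add: algebra_simps)
  qed
  have zero: "0 \<le> p\<^sub>h z" if "z \<in> interior_vertices \<Omega> \<T>" "y\<^sub>h z = \<psi> z" for z
    using assms(15) that by simp
  let ?J = "discrete_cost \<Omega> \<T> \<gamma> \<alpha> \<psi> f y\<^sub>0"
  define \<kappa> where "\<kappa> = 2 * s * (\<alpha> * lambda1 \<Omega>) + \<alpha> - s\<^sup>2"
  have gap: "\<exists>e. e \<in> L2_space \<Omega> \<and> (\<integral>x. (s * e x - \<alpha> * (v x - u\<^sub>h x))\<^sup>2 \<partial>lebesgue_on \<Omega>)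
      + \<kappa> * (\<integral>x. (e x)\<^sup>2 \<partial>lebesgue_on \<Omega>) \<le> 2 * \<alpha> * (?J v - ?J u\<^sub>h)"
    if v: "v \<in> L2_space \<Omega>" for v
  proof -
    obtain y' where y': "discrete_state \<Omega> \<T> \<gamma> \<psi> f v y'"
      using discrete_state_exists[OF \<Omega>(1,2) tri assms(9,7) v] by blast
    have "y' \<in> FE_space0 \<Omega> \<T>" "y\<^sub>h \<in> FE_space0 \<Omega> \<T>"
      using y' assms(12) by (simp_all add: discrete_state_def)
    then have "(\<lambda>x. y' x - y\<^sub>h x) \<in> L2_space \<Omega>"
      by (intro L2_space_diff) (rule FE_space0_regularity(4), assumption)+
    moreover have "(\<integral>x. (s * (y' x - y\<^sub>h x) - \<alpha> * (v x - u\<^sub>h x))\<^sup>2 \<partial>lebesgue_on \<Omega>)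
      + \<kappa> * (\<integral>x. (y' x - y\<^sub>h x)\<^sup>2 \<partial>lebesgue_on \<Omega>) \<le> 2 * \<alpha> * (?J v - ?J u\<^sub>h)"
      unfolding \<kappa>_def
      by (rule cost_gap[OF \<Omega> tri assms(9,8,7,6,11) v assms(12) y' assms(13,14) s(1) pos zero neg])
    ultimately show ?thesis
      by (intro exI[of _ "\<lambda>x. y' x - y\<^sub>h x"] conjI)
  qed
  have nonneg: "0 \<le> (\<integral>x. (h x)\<^sup>2 \<partial>lebesgue_on \<Omega>)" for h :: "'a \<Rightarrow> real"
    by (intro Bochner_Integration.integral_nonneg) simp
  have min: "global_minimum \<Omega> \<T> \<gamma> \<alpha> \<psi> f y\<^sub>0 u\<^sub>h" if \<kappa>: "\<kappa> \<ge> 0"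
    unfolding global_minimum_def
  proof (intro conjI ballI assms(11))
    fix v assume "v \<in> L2_space \<Omega>"
    then obtain e where "(\<integral>x. (s * e x - \<alpha> * (v x - u\<^sub>h x))\<^sup>2 \<partial>lebesgue_on \<Omega>)
      + \<kappa> * (\<integral>x. (e x)\<^sup>2 \<partial>lebesgue_on \<Omega>) \<le> 2 * \<alpha> * (?J v - ?J u\<^sub>h)" using gap by blast
    moreover have "0 \<le> (\<integral>x. (s * e x - \<alpha> * (v x - u\<^sub>h x))\<^sup>2 \<partial>lebesgue_on \<Omega>)
      + \<kappa> * (\<integral>x. (e x)\<^sup>2 \<partial>lebesgue_on \<Omega>)"
      by (intro add_nonneg_nonneg mult_nonneg_nonneg nonneg \<kappa>)
    ultimately have "0 \<le> 2 * \<alpha> * (?J v - ?J u\<^sub>h)" by linarith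
    then show "?J u\<^sub>h \<le> ?J v" using assms(8) by (simp add: zero_le_mult_iff)
  qed
  have unique: "AE x in lebesgue_on \<Omega>. v x = u\<^sub>h x"
    if \<kappa>: "\<kappa> > 0" and v: "global_minimum \<Omega> \<T> \<gamma> \<alpha> \<psi> f y\<^sub>0 v" for v
  proof -
    have vL: "v \<in> L2_space \<Omega>" and "?J v \<le> ?J u\<^sub>h"
      using v assms(11) by (simp_all add: global_minimum_def)
    obtain e where eL: "e \<in> L2_space \<Omega>" and e: "(\<integral>x. (s * e x - \<alpha> * (v x - u\<^sub>h x))\<^sup>2 \<partial>lebesgue_on \<Omega>)
      + \<kappa> * (\<integral>x. (e x)\<^sup>2 \<partial>lebesgue_on \<Omega>) \<le> 2 * \<alpha> * (?J v - ?J u\<^sub>h)" using gap[OF vL] by blast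
    have "2 * \<alpha> * (?J v - ?J u\<^sub>h) \<le> 0"
      using \<open>?J v \<le> ?J u\<^sub>h\<close> assms(8) by (simp add: mult_nonneg_nonpos)
    then have sum0: "(\<integral>x. (s * e x - \<alpha> * (v x - u\<^sub>h x))\<^sup>2 \<partial>lebesgue_on \<Omega>) + \<kappa> * (\<integral>x. (e x)\<^sup>2 \<partial>lebesgue_on \<Omega>) \<le> 0"
      using e by linarith
    have nn: "0 \<le> (\<integral>x. (s * e x - \<alpha> * (v x - u\<^sub>h x))\<^sup>2 \<partial>lebesgue_on \<Omega>)" "0 \<le> \<kappa> * (\<integral>x. (e x)\<^sup>2 \<partial>lebesgue_on \<Omega>)"
      using \<kappa> by (intro nonneg mult_nonneg_nonneg; simp)+
    then have "\<kappa> * (\<integral>x. (e x)\<^sup>2 \<partial>lebesgue_on \<Omega>) = 0" and q0: "(\<integral>x. (s * e x - \<alpha> * (v x - u\<^sub>h x))\<^sup>2 \<partial>lebesgue_on \<Omega>) = 0"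
      using sum0 by linarith+
    then have e0: "(\<integral>x. (e x)\<^sup>2 \<partial>lebesgue_on \<Omega>) = 0" using \<kappa> by simp
    have qL: "(\<lambda>x. s * e x - \<alpha> * (v x - u\<^sub>h x)) \<in> L2_space \<Omega>"
    proof -
      have "(\<lambda>x. 0) \<in> L2_space \<Omega>" by (simp add: L2_space_def)
      from L2_space_lin[OF L2_space_lin[OF this eL, of s] L2_space_diff[OF vL assms(11)], of "- \<alpha>"]
      show ?thesis by simp
    qed
    have "AE x in lebesgue_on \<Omega>. e x = 0"
      using e0 integral_nonneg_eq_0_iff_AE[OF L2_space_integrable_power2[OF eL]] by simp
    moreover have "AE x in lebesgue_on \<Omega>. s * e x - \<alpha> * (v x - u\<^sub>h x) = 0"
      using q0 integral_nonneg_eq_0_iff_AE[OF L2_space_integrable_power2[OF qL]] by simp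
    ultimately show ?thesis
      by eventually_elim (use assms(8) in simp)
  qed
  have \<kappa>_nonneg: "\<kappa> \<ge> 0" if "\<bar>\<eta>\<bar> \<le> \<alpha> * lambda1 \<Omega> + sqrt (\<alpha>\<^sup>2 * (lambda1 \<Omega>)\<^sup>2 + \<alpha>)"
    using quadratic_threshold(1)[OF s(1) assms(8), of "\<alpha> * lambda1 \<Omega>"] that
    by (simp add: \<kappa>_def s_def power_mult_distrib)
  have \<kappa>_pos: "\<kappa> > 0" if "\<bar>\<eta>\<bar> < \<alpha> * lambda1 \<Omega> + sqrt (\<alpha>\<^sup>2 * (lambda1 \<Omega>)\<^sup>2 + \<alpha>)"
    using quadratic_threshold(2)[OF s(1) assms(8), of "\<alpha> * lambda1 \<Omega>"] that
    by (simp add: \<kappa>_def s_def power_mult_distrib)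
  show ?thesis
    using min unique \<kappa>_nonneg \<kappa>_pos by (meson less_imp_le)
qed

end
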